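(* Let $\{a^{(0)}_{\ell m},b^{(0)}_\ell\}$ and $\{a^{(1)}_{\ell m},b^{(1)}_\ell\}$ be two sets of bounded Jacobi parameters on $\mathbb{Z}^\nu$, and let $u^{(0)},u^{(1)}$ be positive sequences on $\mathbb{Z}^\nu$ satisfying, for $i=0,1$, $$\sum_{m:\,|m-\ell|=1}a^{(i)}_{\ell m}u^{(i)}_m+b^{(i)}_\ell u^{(i)}_\ell=0\qquad\text{for all }\ell\in\mathbb{Z}^\nu.$$ Let $$\beta_+=\sup_\ell\Bigl(\frac{u^{(0)}_\ell}{u^{(1)}_\ell}\Bigr)^2,\qquad \beta_-=\inf_\ell\Bigl(\frac{u^{(0)}_\ell}{u^{(1)}_\ell}\Bigr)^2,\qquad \gamma_-=\inf_{|j-\ell|=1}\frac{a^{(0)}_{j\ell}u^{(0)}_ju^{(0)}_\ell}{a^{(1)}_{j\ell}u^{(1)}_ju^{(1)}_\ell}.$$ Suppose $\beta_+<\infty$ and $\beta_->0$, and put $\eta=\gamma_-/\beta_-$, $\beta=\beta_+/\beta_-$. Then for all perturbations $\{\delta a_{\ell m},\delta b_\ell\}$ with $a^{(0)}_{\ell m}+\delta a_{\ell m}>0$ and every $j\ge1$, $$E_j\bigl(\{a^{(0)}_{\ell m}+\delta a_{\ell m},\,b^{(0)}_\ell+\delta b_\ell\}\bigr)\le E_j\Bigl(\Bigl\{\eta a^{(1)}_{\ell m},\ \eta b^{(1)}_\ell+\beta\Bigl[|\delta b_\ell|+\sum_{m:\,|m-\ell|=1}|\delta a_{\ell m}|\B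igr]\Bigr\}\Bigr).$$
   Context: Jacobi parameters on $\mathbb{Z}^\nu$ are symmetric $a_{\ell m}=a_{m\ell}>0$ for $\ell,m\in\mathbb{Z}^\nu$ with $|\ell-m|=1$ (nearest neighbors, $m=\ell\pm\delta_j$ with $\delta_j$ the standard basis vectors) and real $b_\ell$, $\ell\in\mathbb{Z}^\nu$; bounded means $\sup|b_\ell|+\sup|a_{\ell m}|<\infty$. The associated Jacobi operator $J=J(\{a_{\ell m}\},\{b_\ell\})$ on $\ell^2(\mathbb{Z}^\nu)$ is $$(J\varphi)_\ell=\sum_{m:\,|m-\ell|=1}a_{\ell m}\varphi_m+b_\ell\varphi_\ell$$ (the same formula is used if some coefficients $a_{\ell m}$ vanish). Perturbations $\delta a_{\ell m}$ (symmetric, real) and $\delta b_\ell$ (real) are such that the perturbed parameters are bounded. $E_j(\{a_{\ell m},b_\ell\})$ is the maximum of $0$ and the $j$-th eigenvalue (with multiplicity) of $J(\{a_{\ell m}\},\{b_\ell\})$ counting from the top; precisely $E_j=\max\bigl(0,\ \sup\{\lambda:\dim\operatorname{Ran}P_{[\lambda,\infty)}(J)\ge j\}\bigr)$ with $P_I(J)$ the spectral projections of $J$. *)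

theory Defs
  imports "HOL-Analysis.Analysis" "HOL-Library.Function_Algebras"
begin

section \<open>The Hilbert space of square-summable functions\<close>

definition l2 :: "('i \<Rightarrow> complex) set" where
  "l2 = {\<phi>. (\<lambda>i. (cmod (\<phi> i))\<^sup>2) summable_on UNIV}"

definition l2_inner :: "('i \<Rightarrow> complex) \<Rightarrow> ('i \<Rightarrow> complex) \<Rightarrow> complex" where
  "l2_inner \<phi> \<psi> = (\<Sum>\<^sub>\<infinity>i. cnj (\<phi> i) * \<psi> i)"

definition l2_norm :: "('i \<Rightarrow> complex) \<Rightarrow> real" where
  "l2_norm \<phi> = sqrt (\<Sum>\<^sub>\<infinity>i. (cmod (\<phi> i))\<^sup>2)"

abbreviation cscale :: "complex \<Rightarrow> ('i \<Rightarrow> complex) \<Rightarrow> 'i \<Rightarrow> complex" where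
  "cscale c \<phi> \<equiv> (\<lambda>i. c * \<phi> i)"

text \<open>The statement \<open>dim V \<ge> j\<close> over the complex numbers. It is phrased through
  independent subsets because the library's \<open>dim\<close> is \<open>0\<close> on infinite-dimensional spaces.\<close>

definition dim_at_least :: "nat \<Rightarrow> ('i \<Rightarrow> complex) set \<Rightarrow> bool" where
  "dim_at_least j V \<longleftrightarrow>
     (\<exists>S\<subseteq>V. finite S \<and> card S = j \<and> \<not> module.dependent cscale S)"


section \<open>Spectral measures and spectral projections\<close>

text \<open>Operators on \<^term>\<open>l2\<close> are total functions of which only the restriction to \<^term>\<open>l2\<close>
  matters.\<close>

definition orthogonal_projection :: "(('i \<Rightarrow> complex) \<Rightarrow> ('i \<Rightarrow> complex)) \<Rightarrow> bool" where
  "orthogonal_projection P \<longleftrightarrow>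
     (\<forall>\<phi>\<in>l2. P \<phi> \<in> l2) \<and>
     (\<forall>\<phi>\<in>l2. \<forall>\<psi>\<in>l2. P (\<phi> + \<psi>) = P \<phi> + P \<psi>) \<and>
     (\<forall>c. \<forall>\<phi>\<in>l2. P (cscale c \<phi>) = cscale c (P \<phi>)) \<and>
     (\<forall>\<phi>\<in>l2. P (P \<phi>) = P \<phi>) \<and>
     (\<forall>\<phi>\<in>l2. \<forall>\<psi>\<in>l2. l2_inner \<phi> (P \<psi>) = l2_inner (P \<phi>) \<psi>)"

definition projection_valued_measure ::
    "(real set \<Rightarrow> ('i \<Rightarrow> complex) \<Rightarrow> ('i \<Rightarrow> complex)) \<Rightarrow> bool" where
  "projection_valued_measure P \<longleftrightarrow>
     (\<forall>B\<in>sets borel. orthogonal_projection (P B)) \<and>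
     (\<forall>\<phi>\<in>l2. P UNIV \<phi> = \<phi>) \<and>
     (\<forall>B :: nat \<Rightarrow> real set. range B \<subseteq> sets borel \<longrightarrow> disjoint_family B \<longrightarrow>
        (\<forall>\<phi>\<in>l2. (\<lambda>N. l2_norm ((\<Sum>n<N. P (B n) \<phi>) - P (\<Union>n. B n) \<phi>)) \<longlonglongrightarrow> 0))"

text \<open>The scalar measure \<open>B \<mapsto> \<langle>\<phi>, P(B)\<phi>\<rangle>\<close>.\<close>

definition scalar_measure ::
    "(real set \<Rightarrow> ('i \<Rightarrow> complex) \<Rightarrow> ('i \<Rightarrow> complex)) \<Rightarrow> ('i \<Rightarrow> complex) \<Rightarrow> real measure" where
  "scalar_measure P \<phi> =
     measure_of UNIV (sets borel) (\<lambda>B. ennreal (Re (l2_inner \<phi> (P B \<phi>))))"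

text \<open>\<open>A = \<integral> x dP(x)\<close> in the weak sense, for an everywhere defined \<open>A\<close>. By polarization the
  diagonal matrix elements determine \<open>A\<close>.\<close>

definition spectral_measure_of ::
    "(('i \<Rightarrow> complex) \<Rightarrow> ('i \<Rightarrow> complex)) \<Rightarrow>
     (real set \<Rightarrow> ('i \<Rightarrow> complex) \<Rightarrow> ('i \<Rightarrow> complex)) \<Rightarrow> bool" where
  "spectral_measure_of A P \<longleftrightarrow>
     projection_valued_measure P \<and>
     (\<forall>\<phi>\<in>l2. integrable (scalar_measure P \<phi>) (\<lambda>x. x) \<and>
        l2_inner \<phi> (A \<phi>) = complex_of_real (\<integral>x. x \<partial>scalar_measure P \<phi>))"

text \<open>By the spectral theorem, a bounded self-adjoint \<open>A\<close> has a spectral measure, which is unique on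
  Borel sets and \<^term>\<open>l2\<close>; \<open>SOME\<close> only fixes the irrelevant values elsewhere.\<close>

definition spectral_projection ::
    "(('i \<Rightarrow> complex) \<Rightarrow> ('i \<Rightarrow> complex)) \<Rightarrow> real set \<Rightarrow> ('i \<Rightarrow> complex) \<Rightarrow> ('i \<Rightarrow> complex)" where
  "spectral_projection A = (SOME P. spectral_measure_of A P)"


section \<open>Jacobi operators\<close>

text \<open>The lattice is \<^typ>\<open>int ^ 'n\<close>, of dimension \<open>CARD('n)\<close>. Off-diagonal coefficients are
  functions of two arbitrary sites, but only their values at neighbors are ever used or
  constrained.\<close>

definition nearest_neighbors :: "int ^ 'n \<Rightarrow> int ^ 'n \<Rightarrow> bool" where
  "nearest_neighbors l m \<longleftrightarrow> (\<exists>k. m = l + axis k 1 \<or> m = l - axis k 1)"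

definition nn_symmetric :: "(int ^ 'n \<Rightarrow> int ^ 'n \<Rightarrow> real) \<Rightarrow> bool" where
  "nn_symmetric a \<longleftrightarrow> (\<forall>l m. nearest_neighbors l m \<longrightarrow> a l m = a m l)"

definition nn_positive :: "(int ^ 'n \<Rightarrow> int ^ 'n \<Rightarrow> real) \<Rightarrow> bool" where
  "nn_positive a \<longleftrightarrow> (\<forall>l m. nearest_neighbors l m \<longrightarrow> a l m > 0)"

definition bounded_parameters ::
    "(int ^ 'n \<Rightarrow> int ^ 'n \<Rightarrow> real) \<Rightarrow> (int ^ 'n \<Rightarrow> real) \<Rightarrow> bool" where
  "bounded_parameters a b \<longleftrightarrow>
     bounded {a l m | l m. nearest_neighbors l m} \<and> bounded (range b)"

definition bounded_jacobi_parameters ::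
    "(int ^ 'n \<Rightarrow> int ^ 'n \<Rightarrow> real) \<Rightarrow> (int ^ 'n \<Rightarrow> real) \<Rightarrow> bool" where
  "bounded_jacobi_parameters a b \<longleftrightarrow>
     nn_symmetric a \<and> nn_positive a \<and> bounded_parameters a b"

definition jacobi_operator ::
    "(int ^ 'n \<Rightarrow> int ^ 'n \<Rightarrow> real) \<Rightarrow> (int ^ 'n \<Rightarrow> real) \<Rightarrow>
     (int ^ 'n \<Rightarrow> complex) \<Rightarrow> (int ^ 'n \<Rightarrow> complex)" where
  "jacobi_operator a b \<phi> =
     (\<lambda>l. (\<Sum>m | nearest_neighbors l m. complex_of_real (a l m) * \<phi> m) +
          complex_of_real (b l) * \<phi> l)"

text \<open>For bounded parameters and \<open>j \<ge> 1\<close> the set below is nonempty and bounded above by the norm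
  of the operator, so the real supremum is the actual one.\<close>

definition jacobi_E ::
    "nat \<Rightarrow> (int ^ 'n \<Rightarrow> int ^ 'n \<Rightarrow> real) \<Rightarrow> (int ^ 'n \<Rightarrow> real) \<Rightarrow> real" where
  "jacobi_E j a b =
     max 0 (Sup {x. dim_at_least j (spectral_projection (jacobi_operator a b) {x..} ` l2)})"

end

theory Submission imports Defs "HOL-Probability.Probability" begin

text \<open>
  The eigenvalues are compared through quadratic forms. Write \<open>\<phi> = u0 f\<close>. Since \<open>u0\<close> is a positive null
  solution of the first operator \<open>J0\<close>, the form of \<open>J0\<close> at \<open>\<phi>\<close> is minus one half of the sum over directed bonds of
  \<open>a0(l,m) u0(l) u0(m) |f(l) - f(m)|\<^sup>2\<close> (lemma \<open>ground_state_representation\<close>), and likewise for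
  \<open>J1\<close> at \<open>\<psi> = u1 f\<close>. Bond by bond the two sums compare with the constant \<open>\<gamma>_minus\<close>. The perturbation
  contributes at most the potential \<open>W(l) = |\<delta>b(l)| + (\<Sum>m. |\<delta>a(l,m)|)\<close>, because
  \<open>2 |\<phi>(l) \<phi>(m)| \<le> |\<phi>(l)|\<^sup>2 + |\<phi>(m)|\<^sup>2\<close> (lemma \<open>jacobi_form_le_potential\<close>), and
  \<open>|\<phi>|\<^sup>2 \<le> \<beta>_plus |\<psi>|\<^sup>2\<close> pointwise. So the form of the perturbed operator at \<open>\<phi>\<close> is at most \<open>\<beta>_minus\<close> times
  the form at \<open>\<psi>\<close> of the operator on the right-hand side, while \<open>\<parallel>\<phi>\<parallel>\<^sup>2 \<ge> \<beta>_minus \<parallel>\<psi>\<parallel>\<^sup>2\<close>. Hence, for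
  \<open>x > 0\<close>, the injective map \<open>\<phi> \<mapsto> (u1/u0) \<phi>\<close> carries a subspace on which the first form is at least
  \<open>x \<parallel>\<phi>\<parallel>\<^sup>2\<close> to a subspace of the same dimension with the same property for the second form.

  The passage between such subspaces and spectral projections is the min-max principle
  (theorem \<open>sup_spectrum_le\<close>): if a subspace on which the form is at least \<open>x \<parallel>\<phi>\<parallel>\<^sup>2\<close> is projected to the range
  of \<open>P[x,\<infinity>)\<close>, nothing nonzero is lost, since at every nonzero \<open>\<phi>\<close> in the kernel of \<open>P[x,\<infinity>)\<close> the form is
  less than \<open>x \<parallel>\<phi>\<parallel>\<^sup>2\<close>.

  The spectral projections are chosen by \<open>SOME\<close>, so they have these properties only once a spectral
  measure is known to exist. This is the spectral theorem, theorem
  \<open>spectral_theorem_bounded_symmetric\<close>. After rescaling, the operator is a \<open>T\<close> with \<open>0 \<le> T \<le> 1\<close>. The operators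
  \<open>T\<^sup>k (1 - T)\<^sup>m\<close> are positive, so \<open>p \<mapsto> \<langle>x, p(T) x\<rangle>\<close> is nonnegative on the Bernstein polynomials, and
  the solution of the Hausdorff moment problem (theorem \<open>hausdorff_moment_measure\<close>) represents it
  by a measure on the unit interval. The map \<open>p \<mapsto> p(T) x\<close> is then an isometry from the polynomials with the
  norm of that \<open>L\<^sup>2\<close> space; as polynomials are dense there, it extends to indicator functions,
  and the images of \<open>1\<^sub>B\<close> are the spectral projections.
\<close>

section \<open>The Hausdorff moment problem\<close>

text \<open>
  A ratio of binomial coefficients is a falling-factorial analogue of a power. Factor by factor the two
  products differ by at most \<open>m / (n - m)\<close>, which tends to zero uniformly in \<open>k\<close>.
\<close>

lemma binomial_ratio_power_diff:
  assumes "k \<le> n" "2 * m \<le> n" "0 < n"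
  shows "\<bar>real (k choose m) / real (n choose m) - (real k / real n) ^ m\<bar>
           \<le> real m * (real m / (real n - real m))"
proof -
  define z where "z i = (real k - real i) / (real n - real i)" for i
  have ratio: "real (k choose m) / real (n choose m) = (\<Prod>i\<in>{0..<m}. z i)"
    unfolding z_def binomial_gbinomial gbinomial_prod_rev prod_dividef by simp
  have pow: "(real k / real n) ^ m = (\<Prod>i\<in>{0..<m}. real k / real n)"
    by simp
  have z_le: "norm (z i) \<le> 1" if "i \<in> {0..<m}" for i
    using that assms by (auto simp: z_def divide_simps abs_if)
  have q_le: "norm (real k / real n) \<le> 1"
    using assms by auto
  have diff: "norm (z i - real k / real n) \<le> real m / (real n - real m)" if "i \<in> {0..<m}" for i
  proof -
    have i: "real i < real m" "2 * real m \<le> real n" "real k \<le> real n" "0 < real n"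
      using that assms by auto
    have "z i - real k / real n = - (real i * (real n - real k)) / (real n * (real n - real i))"
      using i by (simp add: z_def field_simps)
    then have "norm (z i - real k / real n) = (real i / (real n - real i)) * ((real n - real k) / real n)"
      using i by (simp add: abs_mult)
    also have "\<dots> \<le> (real i / (real n - real i)) * 1"
      using i by (intro mult_left_mono) auto
    also have "\<dots> \<le> real m / (real n - real m)"
      using i by (simp add: frac_le)
    finally show ?thesis .
  qed
  have "norm ((\<Prod>i\<in>{0..<m}. z i) - (\<Prod>i\<in>{0..<m}. real k / real n))
      \<le> (\<Sum>i\<in>{0..<m}. norm (z i - real k / real n))"
    by (rule norm_prod_diff) (use z_le q_le in auto)
  also have "\<dots> \<le> (\<Sum>i\<in>{0..<m}. real m / (real n - real m))"
    using diff by (rule sum_mono)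
  finally show ?thesis
    unfolding ratio pow by simp
qed

text \<open>
  The factorial moments of the binomial distribution, as a polynomial identity: \<open>(k choose m) (n choose k)\<close>
  equals \<open>(n choose m) (n - m choose k - m)\<close>, and the remaining sum is a power of \<open>x + y\<close>.
\<close>

lemma Bernstein_factorial_moment:
  fixes x y :: "'a :: comm_ring_1"
  assumes "x + y = 1" "m \<le> n"
  shows "(\<Sum>k\<le>n. of_nat (k choose m) * (of_nat (n choose k) * (x ^ k * y ^ (n - k))))
           = of_nat (n choose m) * x ^ m"
proof -
  have "(\<Sum>k\<le>n. of_nat (k choose m) * (of_nat (n choose k) * (x ^ k * y ^ (n - k))))
      = (\<Sum>k\<in>{m..n}. of_nat (k choose m) * (of_nat (n choose k) * (x ^ k * y ^ (n - k))))"
    by (rule sum.mono_neutral_right) (auto simp: binomial_eq_0)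
  also have "\<dots> = (\<Sum>i\<le>n - m. of_nat ((m + i) choose m) * (of_nat (n choose (m + i)) * (x ^ (m + i) * y ^ (n - (m + i)))))"
    by (rule sum.reindex_bij_witness[of _ "\<lambda>i. m + i" "\<lambda>k. k - m"]) (use assms in auto)
  also have "\<dots> = (\<Sum>i\<le>n - m. of_nat (n choose m) * x ^ m * (of_nat ((n - m) choose i) * x ^ i * y ^ ((n - m) - i)))"
  proof (rule sum.cong[OF refl])
    fix i assume "i \<in> {..n - m}"
    then have "(n choose (m + i)) * ((m + i) choose m) = (n choose m) * ((n - m) choose i)"
      using choose_mult[of m "m + i" n] assms by simp
    then have *: "of_nat ((m + i) choose m) * of_nat (n choose (m + i)) = (of_nat (n choose m) * of_nat ((n - m) choose i) :: 'a)"
      by (metis mult.commute of_nat_mult)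
    have "of_nat ((m + i) choose m) * (of_nat (n choose (m + i)) * (x ^ (m + i) * y ^ (n - (m + i))))
        = (of_nat ((m + i) choose m) * of_nat (n choose (m + i))) * (x ^ (m + i) * y ^ (n - (m + i)))"
      by (simp add: mult.assoc)
    also have "\<dots> = of_nat (n choose m) * x ^ m * (of_nat ((n - m) choose i) * x ^ i * y ^ ((n - m) - i))"
      unfolding * by (simp add: power_add algebra_simps)
    finally show "of_nat ((m + i) choose m) * (of_nat (n choose (m + i)) * (x ^ (m + i) * y ^ (n - (m + i))))
        = of_nat (n choose m) * x ^ m * (of_nat ((n - m) choose i) * x ^ i * y ^ ((n - m) - i))" .
  qed
  also have "\<dots> = of_nat (n choose m) * x ^ m * (x + y) ^ (n - m)"
    by (simp add: binomial_ring sum_distrib_left)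
  finally show ?thesis
    using assms by simp
qed

text \<open>
  A positive functional gives the weights \<open>L((n choose k) t\<^sup>k (1 - t)\<^sup>n\<^sup>-\<^sup>k)\<close> of a probability measure on
  the points \<open>k / n\<close>. The factorial moments of these measures reproduce \<open>L\<close> exactly, their ordinary moments
  do so in the limit, and Helly's selection theorem supplies a limit measure.
\<close>

theorem hausdorff_moment_measure:
  fixes L :: "real poly \<Rightarrow> real"
  assumes add: "\<And>p q. L (p + q) = L p + L q"
    and smult: "\<And>c p. L (smult c p) = c * L p"
    and one: "L 1 = 1"
    and pos: "\<And>k m. 0 \<le> L ([:0, 1:] ^ k * [:1, -1:] ^ m)"
  obtains M where "prob_space M" "sets M = sets borel" "AE t in M. t \<in> {0..1}"
    "\<And>p. (\<integral>t. poly p t \<partial>M) = L p"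
proof -
  have L_zero: "L 0 = 0"
    using smult[of 0 0] by simp
  have L_sum: "L (sum f I) = (\<Sum>i\<in>I. L (f i))" if "finite I" for f :: "nat \<Rightarrow> real poly" and I
    using that by (induction I) (auto simp: add L_zero)
  have L_of_nat: "L (of_nat c * p) = real c * L p" for c p
    using smult[of "real c" p] by (simp add: of_nat_poly)
  define w where "w n k = real (n choose k) * L ([:0, 1:] ^ k * [:1, -1:] ^ (n - k))" for n k
  have w_nonneg: "0 \<le> w n k" for n k
    using pos by (simp add: w_def)
  have w_moment: "(\<Sum>k\<le>n. real (k choose m) * w n k) = real (n choose m) * L ([:0, 1:] ^ m)"
    if "m \<le> n" for m n
  proof -
    have "(\<Sum>k\<le>n. real (k choose m) * w n k)
        = L (\<Sum>k\<le>n. of_nat (k choose m) * (of_nat (n choose k) * ([:0, 1:] ^ k * [:1, -1:] ^ (n - k))))"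
      by (simp add: L_sum L_of_nat w_def)
    also have "\<dots> = L (of_nat (n choose m) * [:0, 1:] ^ m)"
      by (subst Bernstein_factorial_moment) (use that in \<open>auto simp: one_pCons\<close>)
    finally show ?thesis
      by (simp add: L_of_nat)
  qed
  have w_sum: "(\<Sum>k\<le>n. w n k) = 1" for n
    using w_moment[of 0 n] one by simp

  have mono: "(\<lambda>n. \<Sum>k\<le>n. w n k * (real k / real n) ^ m) \<longlonglongrightarrow> L ([:0, 1:] ^ m)" for m
  proof -
    have bound: "norm ((\<Sum>k\<le>n. w n k * (real k / real n) ^ m) - L ([:0, 1:] ^ m)) \<le> real m * (real m / (real n - real m))"
      if n: "n \<ge> 2 * m + 1" for n
    proof -
      have "L ([:0, 1:] ^ m) = (\<Sum>k\<le>n. w n k * (real (k choose m) / real (n choose m)))"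
        using w_moment[of m n] n by (simp add: field_simps flip: sum_divide_distrib)
      then have "norm ((\<Sum>k\<le>n. w n k * (real k / real n) ^ m) - L ([:0, 1:] ^ m))
          = norm (\<Sum>k\<le>n. w n k * (real (k choose m) / real (n choose m) - (real k / real n) ^ m))"
        by (simp add: sum_subtractf algebra_simps abs_minus_commute)
      also have "\<dots> \<le> (\<Sum>k\<le>n. w n k * (real m * (real m / (real n - real m))))"
        using n w_nonneg
        by (intro sum_norm_le) (auto simp: abs_mult simp del: times_divide_eq_right intro!: mult_left_mono binomial_ratio_power_diff)
      also have "\<dots> = real m * (real m / (real n - real m))"
        unfolding sum_distrib_right[symmetric] w_sum by simp
      finally show ?thesis .
    qed
    have "(\<lambda>n. (\<Sum>k\<le>n. w n k * (real k / real n) ^ m) - L ([:0, 1:] ^ m)) \<longlonglongrightarrow> 0"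
    proof (rule Lim_null_comparison)
      show "\<forall>\<^sub>F n in sequentially. norm ((\<Sum>k\<le>n. w n k * (real k / real n) ^ m) - L ([:0, 1:] ^ m))
              \<le> real m * (real m / (real n - real m))"
        using bound eventually_sequentially by blast
      show "(\<lambda>n. real m * (real m / (real n - real m))) \<longlonglongrightarrow> 0"
      proof (intro tendsto_mult_right_zero tendsto_divide_0[OF tendsto_const] filterlim_at_top_imp_at_infinity)
        show "filterlim (\<lambda>n. real n - real m) at_top sequentially"
          using filterlim_tendsto_add_at_top[OF tendsto_const filterlim_real_sequentially, of "- real m"] by simp
      qed
    qed
    then show ?thesis
      by (simp add: LIM_zero_iff)
  qed
  have lim: "(\<lambda>n. \<Sum>k\<le>n. w n k * poly p (real k / real n)) \<longlonglongrightarrow> L p" for p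
  proof -
    have "(\<lambda>n. \<Sum>m\<le>degree p. coeff p m * (\<Sum>k\<le>n. w n k * (real k / real n) ^ m))
        \<longlonglongrightarrow> (\<Sum>m\<le>degree p. coeff p m * L ([:0, 1:] ^ m))"
      by (intro tendsto_intros mono)
    moreover have "(\<Sum>m\<le>degree p. coeff p m * (\<Sum>k\<le>n. w n k * (real k / real n) ^ m))
        = (\<Sum>k\<le>n. w n k * poly p (real k / real n))" for n
      unfolding poly_altdef sum_distrib_left by (subst sum.swap) (simp add: algebra_simps)
    moreover have "(\<Sum>m\<le>degree p. coeff p m * L ([:0, 1:] ^ m)) = L p"
    proof -
      have "L p = L (\<Sum>m\<le>degree p. smult (coeff p m) ([:0, 1:] ^ m))"
        by (simp add: poly_as_sum_of_monoms flip: monom_altdef)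
      then show ?thesis
        by (simp add: L_sum smult)
    qed
    ultimately show ?thesis
      by simp
  qed

  define \<mu> where "\<mu> n = distr (point_measure {..n} (w n)) borel (\<lambda>k. real k / real n)" for n
  have meas: "(\<lambda>k. real k / real n) \<in> measurable (point_measure {..n} (w n)) borel" for n
    by (simp add: measurable_def space_point_measure sets_point_measure)
  have int: "(\<integral>t. f t \<partial>\<mu> n) = (\<Sum>k\<le>n. w n k * f (real k / real n))"
    if "f \<in> borel_measurable borel" for f :: "real \<Rightarrow> real" and n
    unfolding \<mu>_def using that meas w_nonneg
    by (subst integral_distr) (auto simp: lebesgue_integral_point_measure_finite)
  have prob: "prob_space (\<mu> n)" for n
    unfolding \<mu>_def
  proof (rule prob_space.prob_space_distr[OF _ meas])
    show "prob_space (point_measure {..n} (w n))"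
      by (rule prob_spaceI)
         (use w_nonneg w_sum in \<open>simp add: emeasure_point_measure_finite space_point_measure\<close>)
  qed
  then have real_distr: "real_distribution (\<mu> n)" for n
    by (simp add: real_distribution_def real_distribution_axioms_def \<mu>_def)
  \<comment> \<open>The window is half-open on the left, so it has to start below zero to contain the unit interval.\<close>
  have conc: "measure (\<mu> n) {-1<..2} = 1" for n
  proof -
    interpret prob_space "\<mu> n" by (rule prob)
    have "measure (\<mu> n) {-1<..2} = (\<integral>t. indicator {-1<..2} t \<partial>\<mu> n)"
      by (simp add: \<mu>_def)
    also have "\<dots> = (\<Sum>k\<le>n. w n k * indicator {-1<..2} (real k / real n))"
      by (rule int) simp
    also have "\<dots> = (\<Sum>k\<le>n. w n k)"
    proof (intro sum.cong refl)
      fix k assume "k \<in> {..n}"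
      then have "real k / real n \<le> 1" by (auto simp: divide_le_eq_1)
      moreover have "0 \<le> real k / real n" by simp
      ultimately have "real k / real n \<in> {-1<..2}" unfolding greaterThanAtMost_iff by linarith
      then show "w n k * indicator {-1<..2} (real k / real n) = w n k" by simp
    qed
    finally show ?thesis
      by (simp add: w_sum)
  qed
  have "tight \<mu>"
    unfolding tight_def
  proof (intro conjI allI impI real_distr)
    fix \<epsilon> :: real assume "\<epsilon> > 0"
    then show "\<exists>a b. a < b \<and> (\<forall>n. measure (\<mu> n) {a<..b} > 1 - \<epsilon>)"
      by (intro exI[of _ "-1"] exI[of _ 2]) (simp add: conc)
  qed
  then obtain r M where r: "strict_mono r" and M: "real_distribution M" and weak: "weak_conv_m (\<mu> \<circ> id \<circ> r) M"
    using tight_imp_convergent_subsubsequence[of \<mu> id] by (auto simp: strict_mono_def)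
  interpret M: real_distribution M by (rule M)

  \<comment> \<open>Weak convergence tests bounded functions only, and polynomials are unbounded on the line. Pushing the limit
    to the unit interval turns a polynomial into a bounded continuous function with the same values at the points \<open>k / n\<close>.\<close>
  define clamp :: "real \<Rightarrow> real" where "clamp t = max 0 (min 1 t)" for t
  have clamp_cont: "continuous_on UNIV clamp"
    unfolding clamp_def by (intro continuous_intros)
  have clamp_meas[measurable]: "clamp \<in> borel_measurable borel"
    using clamp_cont by (rule borel_measurable_continuous_onI)
  have clamp_in: "clamp t \<in> {0..1}" for t
    by (auto simp: clamp_def)
  define N where "N = distr M borel clamp"
  show thesis
  proof (rule that)
    show "prob_space N"
      unfolding N_def by (rule M.prob_space_distr) simp
    show "sets N = sets borel"
      by (simp add: N_def)
    show "AE t in N. t \<in> {0..1}"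
      unfolding N_def by (subst AE_distr_iff) (use clamp_in in auto)
    show "(\<integral>t. poly p t \<partial>N) = L p" for p
    proof -
      have [measurable]: "poly p \<in> borel_measurable borel"
        by (intro borel_measurable_continuous_onI continuous_intros)
      define f where "f t = poly p (clamp t)" for t
      have f_cont: "continuous_on UNIV f"
        unfolding f_def by (intro continuous_intros clamp_cont)
      have "compact (poly p ` {0..1})"
        by (intro compact_continuous_image continuous_intros) simp
      then obtain B where B: "\<And>y. y \<in> poly p ` {0..1} \<Longrightarrow> norm y \<le> B"
        using compact_imp_bounded bounded_iff by metis
      have "(\<lambda>n. \<integral>t. f t \<partial>(\<mu> \<circ> id \<circ> r) n) \<longlonglongrightarrow> (\<integral>t. f t \<partial>M)"
      proof (rule weak_conv_imp_integral_bdd_continuous_conv[OF _ _ weak])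
        show "isCont f t" for t
          using f_cont by (simp add: continuous_on_eq_continuous_at)
        show "norm (f t) \<le> B" for t
          using B clamp_in by (auto simp: f_def)
      qed (use real_distr M in auto)
      moreover have "(\<integral>t. f t \<partial>(\<mu> \<circ> id \<circ> r) n) = (\<Sum>k\<le>r n. w (r n) k * poly p (real k / real (r n)))" for n
      proof -
        have "clamp (real k / real (r n)) = real k / real (r n)" if "k \<le> r n" for k
        proof -
          have "real k / real (r n) \<le> 1" "0 \<le> real k / real (r n)"
            using that by (cases "r n = 0"; simp)+
          then show ?thesis
            unfolding clamp_def by linarith
        qed
        then have "(\<Sum>k\<le>r n. w (r n) k * f (real k / real (r n)))
            = (\<Sum>k\<le>r n. w (r n) k * poly p (real k / real (r n)))"
          by (intro sum.cong) (auto simp: f_def)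
        then show ?thesis
          using int[of f "r n"] borel_measurable_continuous_onI[OF f_cont] by simp
      qed
      moreover have "(\<lambda>n. \<Sum>k\<le>r n. w (r n) k * poly p (real k / real (r n))) \<longlonglongrightarrow> L p"
        using LIMSEQ_subseq_LIMSEQ[OF lim[of p] r] by (simp add: o_def)
      ultimately have "(\<integral>t. f t \<partial>M) = L p"
        using LIMSEQ_unique by auto
      then show ?thesis
        unfolding N_def f_def by (subst integral_distr) auto
    qed
  qed
qed

section \<open>Polynomial approximation of indicator functions\<close>

definition unit_measure :: "real measure \<Rightarrow> bool" where
  "unit_measure N \<longleftrightarrow> finite_measure N \<and> sets N = sets borel \<and> (AE t in N. t \<in> {0..1})"

text \<open>
  Measurability is asked for on the whole line, boundedness only on the interval that carries the
  measures, so that polynomials and indicator functions form one algebra.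
\<close>

definition unit_bounded :: "(real \<Rightarrow> real) \<Rightarrow> bool" where
  "unit_bounded f \<longleftrightarrow> f \<in> borel_measurable borel \<and> (\<exists>C. \<forall>t\<in>{0..1}. \<bar>f t\<bar> \<le> C)"

lemma unit_bounded_const: "unit_bounded (\<lambda>t. c)"
  by (auto simp: unit_bounded_def)

lemma unit_bounded_add:
  assumes "unit_bounded f" "unit_bounded g"
  shows "unit_bounded (\<lambda>t. f t + g t)"
proof -
  obtain C D where "\<forall>t\<in>{0..1}. \<bar>f t\<bar> \<le> C" "\<forall>t\<in>{0..1}. \<bar>g t\<bar> \<le> D"
    using assms by (auto simp: unit_bounded_def)
  then have "\<forall>t\<in>{0..1}. \<bar>f t + g t\<bar> \<le> C + D"
    by (meson abs_triangle_ineq add_mono order_trans)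
  then show ?thesis
    using assms by (auto simp: unit_bounded_def)
qed

lemma unit_bounded_mult:
  assumes "unit_bounded f" "unit_bounded g"
  shows "unit_bounded (\<lambda>t. f t * g t)"
proof -
  obtain C D where CD: "\<forall>t\<in>{0..1}. \<bar>f t\<bar> \<le> C" "\<forall>t\<in>{0..1}. \<bar>g t\<bar> \<le> D"
    using assms by (auto simp: unit_bounded_def)
  have "\<bar>f t * g t\<bar> \<le> C * D" if "t \<in> {0..1}" for t
    unfolding abs_mult using CD that by (intro mult_mono) (auto intro: order_trans[OF abs_ge_zero])
  then have "\<forall>t\<in>{0..1}. \<bar>f t * g t\<bar> \<le> C * D" by blast
  then show ?thesis
    using assms unfolding unit_bounded_def by (blast intro: borel_measurable_times)
qed

lemma unit_bounded_diff:
  assumes "unit_bounded f" "unit_bounded g"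
  shows "unit_bounded (\<lambda>t. f t - g t)"
  using unit_bounded_add[OF assms(1) unit_bounded_mult[OF unit_bounded_const[of "-1"] assms(2)]] by simp

lemma unit_bounded_power:
  assumes "unit_bounded f"
  shows "unit_bounded (\<lambda>t. f t ^ n)"
  by (induction n) (auto intro: unit_bounded_const unit_bounded_mult assms)

lemma unit_bounded_continuous:
  assumes "continuous_on UNIV f"
  shows "unit_bounded f"
proof -
  have "compact (f ` {0..1})"
    by (intro compact_continuous_image continuous_on_subset[OF assms]) auto
  then obtain C where "\<forall>y\<in>f ` {0..1}. norm y \<le> C"
    using compact_imp_bounded bounded_iff by metis
  then have "\<forall>t\<in>{0..1}. \<bar>f t\<bar> \<le> C" by auto
  then show ?thesis
    using borel_measurable_continuous_onI[OF assms] unfolding unit_bounded_def by blast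
qed

lemma unit_bounded_poly: "unit_bounded (poly p)"
  by (intro unit_bounded_continuous continuous_intros)

lemma unit_bounded_indicator: "B \<in> sets borel \<Longrightarrow> unit_bounded (indicator B)"
  by (auto simp: unit_bounded_def intro!: exI[of _ 1] split: split_indicator)

lemmas unit_bounded_intros = unit_bounded_const unit_bounded_add unit_bounded_mult unit_bounded_diff
  unit_bounded_power unit_bounded_poly unit_bounded_indicator

lemma integrable_unit:
  assumes "unit_measure N" "unit_bounded f"
  shows "integrable N f"
proof -
  interpret finite_measure N using assms by (simp add: unit_measure_def)
  obtain C where C: "\<forall>t\<in>{0..1}. \<bar>f t\<bar> \<le> C" using assms by (auto simp: unit_bounded_def)
  have sets: "sets N = sets borel" using assms by (simp add: unit_measure_def)
  have "AE t in N. t \<in> {0..1}" using assms unfolding unit_measure_def by blast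
  then have "AE t in N. norm (f t) \<le> C"
    using C by (auto elim: eventually_mono)
  moreover have "f \<in> borel_measurable N"
    using assms by (simp add: unit_bounded_def measurable_cong_sets[OF sets refl])
  ultimately show ?thesis
    by (rule integrable_const_bound)
qed

lemma unit_integral_mono:
  assumes "unit_measure N" "unit_bounded f" "unit_bounded g" "\<And>t. t \<in> {0..1} \<Longrightarrow> f t \<le> g t"
  shows "(\<integral>t. f t \<partial>N) \<le> (\<integral>t. g t \<partial>N)"
proof (rule integral_mono_AE)
  have "AE t in N. t \<in> {0..1}" using assms unfolding unit_measure_def by blast
  then show "AE t in N. f t \<le> g t"
    by (rule eventually_mono) (use assms(4) in auto)
qed (use assms in \<open>auto intro: integrable_unit\<close>)

lemma unit_L2_triangle:
  assumes N: "unit_measure N" and [intro!]: "unit_bounded f" "unit_bounded g" "unit_bounded h"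
  shows "(\<integral>t. (f t - h t)\<^sup>2 \<partial>N) \<le> 2 * (\<integral>t. (f t - g t)\<^sup>2 \<partial>N) + 2 * (\<integral>t. (g t - h t)\<^sup>2 \<partial>N)"
proof -
  have *: "(f t - h t)\<^sup>2 \<le> 2 * (f t - g t)\<^sup>2 + 2 * (g t - h t)\<^sup>2" for t
    using zero_le_power2[of "(f t - g t) - (g t - h t)"] by (simp add: power2_eq_square algebra_simps)
  have "(\<integral>t. (f t - h t)\<^sup>2 \<partial>N) \<le> (\<integral>t. 2 * (f t - g t)\<^sup>2 + 2 * (g t - h t)\<^sup>2 \<partial>N)"
    by (rule unit_integral_mono[OF N]) (auto intro!: unit_bounded_intros *)
  also have "\<dots> = 2 * (\<integral>t. (f t - g t)\<^sup>2 \<partial>N) + 2 * (\<integral>t. (g t - h t)\<^sup>2 \<partial>N)"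
    by (simp add: integrable_unit[OF N] unit_bounded_intros assms)
  finally show ?thesis .
qed

text \<open>
  The quadratic polynomial \<open>c \<mapsto> \<integral> (u - c)\<^sup>2\<close> is nonnegative, so its discriminant is not positive.
\<close>

lemma unit_Cauchy_Schwarz:
  assumes N: "unit_measure N" and u: "unit_bounded u"
  shows "(\<integral>t. u t \<partial>N)\<^sup>2 \<le> measure N UNIV * (\<integral>t. (u t)\<^sup>2 \<partial>N)"
proof -
  define M where "M = measure N UNIV"
  define I where "I = (\<integral>t. u t \<partial>N)"
  define S where "S = (\<integral>t. (u t)\<^sup>2 \<partial>N)"
  have space: "space N = UNIV"
    using N sets_eq_imp_space_eq[of N borel] by (simp add: unit_measure_def)
  have quad: "0 \<le> S - 2 * c * I + c\<^sup>2 * M" for c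
  proof -
    have "0 \<le> (\<integral>t. (u t - c)\<^sup>2 \<partial>N)" by (rule integral_nonneg_AE) simp
    also have "\<dots> = (\<integral>t. (u t)\<^sup>2 - 2 * c * u t + c\<^sup>2 \<partial>N)"
      by (simp add: power2_eq_square algebra_simps)
    also have "\<dots> = S - 2 * c * I + c\<^sup>2 * M"
      by (simp add: integrable_unit[OF N] unit_bounded_intros u S_def I_def M_def space)
    finally show ?thesis .
  qed
  have "I\<^sup>2 \<le> M * S"
  proof (cases "M = 0")
    case True
    \<comment> \<open>The quadratic degenerates to a linear function of \<open>c\<close>, which is negative at this value unless its slope vanishes.\<close>
    then have "I = 0"
      using quad[of "(S + 1) / (2 * I)"] by (cases "I = 0") (auto simp: field_simps)
    then show ?thesis using True by simp
  next
    case False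
    then have "0 < M" by (simp add: M_def zero_less_measure_iff)
    then show ?thesis
      using quad[of "I / M"] by (simp add: field_simps power2_eq_square)
  qed
  then show ?thesis by (simp add: M_def I_def S_def)
qed

lemma unit_poly_approx_continuous:
  assumes F: "finite F" "\<And>N. N \<in> F \<Longrightarrow> unit_measure N" and f: "continuous_on UNIV f" and "0 < e"
  shows "\<exists>p. \<forall>N\<in>F. (\<integral>t. (poly p t - f t)\<^sup>2 \<partial>N) < e"
proof -
  define M where "M = 1 + (\<Sum>N\<in>F. measure N UNIV)"
  have M: "measure N UNIV < M" if "N \<in> F" for N
    using that F(1) member_le_sum[of N F "\<lambda>N. measure N UNIV"] by (simp add: M_def)
  have "0 < M" by (simp add: M_def sum_nonneg add_pos_nonneg)
  define d where "d = sqrt (e / M)"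
  have "0 < d" using \<open>0 < e\<close> \<open>0 < M\<close> by (simp add: d_def)
  then obtain n where n: "\<And>t. t \<in> {0..1} \<Longrightarrow> \<bar>f t - (\<Sum>k\<le>n. f (k / n) * Bernstein n k t)\<bar> < d"
    using Bernstein_Weierstrass[OF continuous_on_subset[OF f], of d] by auto
  define p where "p = (\<Sum>k\<le>n. smult (f (k / n) * (n choose k)) ([:0, 1:] ^ k * [:1, -1:] ^ (n - k)))"
  have p: "poly p t = (\<Sum>k\<le>n. f (k / n) * Bernstein n k t)" for t
    by (simp add: p_def poly_sum Bernstein_def mult.assoc)
  show ?thesis
  proof (intro exI[of _ p] ballI)
    fix N assume "N \<in> F"
    note N = F(2)[OF this]
    have space: "space N = UNIV"
      using N sets_eq_imp_space_eq[of N borel] by (simp add: unit_measure_def)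
    have "(\<integral>t. (poly p t - f t)\<^sup>2 \<partial>N) \<le> (\<integral>t. d\<^sup>2 \<partial>N)"
    proof (rule unit_integral_mono[OF N])
      fix t :: real assume "t \<in> {0..1}"
      then have "\<bar>poly p t - f t\<bar> \<le> d" using n[of t] by (simp add: p abs_minus_commute)
      then show "(poly p t - f t)\<^sup>2 \<le> d\<^sup>2" by (metis abs_ge_zero power2_abs power_mono)
    qed (intro unit_bounded_intros unit_bounded_continuous[OF f])+
    also have "\<dots> = (e / M) * measure N UNIV"
      using \<open>0 < e\<close> \<open>0 < M\<close> by (simp add: d_def space)
    also have "\<dots> < (e / M) * M"
      using M[OF \<open>N \<in> F\<close>] \<open>0 < e\<close> \<open>0 < M\<close> by (intro mult_strict_left_mono) auto
    finally show "(\<integral>t. (poly p t - f t)\<^sup>2 \<partial>N) < e"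
      using \<open>0 < M\<close> by simp
  qed
qed

lemma unit_L2_dominated:
  assumes N: "unit_measure N" and g: "\<And>n. unit_bounded (g n)" and f: "unit_bounded f"
    and b: "\<And>n t. \<bar>g n t - f t\<bar> \<le> 1" and lim: "\<And>t. (\<lambda>n. g n t) \<longlonglongrightarrow> f t"
  shows "(\<lambda>n. \<integral>t. (g n t - f t)\<^sup>2 \<partial>N) \<longlonglongrightarrow> 0"
proof -
  have "(\<lambda>n. \<integral>t. (g n t - f t)\<^sup>2 \<partial>N) \<longlonglongrightarrow> (\<integral>t. 0 \<partial>N)"
  proof (rule integral_dominated_convergence[where w = "\<lambda>t. 1"])
    show "(\<lambda>t. (g n t - f t)\<^sup>2) \<in> borel_measurable N" for n
      by (rule borel_measurable_integrable) (intro integrable_unit[OF N] unit_bounded_intros g f)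
    show "integrable N (\<lambda>t. 1 :: real)"
      by (intro integrable_unit[OF N] unit_bounded_intros)
    show "AE t in N. norm ((g n t - f t)\<^sup>2) \<le> 1" for n
      using b by (auto simp: abs_square_le_1)
    have "(\<lambda>n. (g n t - f t)\<^sup>2) \<longlonglongrightarrow> (f t - f t)\<^sup>2" for t
      by (intro tendsto_intros lim)
    then show "AE t in N. (\<lambda>n. (g n t - f t)\<^sup>2) \<longlonglongrightarrow> 0"
      by simp
  qed simp
  then show ?thesis by simp
qed

text \<open>
  The sets whose indicator is an \<open>L\<^sup>2\<close> limit of polynomials form a Dynkin system, and half-lines belong to it
  because their indicators are limits of continuous functions. Working with finitely many measures
  at once yields one polynomial for several vectors later, which is what makes the projections linear.
\<close>

lemma unit_poly_approx_indicator:
  assumes F: "finite F" "\<And>N. N \<in> F \<Longrightarrow> unit_measure N" and B: "B \<in> sets borel"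
  shows "\<forall>e>0. \<exists>p. \<forall>N\<in>F. (\<integral>t. (poly p t - indicator B t)\<^sup>2 \<partial>N) < e"
proof -
  define Q where "Q f \<longleftrightarrow> (\<forall>e>0. \<exists>p. \<forall>N\<in>F. (\<integral>t. (poly p t - f t)\<^sup>2 \<partial>N) < e)" for f :: "real \<Rightarrow> real"
  have limit: "Q f" if g: "\<And>n. unit_bounded (g n)" "\<And>n. Q (g n)" and f: "unit_bounded f"
    and b: "\<And>n t. \<bar>g n t - f t\<bar> \<le> 1" and lim: "\<And>t. (\<lambda>n. g n t) \<longlonglongrightarrow> f t" for f g
    unfolding Q_def
  proof (intro allI impI)
    fix e :: real assume "0 < e"
    have "\<forall>N\<in>F. \<forall>\<^sub>F n in sequentially. (\<integral>t. (g n t - f t)\<^sup>2 \<partial>N) < e / 4"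
      using order_tendstoD(2)[OF unit_L2_dominated[OF F(2) g(1) f b lim], of _ "e / 4"] \<open>0 < e\<close> by simp
    then have "\<forall>\<^sub>F n in sequentially. \<forall>N\<in>F. (\<integral>t. (g n t - f t)\<^sup>2 \<partial>N) < e / 4"
      using F(1) by (simp add: eventually_ball_finite)
    then obtain n where n: "\<And>N. N \<in> F \<Longrightarrow> (\<integral>t. (g n t - f t)\<^sup>2 \<partial>N) < e / 4"
      using eventually_happens'[OF sequentially_bot] by blast
    obtain p where p: "\<And>N. N \<in> F \<Longrightarrow> (\<integral>t. (poly p t - g n t)\<^sup>2 \<partial>N) < e / 4"
      using g(2)[of n] \<open>0 < e\<close> unfolding Q_def by (metis zero_less_divide_iff zero_less_numeral)
    show "\<exists>p. \<forall>N\<in>F. (\<integral>t. (poly p t - f t)\<^sup>2 \<partial>N) < e"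
    proof (intro exI[of _ p] ballI)
      fix N assume "N \<in> F"
      then show "(\<integral>t. (poly p t - f t)\<^sup>2 \<partial>N) < e"
        using unit_L2_triangle[OF F(2) unit_bounded_poly g(1) f, of N p n] n[of N] p[of N] by linarith
    qed
  qed
  have add: "Q (\<lambda>t. f t + g t)" if f: "unit_bounded f" "Q f" and g: "unit_bounded g" "Q g" for f g
    unfolding Q_def
  proof (intro allI impI)
    fix e :: real assume "0 < e"
    then have e: "0 < e / 4" by simp
    obtain p where p: "\<And>N. N \<in> F \<Longrightarrow> (\<integral>t. (poly p t - f t)\<^sup>2 \<partial>N) < e / 4"
      using f(2) e unfolding Q_def by metis
    obtain q where q: "\<And>N. N \<in> F \<Longrightarrow> (\<integral>t. (poly q t - g t)\<^sup>2 \<partial>N) < e / 4"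
      using g(2) e unfolding Q_def by metis
    show "\<exists>p. \<forall>N\<in>F. (\<integral>t. (poly p t - (f t + g t))\<^sup>2 \<partial>N) < e"
    proof (intro exI[of _ "p + q"] ballI)
      fix N assume "N \<in> F"
      have "(\<integral>t. (poly (p + q) t - (f t + g t))\<^sup>2 \<partial>N)
        \<le> 2 * (\<integral>t. (poly (p + q) t - (f t + poly q t))\<^sup>2 \<partial>N) + 2 * (\<integral>t. ((f t + poly q t) - (f t + g t))\<^sup>2 \<partial>N)"
        by (rule unit_L2_triangle[OF F(2)[OF \<open>N \<in> F\<close>]]) (intro unit_bounded_intros f g)+
      also have "\<dots> < e"
        using p[OF \<open>N \<in> F\<close>] q[OF \<open>N \<in> F\<close>] by simp
      finally show "(\<integral>t. (poly (p + q) t - (f t + g t))\<^sup>2 \<partial>N) < e" .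
    qed
  qed
  have borel: "sets borel = sigma_sets UNIV (range (\<lambda>a :: real. {..a}))"
    by (subst borel_eq_atMost) simp
  have stable: "Int_stable (range (\<lambda>a :: real. {..a}))"
  proof (rule Int_stableI)
    fix A B assume "A \<in> range (\<lambda>a :: real. {..a})" "B \<in> range (\<lambda>a :: real. {..a})"
    then obtain a b where "A = {..a}" "B = {..b}" by auto
    then have "A \<inter> B = {..min a b}" by auto
    then show "A \<inter> B \<in> range (\<lambda>a :: real. {..a})" by blast
  qed
  have subset: "range (\<lambda>a :: real. {..a}) \<subseteq> Pow UNIV" by simp
  have "B \<in> sigma_sets UNIV (range (\<lambda>a :: real. {..a}))"
    using B borel by simp
  then have "Q (indicator B)"
  proof (induction B rule: sigma_sets_induct_disjoint[OF stable subset, consumes 1, case_names basic empty compl union])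
    case (basic A)
    then obtain a where A: "A = {..a}" by auto
    define g where "g n t = max 0 (min 1 (1 - real n * (t - a)))" for n t
    have cont: "continuous_on UNIV (g n)" for n
      unfolding g_def by (intro continuous_intros)
    show ?case
    proof (rule limit[of g])
      show "unit_bounded (g n)" for n using cont by (rule unit_bounded_continuous)
      show "Q (g n)" for n unfolding Q_def using unit_poly_approx_continuous[OF F cont] by blast
      show "unit_bounded (indicator A)" using A by (intro unit_bounded_indicator) simp
      show "\<bar>g n t - indicator A t\<bar> \<le> 1" for n t by (auto simp: g_def split: split_indicator)
      show "(\<lambda>n. g n t) \<longlonglongrightarrow> indicator A t" for t
      proof (cases "t \<le> a")
        case True
        then have "real n * (t - a) \<le> 0" for n by (simp add: mult_nonneg_nonpos)
        then have "g n t = 1" for n by (auto simp: g_def min_def max_def)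
        then show ?thesis using True A by simp
      next
        case False
        obtain m where m: "1 < real m * (t - a)" using False by (metis diff_gt_0_iff_gt not_le reals_Archimedean3)
        have "g n t = 0" if "n \<ge> m" for n
        proof -
          have "real m * (t - a) \<le> real n * (t - a)" using that False by (intro mult_right_mono) auto
          then show ?thesis using m by (simp add: g_def)
        qed
        then have "\<forall>\<^sub>F n in sequentially. g n t = 0" unfolding eventually_sequentially by blast
        then show ?thesis using False A by (simp add: tendsto_eventually)
      qed
    qed
  next
    case empty
    show ?case unfolding Q_def by (auto intro!: exI[of _ 0])
  next
    case (compl A)
    show ?case unfolding Q_def
    proof (intro allI impI)
      fix e :: real assume "0 < e"
      then obtain p where p: "\<And>N. N \<in> F \<Longrightarrow> (\<integral>t. (poly p t - indicator A t)\<^sup>2 \<partial>N) < e"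
        using compl unfolding Q_def by metis
      have "(poly (1 - p) t - indicator (UNIV - A) t)\<^sup>2 = (poly p t - indicator A t)\<^sup>2" for t
        by (auto simp: power2_eq_square algebra_simps split: split_indicator)
      then show "\<exists>p. \<forall>N\<in>F. (\<integral>t. (poly p t - indicator (UNIV - A) t)\<^sup>2 \<partial>N) < e"
        using p by (intro exI[of _ "1 - p"]) simp
    qed
  next
    case (union A)
    have A: "A i \<in> sets borel" for i using union borel by auto
    define g where "g n t = (\<Sum>i<n. indicator (A i) t :: real)" for n t
    have g: "g n = indicator (\<Union>i<n. A i)" for n
      unfolding g_def using union(1)
      by (intro ext indicator_UN_disjoint[symmetric]) (auto simp: disjoint_family_on_def)
    have gb: "unit_bounded (g n)" for n
      unfolding g using A by (intro unit_bounded_indicator) auto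
    show ?case
    proof (rule limit[of g])
      show "Q (g n)" for n
      proof (induction n)
        case 0
        show ?case unfolding Q_def g_def by (auto intro!: exI[of _ 0])
      next
        case (Suc n)
        have "Q (\<lambda>t. g n t + indicator (A n) t)"
          using Suc gb union(3) A by (intro add unit_bounded_indicator)
        moreover have "g (Suc n) = (\<lambda>t. g n t + indicator (A n) t)" by (simp add: g_def fun_eq_iff)
        ultimately show ?case by simp
      qed
      show "unit_bounded (g n)" for n by (rule gb)
      show "unit_bounded (indicator (\<Union>i. A i))" using A by (intro unit_bounded_indicator) auto
      show "\<bar>g n t - indicator (\<Union>i. A i) t\<bar> \<le> 1" for n t
        by (auto simp: g split: split_indicator)
      show "(\<lambda>n. g n t) \<longlonglongrightarrow> indicator (\<Union>i. A i) t" for t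
        unfolding g by (rule LIMSEQ_indicator_UN)
    qed
  qed
  then show ?thesis by (simp add: Q_def)
qed

section \<open>Spectral projections of a positive contraction\<close>

text \<open>
  Stated over a real Hilbert space; a complex structure enters later as an operator that commutes with \<open>T\<close>.
\<close>

locale positive_contraction =
  fixes T :: "'a :: {real_inner, complete_space} \<Rightarrow> 'a"
  assumes bounded_linear_T: "bounded_linear T"
    and T_sym: "inner x (T y) = inner (T x) y"
    and T_nonneg: "0 \<le> inner x (T x)"
    and T_le_one: "inner x (T x) \<le> inner x x"
begin

definition poly_op :: "real poly \<Rightarrow> 'a \<Rightarrow> 'a" where
  "poly_op p x = (\<Sum>i\<le>degree p. coeff p i *\<^sub>R (T ^^ i) x)"

lemma linear_T: "linear T"
  using bounded_linear_T by (rule bounded_linear.linear)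

lemma poly_op_sum_le:
  assumes "degree p \<le> n"
  shows "poly_op p x = (\<Sum>i\<le>n. coeff p i *\<^sub>R (T ^^ i) x)"
  unfolding poly_op_def
  by (rule sum.mono_neutral_left) (use assms in \<open>auto simp: coeff_eq_0 not_le\<close>)

lemma poly_op_zero [simp]: "poly_op 0 x = 0"
  by (simp add: poly_op_def)

lemma poly_op_pCons: "poly_op (pCons a p) x = a *\<^sub>R x + T (poly_op p x)"
proof -
  have "poly_op (pCons a p) x = (\<Sum>i\<le>Suc (degree p). coeff (pCons a p) i *\<^sub>R (T ^^ i) x)"
    by (rule poly_op_sum_le) (rule degree_pCons_le)
  also have "\<dots> = a *\<^sub>R x + (\<Sum>i\<le>degree p. coeff p i *\<^sub>R T ((T ^^ i) x))"
    by (subst sum.atMost_Suc_shift) simp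
  also have "(\<Sum>i\<le>degree p. coeff p i *\<^sub>R T ((T ^^ i) x)) = T (poly_op p x)"
    by (simp add: poly_op_def linear_sum[OF linear_T] linear_cmul[OF linear_T])
  finally show ?thesis .
qed

lemma poly_op_one [simp]: "poly_op 1 x = x"
  by (simp add: one_pCons poly_op_pCons linear_0[OF linear_T])

lemma poly_op_X: "poly_op [:0, 1:] x = T x"
  by (simp add: poly_op_pCons linear_0[OF linear_T])

lemma poly_op_add: "poly_op (p + q) x = poly_op p x + poly_op q x"
proof (induction p arbitrary: q)
  case (pCons a p)
  show ?case
    by (cases q) (simp add: poly_op_pCons pCons.IH linear_add[OF linear_T] scaleR_add_left)
qed simp

lemma poly_op_smult: "poly_op (smult c p) x = c *\<^sub>R poly_op p x"
  by (induction p) (simp_all add: poly_op_pCons linear_cmul[OF linear_T] scaleR_add_right)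

lemma poly_op_diff: "poly_op (p - q) x = poly_op p x - poly_op q x"
  using poly_op_add[of p "smult (-1) q" x] poly_op_smult[of "-1" q x] by simp

lemma poly_op_mult: "poly_op (p * q) x = poly_op p (poly_op q x)"
  by (induction p) (simp_all add: poly_op_pCons poly_op_add poly_op_smult)

lemma poly_op_intertwine:
  assumes "linear U" "\<And>x. U (T x) = T (U x)"
  shows "U (poly_op p x) = poly_op p (U x)"
  by (induction p)
     (simp_all add: poly_op_pCons linear_add[OF assms(1)] linear_cmul[OF assms(1)] linear_0[OF assms(1)] assms(2))

lemma linear_poly_op: "linear (poly_op p)"
  by (intro linearI; induction p)
     (simp_all add: poly_op_pCons linear_add[OF linear_T] linear_cmul[OF linear_T] algebra_simps)

lemma poly_op_sym: "inner x (poly_op p y) = inner (poly_op p x) y"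
  by (induction p arbitrary: x y) (simp_all add: poly_op_pCons inner_add_left inner_add_right T_sym poly_op_intertwine[of T, OF linear_T])

lemma norm_poly_op: "(norm (poly_op p x))\<^sup>2 = inner x (poly_op (p * p) x)"
  by (simp add: power2_norm_eq_inner poly_op_mult poly_op_sym)

text \<open>
  Even powers can be moved symmetrically to both sides of the inner product. What remains is one of
  \<open>1\<close>, \<open>T\<close>, \<open>1 - T\<close> and \<open>T (1 - T)\<close>.
\<close>

lemma poly_op_Bernstein_nonneg: "0 \<le> inner x (poly_op ([:0, 1:] ^ k * [:1, -1:] ^ m) x)"
proof -
  define X Y where "X = [:0, 1 :: real:]" and "Y = [:1, -1 :: real:]"
  have square: "0 \<le> inner x (poly_op (q * q * r) x)" if "\<And>y. 0 \<le> inner y (poly_op r y)" for q r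
  proof -
    have "poly_op (q * q * r) x = poly_op q (poly_op r (poly_op q x))"
      by (metis mult.commute poly_op_mult)
    then show ?thesis
      using that[of "poly_op q x"] by (simp add: poly_op_sym)
  qed
  have X: "0 \<le> inner y (poly_op X y)" for y
    by (simp add: X_def poly_op_X T_nonneg)
  have Y: "0 \<le> inner y (poly_op Y y)" for y
    using T_le_one[of y] by (simp add: Y_def poly_op_pCons linear_0[OF linear_T] linear_neg[OF linear_T] inner_diff_right)
  have XY: "0 \<le> inner y (poly_op (X * Y) y)" for y
  proof -
    have "X + Y = 1" by (simp add: X_def Y_def one_pCons)
    \<comment> \<open>Since \<open>X + Y = 1\<close>, the product is the sum of \<open>X\<^sup>2 Y\<close> and \<open>Y\<^sup>2 X\<close>, each a positive operator between two equal symmetric ones.\<close>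
    then have "X * Y = X * Y * (X + Y)" by simp
    also have "\<dots> = X * X * Y + Y * Y * X" by (simp add: algebra_simps)
    finally have eq: "poly_op (X * Y) y = poly_op (X * X * Y) y + poly_op (Y * Y * X) y"
      by (simp add: poly_op_add)
    have "inner y (poly_op (X * X * Y) y) = inner (poly_op X y) (poly_op Y (poly_op X y))"
      by (metis mult.assoc mult.commute poly_op_mult poly_op_sym)
    moreover have "inner y (poly_op (Y * Y * X) y) = inner (poly_op Y y) (poly_op X (poly_op Y y))"
      by (metis mult.assoc mult.commute poly_op_mult poly_op_sym)
    ultimately show ?thesis
      using X[of "poly_op Y y"] Y[of "poly_op X y"] by (simp add: eq inner_add_right)
  qed
  obtain a r where k: "k = 2 * a + r" "r = 0 \<or> r = 1" by (metis mod2_eq_if mult.commute div_mod_decomp)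
  obtain b s where m: "m = 2 * b + s" "s = 0 \<or> s = 1" by (metis mod2_eq_if mult.commute div_mod_decomp)
  have "0 \<le> inner y (poly_op (X ^ r * Y ^ s) y)" for y
    using k m X Y XY by auto
  then have "0 \<le> inner x (poly_op ((X ^ a * Y ^ b) * (X ^ a * Y ^ b) * (X ^ r * Y ^ s)) x)"
    by (rule square)
  also have "(X ^ a * Y ^ b) * (X ^ a * Y ^ b) * (X ^ r * Y ^ s) = X ^ k * Y ^ m"
    unfolding k(1) m(1) power_add mult_2 by (simp only: ac_simps)
  finally show ?thesis by (simp add: X_def Y_def)
qed

text \<open>
  The functional \<open>p \<mapsto> \<langle>x, p(T) x\<rangle>\<close> is normalized for the moment problem; the factor \<open>\<langle>x, x\<rangle>\<close> is put back as
  a constant density.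
\<close>

lemma ex_vector_measure:
  "\<exists>N. unit_measure N \<and> (\<forall>p. (\<integral>t. poly p t \<partial>N) = inner x (poly_op p x))"
proof (cases "x = 0")
  case True
  have "unit_measure (null_measure borel)"
    by (auto simp: unit_measure_def intro!: finite_measureI AE_I[of _ _ UNIV])
  then show ?thesis
    using True by (intro exI[of _ "null_measure borel"]) simp
next
  case False
  define c where "c = inner x x"
  have c: "0 < c" using False by (simp add: c_def)
  define L where "L p = inner x (poly_op p x) / c" for p
  obtain M where M: "prob_space M" "sets M = sets borel" "AE t in M. t \<in> {0..1}"
    "\<And>p. (\<integral>t. poly p t \<partial>M) = L p"
  proof (rule hausdorff_moment_measure[of L])
    show "0 \<le> L ([:0, 1:] ^ k * [:1, -1:] ^ m)" for k m
      using poly_op_Bernstein_nonneg[of x k m] c unfolding L_def by simp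
  qed (use c in \<open>auto simp: L_def poly_op_add poly_op_smult inner_add_right add_divide_distrib c_def\<close>)
  interpret prob_space M by (rule M)
  define N where "N = density M (\<lambda>_. ennreal c)"
  have "finite_measure N"
    by (rule finite_measureI) (simp add: N_def emeasure_density emeasure_space_1)
  moreover have "AE t in N. t \<in> {0..1}"
    unfolding N_def using M(3) by (subst AE_density) auto
  moreover have "sets N = sets borel"
    by (simp add: N_def M(2))
  ultimately have "unit_measure N"
    unfolding unit_measure_def by blast
  moreover have "(\<integral>t. poly p t \<partial>N) = inner x (poly_op p x)" for p
  proof -
    have "poly p \<in> borel_measurable M"
      using unit_bounded_poly[of p] by (simp add: unit_bounded_def measurable_cong_sets[OF M(2) refl])
    then have "(\<integral>t. poly p t \<partial>N) = (\<integral>t. c *\<^sub>R poly p t \<partial>M)"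
      unfolding N_def using c by (intro integral_density) auto
    also have "\<dots> = c * L p" by (simp add: M(4))
    finally show ?thesis using c by (simp add: L_def)
  qed
  ultimately show ?thesis by blast
qed

definition vector_measure :: "'a \<Rightarrow> real measure" where
  "vector_measure x = (SOME N. unit_measure N \<and> (\<forall>p. (\<integral>t. poly p t \<partial>N) = inner x (poly_op p x)))"

lemma unit_measure_vector: "unit_measure (vector_measure x)"
  and integral_poly_vector: "(\<integral>t. poly p t \<partial>vector_measure x) = inner x (poly_op p x)"
  using someI_ex[OF ex_vector_measure[of x]] by (auto simp: vector_measure_def)

lemma space_vector_measure: "space (vector_measure x) = UNIV"
  and sets_vector_measure: "sets (vector_measure x) = sets borel"
  using unit_measure_vector[of x] sets_eq_imp_space_eq[of "vector_measure x" borel] by (auto simp: unit_measure_def)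

text \<open>
  The isometry between polynomials in \<open>L\<^sup>2\<close> of the measure of \<open>x\<close> and the vectors \<open>p(T) x\<close>.
\<close>

lemma integral_poly_square: "(\<integral>t. (poly p t)\<^sup>2 \<partial>vector_measure x) = (norm (poly_op p x))\<^sup>2"
  using integral_poly_vector[of x "p * p"] norm_poly_op[of p x] by (simp add: power2_eq_square[of "poly p _"])

lemma ex_common_approx:
  assumes "finite X" "B \<in> sets borel"
  obtains p where "\<And>x. x \<in> X \<Longrightarrow>
    (\<lambda>n. \<integral>t. (poly (p n) t - indicator B t)\<^sup>2 \<partial>vector_measure x) \<longlonglongrightarrow> 0"
proof -
  have "\<exists>p. \<forall>N\<in>vector_measure ` X. (\<integral>t. (poly p t - indicator B t)\<^sup>2 \<partial>N) < e" if "0 < e" for e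
    using unit_poly_approx_indicator[of "vector_measure ` X" B] assms unit_measure_vector that by auto
  then have "\<forall>n. \<exists>p. \<forall>x\<in>X. (\<integral>t. (poly p t - indicator B t)\<^sup>2 \<partial>vector_measure x) < inverse (real (Suc n))"
    by auto
  then obtain p where p: "\<And>n x. x \<in> X \<Longrightarrow>
      (\<integral>t. (poly (p n) t - indicator B t)\<^sup>2 \<partial>vector_measure x) < inverse (real (Suc n))"
    by metis
  show thesis
  proof (rule that[of p])
    fix x assume x: "x \<in> X"
    show "(\<lambda>n. \<integral>t. (poly (p n) t - indicator B t)\<^sup>2 \<partial>vector_measure x) \<longlonglongrightarrow> 0"
      by (rule tendsto_sandwich[OF _ _ tendsto_const LIMSEQ_inverse_real_of_nat])
         (intro always_eventually allI integral_nonneg_AE less_imp_le p[OF x] AE_I2 zero_le_power2)+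
  qed
qed

lemma poly_op_diff_bound:
  assumes "B \<in> sets borel"
  shows "(norm (poly_op p x - poly_op q x))\<^sup>2 \<le> 2 * (\<integral>t. (poly p t - indicator B t)\<^sup>2 \<partial>vector_measure x)
     + 2 * (\<integral>t. (poly q t - indicator B t)\<^sup>2 \<partial>vector_measure x)"
  using unit_L2_triangle[OF unit_measure_vector unit_bounded_poly unit_bounded_indicator[OF assms] unit_bounded_poly, of x p q]
  by (simp add: integral_poly_square[of x "p - q", simplified] poly_op_diff power2_commute)

text \<open>
  The operator \<open>1\<^sub>B(T)\<close>, as the vector that every \<open>p(T) x\<close> approaches when \<open>p\<close> approaches \<open>1\<^sub>B\<close> in \<open>L\<^sup>2\<close>.
  Quantifying over all polynomials makes approximating sequences interchangeable. The factor two
  comes from the triangle inequality for squares and lets the bound survive the limit.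
\<close>

definition indicator_op :: "real set \<Rightarrow> 'a \<Rightarrow> 'a" where
  "indicator_op B x = (SOME y. \<forall>p. (norm (poly_op p x - y))\<^sup>2 \<le>
      2 * (\<integral>t. (poly p t - indicator B t)\<^sup>2 \<partial>vector_measure x))"

lemma indicator_op_bound:
  assumes B: "B \<in> sets borel"
  shows "(norm (poly_op p x - indicator_op B x))\<^sup>2 \<le> 2 * (\<integral>t. (poly p t - indicator B t)\<^sup>2 \<partial>vector_measure x)"
proof -
  define D where "D p = (\<integral>t. (poly p t - indicator B t)\<^sup>2 \<partial>vector_measure x)" for p
  obtain q where q: "(\<lambda>n. D (q n)) \<longlonglongrightarrow> 0"
    using ex_common_approx[of "{x}" B] B unfolding D_def by auto
  have bound: "(norm (poly_op p x - poly_op q x))\<^sup>2 \<le> 2 * D p + 2 * D q" for p q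
    unfolding D_def using B by (rule poly_op_diff_bound)
  have "Cauchy (\<lambda>n. poly_op (q n) x)"
    unfolding Cauchy_def
  proof (intro allI impI)
    fix e :: real assume "0 < e"
    then have "\<forall>\<^sub>F n in sequentially. D (q n) < e\<^sup>2 / 4"
      by (intro order_tendstoD(2)[OF q]) simp
    then obtain M where M: "\<And>n. n \<ge> M \<Longrightarrow> D (q n) < e\<^sup>2 / 4"
      by (auto simp: eventually_sequentially)
    show "\<exists>M. \<forall>m\<ge>M. \<forall>n\<ge>M. dist (poly_op (q m) x) (poly_op (q n) x) < e"
    proof (intro exI[of _ M] allI impI)
      fix m n assume "m \<ge> M" "n \<ge> M"
      then have "(norm (poly_op (q m) x - poly_op (q n) x))\<^sup>2 < e\<^sup>2"
        using bound[of "q m" "q n"] M[of m] M[of n] by linarith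
      then show "dist (poly_op (q m) x) (poly_op (q n) x) < e"
        using \<open>0 < e\<close> by (simp add: dist_norm power2_less_imp_less)
    qed
  qed
  then obtain y where y: "(\<lambda>n. poly_op (q n) x) \<longlonglongrightarrow> y"
    using Cauchy_convergent convergent_def by blast
  have "(norm (poly_op p x - y))\<^sup>2 \<le> 2 * D p" for p
  proof (rule LIMSEQ_le)
    show "(\<lambda>n. (norm (poly_op p x - poly_op (q n) x))\<^sup>2) \<longlonglongrightarrow> (norm (poly_op p x - y))\<^sup>2"
      by (intro tendsto_intros y)
    show "(\<lambda>n. 2 * D p + 2 * D (q n)) \<longlonglongrightarrow> 2 * D p"
      using tendsto_add[OF tendsto_const tendsto_mult[OF tendsto_const q], of "2 * D p" 2] by simp
  qed (use bound in auto)
  then have "\<exists>y. \<forall>p. (norm (poly_op p x - y))\<^sup>2 \<le> 2 * D p" by blast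
  from someI_ex[OF this] show ?thesis
    by (simp add: indicator_op_def D_def)
qed

lemma poly_op_tendsto_indicator_op:
  assumes B: "B \<in> sets borel"
    and p: "(\<lambda>n. \<integral>t. (poly (p n) t - indicator B t)\<^sup>2 \<partial>vector_measure x) \<longlonglongrightarrow> 0"
  shows "(\<lambda>n. poly_op (p n) x) \<longlonglongrightarrow> indicator_op B x"
proof -
  have "(\<lambda>n. (norm (poly_op (p n) x - indicator_op B x))\<^sup>2) \<longlonglongrightarrow> 0"
  proof (rule tendsto_sandwich[OF _ _ tendsto_const])
    show "(\<lambda>n. 2 * (\<integral>t. (poly (p n) t - indicator B t)\<^sup>2 \<partial>vector_measure x)) \<longlonglongrightarrow> 0"
      using tendsto_mult[OF tendsto_const p, of 2] by simp
  qed (auto intro!: always_eventually indicator_op_bound B)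
  then have "(\<lambda>n. sqrt ((norm (poly_op (p n) x - indicator_op B x))\<^sup>2)) \<longlonglongrightarrow> sqrt 0"
    by (rule tendsto_real_sqrt)
  then have "(\<lambda>n. norm (poly_op (p n) x - indicator_op B x)) \<longlonglongrightarrow> 0"
    by simp
  then show ?thesis
    by (simp add: tendsto_norm_zero_iff LIM_zero_iff)
qed

text \<open>
  One sequence for several vectors: linearity, symmetry and commutation properties of \<open>1\<^sub>B(T)\<close> are limits of the same
  properties of \<open>p(T)\<close> along such a sequence.
\<close>

lemma ex_common_poly_op_limit:
  assumes "finite X" "B \<in> sets borel"
  obtains p where "\<And>x. x \<in> X \<Longrightarrow> (\<lambda>n. poly_op (p n) x) \<longlonglongrightarrow> indicator_op B x"
proof -
  obtain p where "\<And>x. x \<in> X \<Longrightarrow>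
      (\<lambda>n. \<integral>t. (poly (p n) t - indicator B t)\<^sup>2 \<partial>vector_measure x) \<longlonglongrightarrow> 0"
    using ex_common_approx[OF assms] by blast
  then show thesis
    by (intro that poly_op_tendsto_indicator_op assms)
qed

text \<open>
  Used with multiplication by the imaginary unit for \<open>U\<close>, this is the source of complex linearity.
\<close>

lemma indicator_op_intertwine:
  assumes U: "bounded_linear U" "\<And>x. U (T x) = T (U x)" and B: "B \<in> sets borel"
  shows "indicator_op B (U x) = U (indicator_op B x)"
proof -
  obtain p where lim: "\<And>z. z \<in> {x, U x} \<Longrightarrow> (\<lambda>n. poly_op (p n) z) \<longlonglongrightarrow> indicator_op B z"
    using ex_common_poly_op_limit[of "{x, U x}" B] B by blast
  have p: "(\<lambda>n. poly_op (p n) x) \<longlonglongrightarrow> indicator_op B x" "(\<lambda>n. poly_op (p n) (U x)) \<longlonglongrightarrow> indicator_op B (U x)"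
    using lim by simp_all
  have "(\<lambda>n. U (poly_op (p n) x)) \<longlonglongrightarrow> U (indicator_op B x)"
    by (rule bounded_linear.tendsto[OF U(1) p(1)])
  then have "(\<lambda>n. poly_op (p n) (U x)) \<longlonglongrightarrow> U (indicator_op B x)"
    by (simp only: poly_op_intertwine[of U, OF bounded_linear.linear[OF U(1)] U(2)])
  then show ?thesis
    by (rule LIMSEQ_unique[OF p(2)])
qed

lemma linear_indicator_op:
  assumes B: "B \<in> sets borel"
  shows "linear (indicator_op B)"
proof (rule linearI)
  fix x y
  obtain p where lim: "\<And>z. z \<in> {x, y, x + y} \<Longrightarrow> (\<lambda>n. poly_op (p n) z) \<longlonglongrightarrow> indicator_op B z"
    using ex_common_poly_op_limit[of "{x, y, x + y}" B] B by blast
  have p: "(\<lambda>n. poly_op (p n) x) \<longlonglongrightarrow> indicator_op B x" "(\<lambda>n. poly_op (p n) y) \<longlonglongrightarrow> indicator_op B y"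
    "(\<lambda>n. poly_op (p n) (x + y)) \<longlonglongrightarrow> indicator_op B (x + y)"
    using lim by simp_all
  show "indicator_op B (x + y) = indicator_op B x + indicator_op B y"
    by (rule LIMSEQ_unique[OF p(3)]) (simp add: linear_add[OF linear_poly_op] tendsto_add[OF p(1,2)])
next
  fix c x
  show "indicator_op B (c *\<^sub>R x) = c *\<^sub>R indicator_op B x"
    using indicator_op_intertwine[of "\<lambda>x. c *\<^sub>R x" B x] B
    by (simp add: linear_cmul[OF linear_T] bounded_linear_scaleR_right)
qed

lemma indicator_op_sym:
  assumes B: "B \<in> sets borel"
  shows "inner x (indicator_op B y) = inner (indicator_op B x) y"
proof -
  obtain p where lim: "\<And>z. z \<in> {x, y} \<Longrightarrow> (\<lambda>n. poly_op (p n) z) \<longlonglongrightarrow> indicator_op B z"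
    using ex_common_poly_op_limit[of "{x, y}" B] B by blast
  have p: "(\<lambda>n. poly_op (p n) x) \<longlonglongrightarrow> indicator_op B x" "(\<lambda>n. poly_op (p n) y) \<longlonglongrightarrow> indicator_op B y"
    using lim by simp_all
  show ?thesis
  proof (rule LIMSEQ_unique)
    show "(\<lambda>n. inner x (poly_op (p n) y)) \<longlonglongrightarrow> inner x (indicator_op B y)"
      by (intro tendsto_intros p)
    show "(\<lambda>n. inner x (poly_op (p n) y)) \<longlonglongrightarrow> inner (indicator_op B x) y"
      unfolding poly_op_sym by (intro tendsto_intros p)
  qed
qed

text \<open>
  As \<open>p\<close> approaches \<open>1\<^sub>B\<close>, the integrals of \<open>p\<close> and of \<open>p\<^sup>2\<close> against the measure of \<open>x\<close> have the same
  limit. This is what makes \<open>1\<^sub>B(T)\<close> idempotent.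
\<close>

lemma indicator_op_quadratic:
  assumes B: "B \<in> sets borel"
  shows inner_indicator_op: "inner x (indicator_op B x) = measure (vector_measure x) B"
    and norm_indicator_op: "(norm (indicator_op B x))\<^sup>2 = measure (vector_measure x) B"
proof -
  let ?N = "vector_measure x"
  note N = unit_measure_vector[of x]
  obtain p where p: "(\<lambda>n. \<integral>t. (poly (p n) t - indicator B t)\<^sup>2 \<partial>?N) \<longlonglongrightarrow> 0"
    using ex_common_approx[of "{x}" B] B by auto
  note lim = poly_op_tendsto_indicator_op[OF B p]
  \<comment> \<open>Convergence in \<open>L\<^sup>2\<close> of a finite measure implies convergence of integrals.\<close>
  have weak: "(\<lambda>n. \<integral>t. g t * (poly (p n) t - indicator B t) \<partial>?N) \<longlonglongrightarrow> 0"
    if g: "unit_bounded g" "\<And>t. \<bar>g t\<bar> \<le> 1" for g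
  proof -
    have "(\<integral>t. g t * (poly (p n) t - indicator B t) \<partial>?N)\<^sup>2
        \<le> measure ?N UNIV * (\<integral>t. (poly (p n) t - indicator B t)\<^sup>2 \<partial>?N)" for n
    proof -
      have "(\<integral>t. g t * (poly (p n) t - indicator B t) \<partial>?N)\<^sup>2
        \<le> measure ?N UNIV * (\<integral>t. (g t * (poly (p n) t - indicator B t))\<^sup>2 \<partial>?N)"
        by (intro unit_Cauchy_Schwarz N unit_bounded_intros g B)
      also have "\<dots> \<le> measure ?N UNIV * (\<integral>t. (poly (p n) t - indicator B t)\<^sup>2 \<partial>?N)"
      proof (intro mult_left_mono unit_integral_mono[OF N] unit_bounded_intros g B)
        fix t
        have "(g t)\<^sup>2 \<le> 1" using g(2)[of t] by (simp add: abs_square_le_1)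
        then show "(g t * (poly (p n) t - indicator B t))\<^sup>2 \<le> (poly (p n) t - indicator B t)\<^sup>2"
          by (simp add: power_mult_distrib mult_left_le_one_le)
      qed simp
      finally show ?thesis .
    qed
    note bound = this
    have "(\<lambda>n. (\<integral>t. g t * (poly (p n) t - indicator B t) \<partial>?N)\<^sup>2) \<longlonglongrightarrow> 0"
    proof (rule tendsto_sandwich[OF _ _ tendsto_const])
      show "\<forall>\<^sub>F n in sequentially. 0 \<le> (\<integral>t. g t * (poly (p n) t - indicator B t) \<partial>?N)\<^sup>2"
        by simp
      show "\<forall>\<^sub>F n in sequentially. (\<integral>t. g t * (poly (p n) t - indicator B t) \<partial>?N)\<^sup>2
          \<le> measure ?N UNIV * (\<integral>t. (poly (p n) t - indicator B t)\<^sup>2 \<partial>?N)"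
        by (intro always_eventually allI bound)
      show "(\<lambda>n. measure ?N UNIV * (\<integral>t. (poly (p n) t - indicator B t)\<^sup>2 \<partial>?N)) \<longlonglongrightarrow> 0"
        using tendsto_mult[OF tendsto_const p] by simp
    qed
    then show ?thesis by simp
  qed
  have 1: "(\<lambda>n. \<integral>t. poly (p n) t - indicator B t \<partial>?N) \<longlonglongrightarrow> 0"
    using weak[of "\<lambda>_. 1"] by (simp add: unit_bounded_const)
  have 2: "(\<integral>t. poly (p n) t - indicator B t \<partial>?N) = inner x (poly_op (p n) x) - measure ?N B" for n
    using integrable_unit[OF N unit_bounded_poly] integrable_unit[OF N unit_bounded_indicator[OF B]]
    by (simp add: integral_poly_vector space_vector_measure)
  have "(\<lambda>n. inner x (poly_op (p n) x)) \<longlonglongrightarrow> measure ?N B"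
    using 1 unfolding 2 by (simp add: LIM_zero_iff)
  then show "inner x (indicator_op B x) = measure ?N B"
    by (rule LIMSEQ_unique[OF tendsto_inner[OF tendsto_const lim]])
  have 3: "(norm (poly_op (p n) x))\<^sup>2 = (\<integral>t. (poly (p n) t - indicator B t)\<^sup>2 \<partial>?N)
      + 2 * (\<integral>t. indicator B t * (poly (p n) t - indicator B t) \<partial>?N) + measure ?N B" for n
  proof -
    have "(\<integral>t. (poly (p n) t)\<^sup>2 \<partial>?N) = (\<integral>t. (poly (p n) t - indicator B t)\<^sup>2
        + 2 * (indicator B t * (poly (p n) t - indicator B t)) + indicator B t \<partial>?N)"
      by (intro Bochner_Integration.integral_cong refl) (simp split: split_indicator add: power2_eq_square algebra_simps)
    also have "\<dots> = (\<integral>t. (poly (p n) t - indicator B t)\<^sup>2 \<partial>?N)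
      + 2 * (\<integral>t. indicator B t * (poly (p n) t - indicator B t) \<partial>?N) + (\<integral>t. indicator B t \<partial>?N)"
    proof -
      have "integrable ?N (\<lambda>t. (poly (p n) t - indicator B t)\<^sup>2)"
        "integrable ?N (\<lambda>t. 2 * (indicator B t * (poly (p n) t - indicator B t)))"
        "integrable ?N (\<lambda>t. indicator B t :: real)"
        by (intro integrable_unit[OF N] unit_bounded_intros B)+
      then show ?thesis
        by (simp only: Bochner_Integration.integral_add Bochner_Integration.integrable_add integral_mult_right_zero)
    qed
    finally show ?thesis
      by (simp add: integral_poly_square space_vector_measure)
  qed
  have "(\<lambda>n. (norm (poly_op (p n) x))\<^sup>2) \<longlonglongrightarrow> 0 + 2 * 0 + measure ?N B"
    unfolding 3 by (intro tendsto_intros p weak unit_bounded_intros B) (auto split: split_indicator)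
  then have "(\<lambda>n. (norm (poly_op (p n) x))\<^sup>2) \<longlonglongrightarrow> measure ?N B"
    by simp
  then show "(norm (indicator_op B x))\<^sup>2 = measure ?N B"
    by (rule LIMSEQ_unique[OF tendsto_power[OF tendsto_norm[OF lim]]])
qed

end

text \<open>
  Polarization of the vanishing form at \<open>x + S x\<close>.
\<close>

lemma symmetric_eq_zero_if_quadratic_zero:
  fixes S :: "'a :: real_inner \<Rightarrow> 'a"
  assumes S: "linear S" and sym: "\<And>x y. inner x (S y) = inner (S x) y" and zero: "\<And>x. inner x (S x) = 0"
  shows "S x = 0"
proof -
  have "inner (x + S x) (S (x + S x)) = 2 * inner (S x) (S x)"
    using zero[of x] zero[of "S x"] sym[of x "S x"]
    by (simp add: linear_add[OF S] inner_add_left inner_add_right)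
  then show ?thesis using zero[of "x + S x"] by simp
qed

context positive_contraction
begin

text \<open>
  A symmetric operator is determined by its quadratic form, so algebraic identities between the
  projections reduce to identities between the measures of single vectors.
\<close>

lemma indicator_op_eqI:
  assumes S: "linear S" and sym: "\<And>x y. inner x (S y) = inner (S x) y" and B: "B \<in> sets borel"
    and quad: "\<And>x. inner x (S x) = measure (vector_measure x) B"
  shows "S x = indicator_op B x"
proof -
  have "S x - indicator_op B x = 0"
  proof (rule symmetric_eq_zero_if_quadratic_zero[of "\<lambda>x. S x - indicator_op B x"])
    show "linear (\<lambda>x. S x - indicator_op B x)"
      by (intro linear_compose_sub S linear_indicator_op B)
    show "inner x (S x - indicator_op B x) = 0" for x
      unfolding inner_diff_right quad inner_indicator_op[OF B] by simp
  qed (simp add: inner_diff_left inner_diff_right sym indicator_op_sym[OF B])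
  then show ?thesis by simp
qed

lemma indicator_op_idem:
  assumes B: "B \<in> sets borel"
  shows "indicator_op B (indicator_op B x) = indicator_op B x"
proof (rule indicator_op_eqI[OF _ _ B])
  show "linear (\<lambda>x. indicator_op B (indicator_op B x))"
    using linear_compose[OF linear_indicator_op[OF B] linear_indicator_op[OF B]] by (simp add: o_def)
  show "inner x (indicator_op B (indicator_op B x)) = measure (vector_measure x) B" for x
    using norm_indicator_op[OF B, of x] by (simp add: indicator_op_sym[OF B, of x] power2_norm_eq_inner)
qed (simp add: indicator_op_sym[OF B])

lemma finite_vector_measure: "finite_measure (vector_measure x)"
  using unit_measure_vector[of x] by (simp add: unit_measure_def)

lemma measure_vector_UNIV: "measure (vector_measure x) UNIV = inner x x"
  using integral_poly_vector[of x 1] by (simp add: space_vector_measure)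

lemma indicator_op_UNIV: "indicator_op UNIV x = x"
  by (rule indicator_op_eqI[symmetric]) (auto simp: measure_vector_UNIV linear_id[unfolded id_def])

lemma indicator_op_Un:
  assumes "A \<in> sets borel" "B \<in> sets borel" "A \<inter> B = {}"
  shows "indicator_op (A \<union> B) x = indicator_op A x + indicator_op B x"
proof (rule indicator_op_eqI[symmetric])
  show "linear (\<lambda>x. indicator_op A x + indicator_op B x)"
    by (intro linear_compose_add linear_indicator_op assms)
  show "inner x (indicator_op A x + indicator_op B x) = measure (vector_measure x) (A \<union> B)" for x
    using assms finite_measure.finite_measure_Union[OF finite_vector_measure, of A x B]
    by (simp add: inner_add_right inner_indicator_op sets_vector_measure)
qed (use assms in \<open>auto simp: inner_add_left inner_add_right indicator_op_sym\<close>)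

lemma indicator_op_empty: "indicator_op {} x = 0"
  using indicator_op_Un[of "{}" "{}" x] by simp

text \<open>
  By finite additivity the error is the projection for the rest of the union, whose squared norm is the measure
  of a decreasing sequence of sets with empty intersection.
\<close>

lemma indicator_op_countably_additive:
  assumes B: "range B \<subseteq> sets borel" "disjoint_family B"
  shows "(\<lambda>n. norm ((\<Sum>i<n. indicator_op (B i) x) - indicator_op (\<Union>i. B i) x)) \<longlonglongrightarrow> 0"
proof -
  interpret finite_measure "vector_measure x" by (rule finite_vector_measure)
  have Bi: "B i \<in> sets borel" for i using B(1) by auto
  have fin: "(\<Sum>i<n. indicator_op (B i) x) = indicator_op (\<Union>i<n. B i) x" for n
  proof (induction n)
    case (Suc n)
    have "(\<Union>i<n. B i) \<inter> B n = {}"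
    proof -
      have "B i \<inter> B n = {}" if "i < n" for i
        using B(2) that by (simp add: disjoint_family_on_def)
      then show ?thesis by blast
    qed
    then have "indicator_op ((\<Union>i<n. B i) \<union> B n) x = indicator_op (\<Union>i<n. B i) x + indicator_op (B n) x"
      by (intro indicator_op_Un) (use Bi in auto)
    moreover have "(\<Union>i<n. B i) \<union> B n = (\<Union>i<Suc n. B i)" by (auto simp: less_Suc_eq)
    ultimately show ?case using Suc by simp
  qed (simp add: indicator_op_empty)
  define R where "R n = (\<Union>i. B i) - (\<Union>i<n. B i)" for n
  have R: "R n \<in> sets borel" for n unfolding R_def using Bi by auto
  have diff: "(norm ((\<Sum>i<n. indicator_op (B i) x) - indicator_op (\<Union>i. B i) x))\<^sup>2 = measure (vector_measure x) (R n)" for n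
  proof -
    have "(\<Union>i. B i) = (\<Union>i<n. B i) \<union> R n" by (auto simp: R_def)
    moreover have "indicator_op ((\<Union>i<n. B i) \<union> R n) x = indicator_op (\<Union>i<n. B i) x + indicator_op (R n) x"
      by (intro indicator_op_Un R) (use Bi in \<open>auto simp: R_def\<close>)
    ultimately have "(\<Sum>i<n. indicator_op (B i) x) - indicator_op (\<Union>i. B i) x = - indicator_op (R n) x"
      by (simp add: fin)
    then show ?thesis by (simp add: norm_indicator_op[OF R])
  qed
  have "(\<lambda>n. measure (vector_measure x) (R n)) \<longlonglongrightarrow> measure (vector_measure x) (\<Inter>n. R n)"
    by (rule finite_Lim_measure_decseq) (use R in \<open>auto simp: sets_vector_measure R_def decseq_def\<close>)
  moreover have "(\<Inter>n. R n) = {}" by (auto simp: R_def)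
  ultimately have "(\<lambda>n. (norm ((\<Sum>i<n. indicator_op (B i) x) - indicator_op (\<Union>i. B i) x))\<^sup>2) \<longlonglongrightarrow> 0"
    by (simp add: diff)
  then show ?thesis
    by simp
qed

lemma integral_id_vector_measure:
  shows "integrable (vector_measure x) (\<lambda>t. t)" "(\<integral>t. t \<partial>vector_measure x) = inner x (T x)"
proof -
  have "poly [:0, 1 :: real:] = (\<lambda>t. t)" by (simp add: fun_eq_iff)
  then show "integrable (vector_measure x) (\<lambda>t. t)" "(\<integral>t. t \<partial>vector_measure x) = inner x (T x)"
    using integrable_unit[OF unit_measure_vector unit_bounded_poly, of x "[:0, 1:]"]
      integral_poly_vector[of x "[:0, 1:]"] by (simp_all add: poly_op_X)
qed

end

section \<open>Square-summable functions as a real Hilbert space\<close>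

lemma l2_summable: "\<phi> \<in> l2 \<Longrightarrow> (\<lambda>i. (cmod (\<phi> i))\<^sup>2) summable_on UNIV"
  by (simp add: l2_def)

lemma l2_comparison:
  assumes "f summable_on UNIV" "\<And>i. (cmod (\<phi> i))\<^sup>2 \<le> f i"
  shows "\<phi> \<in> l2"
  unfolding l2_def mem_Collect_eq by (rule summable_on_comparison_test[OF assms(1)]) (use assms in auto)

lemma l2_zero: "(0 :: 'i \<Rightarrow> complex) \<in> l2"
  by (simp add: l2_def)

lemma l2_add:
  assumes "\<phi> \<in> l2" "\<psi> \<in> l2"
  shows "\<phi> + \<psi> \<in> l2"
proof (rule l2_comparison)
  show "(\<lambda>i. 2 * (cmod (\<phi> i))\<^sup>2 + 2 * (cmod (\<psi> i))\<^sup>2) summable_on UNIV"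
    by (intro summable_on_add summable_on_cmult_right l2_summable assms)
  show "(cmod ((\<phi> + \<psi>) i))\<^sup>2 \<le> 2 * (cmod (\<phi> i))\<^sup>2 + 2 * (cmod (\<psi> i))\<^sup>2" for i
  proof -
    have "(cmod ((\<phi> + \<psi>) i))\<^sup>2 \<le> (cmod (\<phi> i) + cmod (\<psi> i))\<^sup>2"
      by (intro power_mono) (auto simp: norm_triangle_ineq)
    also have "\<dots> \<le> 2 * (cmod (\<phi> i))\<^sup>2 + 2 * (cmod (\<psi> i))\<^sup>2"
      using zero_le_power2[of "cmod (\<phi> i) - cmod (\<psi> i)"] by (simp add: power2_eq_square algebra_simps)
    finally show ?thesis .
  qed
qed

lemma l2_mult_bounded:
  assumes "\<phi> \<in> l2" "\<And>i. cmod (c i) \<le> C"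
  shows "(\<lambda>i. c i * \<phi> i) \<in> l2"
proof (rule l2_comparison)
  show "(\<lambda>i. C\<^sup>2 * (cmod (\<phi> i))\<^sup>2) summable_on UNIV"
    by (intro summable_on_cmult_right l2_summable assms)
  show "(cmod (c i * \<phi> i))\<^sup>2 \<le> C\<^sup>2 * (cmod (\<phi> i))\<^sup>2" for i
    unfolding norm_mult power_mult_distrib
    by (intro mult_right_mono power_mono assms) auto
qed

lemma l2_cscale: "\<phi> \<in> l2 \<Longrightarrow> cscale c \<phi> \<in> l2"
  by (rule l2_mult_bounded[where C = "cmod c"]) auto

lemma l2_diff: "\<phi> \<in> l2 \<Longrightarrow> \<psi> \<in> l2 \<Longrightarrow> \<phi> - \<psi> \<in> l2"
  using l2_add[OF _ l2_cscale[of \<psi> "-1"], of \<phi>] by (simp add: plus_fun_def fun_diff_def)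

lemma l2_sum: "(\<And>k. k \<in> K \<Longrightarrow> f k \<in> l2) \<Longrightarrow> sum f K \<in> l2"
  by (induction K rule: infinite_finite_induct) (auto intro: l2_zero l2_add)

lemma l2_inner_summable:
  assumes "\<phi> \<in> l2" "\<psi> \<in> l2"
  shows "(\<lambda>i. cnj (\<phi> i) * \<psi> i) summable_on UNIV"
proof (rule Infinite_Sum.abs_summable_summable, rule Infinite_Sum.abs_summable_on_comparison_test')
  show "(\<lambda>i. (cmod (\<phi> i))\<^sup>2 + (cmod (\<psi> i))\<^sup>2) summable_on UNIV"
    by (intro summable_on_add l2_summable assms)
  show "cmod (cnj (\<phi> i) * \<psi> i) \<le> (cmod (\<phi> i))\<^sup>2 + (cmod (\<psi> i))\<^sup>2" for i
    using sum_squares_bound[of "cmod (\<phi> i)" "cmod (\<psi> i)"] mult_nonneg_nonneg[OF norm_ge_zero norm_ge_zero, of "\<phi> i" "\<psi> i"]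
    unfolding norm_mult complex_mod_cnj mult.assoc by linarith
qed

lemma l2_inner_cnj: "l2_inner \<psi> \<phi> = cnj (l2_inner \<phi> \<psi>)"
  unfolding l2_inner_def infsum_cnj[symmetric] by (simp add: mult.commute)

lemma l2_inner_add_left:
  assumes "\<phi> \<in> l2" "\<phi>' \<in> l2" "\<psi> \<in> l2"
  shows "l2_inner (\<phi> + \<phi>') \<psi> = l2_inner \<phi> \<psi> + l2_inner \<phi>' \<psi>"
  unfolding l2_inner_def infsum_add[OF l2_inner_summable l2_inner_summable, OF assms(1,3) assms(2,3), symmetric]
  by (simp add: distrib_right)

lemma l2_inner_cscale_left: "l2_inner (cscale c \<phi>) \<psi> = cnj c * l2_inner \<phi> \<psi>"
  unfolding l2_inner_def infsum_cmult_right'[symmetric] by (simp add: mult.assoc)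

lemma l2_norm_eq_inner: "l2_inner \<phi> \<phi> = complex_of_real ((l2_norm \<phi>)\<^sup>2)"
proof -
  have "l2_inner \<phi> \<phi> = (\<Sum>\<^sub>\<infinity>i. complex_of_real ((cmod (\<phi> i))\<^sup>2))"
    unfolding l2_inner_def by (intro infsum_cong) (simp add: complex_norm_square mult.commute del: of_real_power)
  also have "\<dots> = complex_of_real (\<Sum>\<^sub>\<infinity>i. (cmod (\<phi> i))\<^sup>2)"
    by (rule infsum_bounded_linear_strong[OF summable_on_bounded_linear_iff[OF bounded_linear_of_real bounded_linear_Re]
          bounded_linear_of_real]) simp
  also have "(\<Sum>\<^sub>\<infinity>i. (cmod (\<phi> i))\<^sup>2) = (l2_norm \<phi>)\<^sup>2"
    by (simp add: l2_norm_def infsum_nonneg)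
  finally show ?thesis .
qed

text \<open>
  The theory of Hilbert spaces and limits applies to types, hence a type for the set \<^term>\<open>l2\<close>. Its inner product is
  the real part of the complex one, from which the imaginary part is recovered by multiplying an argument by
  the imaginary unit.
\<close>

typedef 'i ell2 = "l2 :: ('i \<Rightarrow> complex) set"
  using l2_zero by blast

setup_lifting type_definition_ell2

instantiation ell2 :: (type) real_inner
begin

lift_definition zero_ell2 :: "'a ell2" is 0 by (rule l2_zero)
lift_definition plus_ell2 :: "'a ell2 \<Rightarrow> 'a ell2 \<Rightarrow> 'a ell2" is "(+)" by (rule l2_add)
lift_definition minus_ell2 :: "'a ell2 \<Rightarrow> 'a ell2 \<Rightarrow> 'a ell2" is "(-)" by (rule l2_diff)
lift_definition uminus_ell2 :: "'a ell2 \<Rightarrow> 'a ell2" is "cscale (-1)" by (rule l2_cscale)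
lift_definition scaleR_ell2 :: "real \<Rightarrow> 'a ell2 \<Rightarrow> 'a ell2" is "\<lambda>r. cscale (complex_of_real r)"
  by (rule l2_cscale)
lift_definition inner_ell2 :: "'a ell2 \<Rightarrow> 'a ell2 \<Rightarrow> real" is "\<lambda>\<phi> \<psi>. Re (l2_inner \<phi> \<psi>)" .
definition norm_ell2 :: "'a ell2 \<Rightarrow> real" where "norm_ell2 x = sqrt (inner x x)"
definition dist_ell2 :: "'a ell2 \<Rightarrow> 'a ell2 \<Rightarrow> real" where "dist_ell2 x y = norm (x - y)"
definition sgn_ell2 :: "'a ell2 \<Rightarrow> 'a ell2" where "sgn_ell2 x = inverse (norm x) *\<^sub>R x"
definition uniformity_ell2 :: "('a ell2 \<times> 'a ell2) filter"
  where "uniformity_ell2 = (INF e\<in>{0<..}. principal {(x, y). dist x y < e})"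
definition open_ell2 :: "'a ell2 set \<Rightarrow> bool"
  where "open_ell2 S = (\<forall>x\<in>S. \<forall>\<^sub>F (x', y) in uniformity. x' = x \<longrightarrow> y \<in> S)"

instance
proof
  fix x y z :: "'a ell2" and a b r :: real
  show "x + y + z = x + (y + z)" by transfer (simp add: add.assoc)
  show "x + y = y + x" by transfer (simp add: add.commute)
  show "0 + x = x" by transfer simp
  show "- x + x = 0" by transfer (simp add: plus_fun_def zero_fun_def)
  show "x - y = x + - y" by transfer (simp add: plus_fun_def fun_diff_def)
  show "a *\<^sub>R (x + y) = a *\<^sub>R x + a *\<^sub>R y" by transfer (simp add: plus_fun_def algebra_simps)
  show "(a + b) *\<^sub>R x = a *\<^sub>R x + b *\<^sub>R x" by transfer (simp add: plus_fun_def algebra_simps)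
  show "a *\<^sub>R b *\<^sub>R x = (a * b) *\<^sub>R x" by transfer (simp add: mult.assoc)
  show "1 *\<^sub>R x = x" by transfer simp
  show "dist x y = norm (x - y)" by (rule dist_ell2_def)
  show "sgn x = inverse (norm x) *\<^sub>R x" by (rule sgn_ell2_def)
  show "uniformity = (INF e\<in>{0<..}. principal {(x, y :: 'a ell2). dist x y < e})"
    by (rule uniformity_ell2_def)
  show "open U = (\<forall>x\<in>U. \<forall>\<^sub>F (x', y) in uniformity. x' = x \<longrightarrow> y \<in> U)" for U :: "'a ell2 set"
    by (rule open_ell2_def)
  show "inner x y = inner y x"
    by transfer (subst l2_inner_cnj, simp)
  show "inner (x + y) z = inner x z + inner y z"
    by transfer (simp add: l2_inner_add_left)
  show "inner (r *\<^sub>R x) y = r * inner x y"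
    by transfer (simp add: l2_inner_cscale_left)
  show "0 \<le> inner x x"
    by transfer (simp add: l2_norm_eq_inner)
  show "inner x x = 0 \<longleftrightarrow> x = 0"
  proof transfer
    fix \<phi> :: "'a \<Rightarrow> complex" assume "\<phi> \<in> l2"
    have "\<forall>i. \<phi> i = 0" if "l2_norm \<phi> = 0"
    proof
      fix i
      have "(cmod (\<phi> i))\<^sup>2 = 0"
        by (rule nonneg_infsum_le_0D[where A = UNIV])
           (use that l2_summable[OF \<open>\<phi> \<in> l2\<close>] in \<open>auto simp: l2_norm_def\<close>)
      then show "\<phi> i = 0" by simp
    qed
    moreover have "l2_norm \<phi> = 0" if "\<forall>i. \<phi> i = 0"
      using that by (simp add: l2_norm_def)
    ultimately have "l2_norm \<phi> = 0 \<longleftrightarrow> (\<forall>i. \<phi> i = 0)"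
      by blast
    then show "Re (l2_inner \<phi> \<phi>) = 0 \<longleftrightarrow> \<phi> = 0"
      by (simp add: l2_norm_eq_inner zero_fun_def fun_eq_iff)
  qed
  show "norm x = sqrt (inner x x)" by (rule norm_ell2_def)
qed

end

lemma norm_Abs_ell2: "\<phi> \<in> l2 \<Longrightarrow> norm (Abs_ell2 \<phi>) = l2_norm \<phi>"
  by (simp add: norm_eq_sqrt_inner inner_ell2.rep_eq Abs_ell2_inverse l2_norm_eq_inner l2_norm_def infsum_nonneg)

lemma norm_Rep_ell2: "norm x = l2_norm (Rep_ell2 x)"
  using norm_Abs_ell2[OF Rep_ell2, of x] by (simp add: Rep_ell2_inverse)

lemma sum_le_norm_ell2:
  assumes "finite F"
  shows "(\<Sum>i\<in>F. (cmod (Rep_ell2 x i))\<^sup>2) \<le> (norm x)\<^sup>2"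
proof -
  have "(norm x)\<^sup>2 = (\<Sum>\<^sub>\<infinity>i. (cmod (Rep_ell2 x i))\<^sup>2)"
    by (simp add: norm_Rep_ell2 l2_norm_def infsum_nonneg)
  then show ?thesis
    using finite_sum_le_infsum[of "\<lambda>i. (cmod (Rep_ell2 x i))\<^sup>2" UNIV F] l2_summable[OF Rep_ell2[of x]] assms by simp
qed

text \<open>
  The coordinates of a Cauchy sequence converge; the Cauchy bound for finite partial sums passes to the limit
  coordinates and shows that the limit is square-summable and attained in norm.
\<close>

instance ell2 :: (type) complete_space
proof
  fix X :: "nat \<Rightarrow> 'a ell2" assume X: "Cauchy X"
  have coord: "cmod (Rep_ell2 x i) \<le> norm x" for x :: "'a ell2" and i
    by (rule power2_le_imp_le) (use sum_le_norm_ell2[of "{i}" x] in simp_all)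
  have Rep_diff: "Rep_ell2 (x - y) i = Rep_ell2 x i - Rep_ell2 y i" for x y :: "'a ell2" and i
    by (simp add: minus_ell2.rep_eq)
  have "Cauchy (\<lambda>n. Rep_ell2 (X n) i)" for i
    unfolding Cauchy_def
  proof (intro allI impI)
    fix e :: real assume "0 < e"
    then obtain M where "\<And>m n. m \<ge> M \<Longrightarrow> n \<ge> M \<Longrightarrow> dist (X m) (X n) < e"
      using X unfolding Cauchy_def by blast
    then have "dist (Rep_ell2 (X m) i) (Rep_ell2 (X n) i) < e" if "m \<ge> M" "n \<ge> M" for m n
      using coord[of "X m - X n" i] that unfolding dist_norm Rep_diff by (meson le_less_trans)
    then show "\<exists>M. \<forall>m\<ge>M. \<forall>n\<ge>M. dist (Rep_ell2 (X m) i) (Rep_ell2 (X n) i) < e" by blast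
  qed
  then have "\<exists>l. (\<lambda>n. Rep_ell2 (X n) i) \<longlonglongrightarrow> l" for i
    using Cauchy_convergent convergent_def by blast
  then obtain \<psi> where \<psi>: "\<And>i. (\<lambda>n. Rep_ell2 (X n) i) \<longlonglongrightarrow> \<psi> i" by metis
  have tail: "(\<lambda>i. (cmod (Rep_ell2 (X m) i - \<psi> i))\<^sup>2) summable_on UNIV \<and>
      (\<Sum>\<^sub>\<infinity>i. (cmod (Rep_ell2 (X m) i - \<psi> i))\<^sup>2) \<le> e\<^sup>2"
    if e: "\<And>n. n \<ge> M \<Longrightarrow> dist (X m) (X n) \<le> e" for M m e
  proof -
    have fin: "(\<Sum>i\<in>F. (cmod (Rep_ell2 (X m) i - \<psi> i))\<^sup>2) \<le> e\<^sup>2" if "finite F" for F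
    proof (rule Lim_bounded)
      show "(\<lambda>n. \<Sum>i\<in>F. (cmod (Rep_ell2 (X m) i - Rep_ell2 (X n) i))\<^sup>2)
          \<longlonglongrightarrow> (\<Sum>i\<in>F. (cmod (Rep_ell2 (X m) i - \<psi> i))\<^sup>2)"
        by (intro tendsto_intros \<psi>)
      show "\<forall>n\<ge>M. (\<Sum>i\<in>F. (cmod (Rep_ell2 (X m) i - Rep_ell2 (X n) i))\<^sup>2) \<le> e\<^sup>2"
      proof (intro allI impI)
        fix n assume "n \<ge> M"
        then have "norm (X m - X n) \<le> e" using e by (simp add: dist_norm)
        then have "(norm (X m - X n))\<^sup>2 \<le> e\<^sup>2" by (rule power_mono) simp
        then show "(\<Sum>i\<in>F. (cmod (Rep_ell2 (X m) i - Rep_ell2 (X n) i))\<^sup>2) \<le> e\<^sup>2"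
          using sum_le_norm_ell2[OF that, of "X m - X n"] by (simp add: Rep_diff)
      qed
    qed
    have summable: "(\<lambda>i. (cmod (Rep_ell2 (X m) i - \<psi> i))\<^sup>2) summable_on UNIV"
      by (rule nonneg_bdd_above_summable_on) (use fin in \<open>auto intro!: bdd_aboveI2\<close>)
    show ?thesis
      by (intro conjI summable infsum_le_finite_sums fin)
  qed
  have in_l2: "Rep_ell2 (X m) - \<psi> \<in> l2" if e: "\<And>n. n \<ge> M \<Longrightarrow> dist (X m) (X n) \<le> e" for M m e
    using tail[OF e] by (simp add: l2_def fun_diff_def)
  obtain M where "\<And>m n. m \<ge> M \<Longrightarrow> n \<ge> M \<Longrightarrow> dist (X m) (X n) < 1"
    using X unfolding Cauchy_def by (metis zero_less_one)
  then have "Rep_ell2 (X M) - \<psi> \<in> l2"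
    by (intro in_l2[of M M 1]) (simp add: less_imp_le)
  then have "Rep_ell2 (X M) - (Rep_ell2 (X M) - \<psi>) \<in> l2"
    by (rule l2_diff[OF Rep_ell2])
  then have \<psi>_l2: "\<psi> \<in> l2" by simp
  have "X \<longlonglongrightarrow> Abs_ell2 \<psi>"
    unfolding lim_sequentially
  proof (intro allI impI)
    fix r :: real assume "0 < r"
    then obtain M where M: "\<And>m n. m \<ge> M \<Longrightarrow> n \<ge> M \<Longrightarrow> dist (X m) (X n) < r / 2"
      using X unfolding Cauchy_def by (meson half_gt_zero)
    have "dist (X m) (Abs_ell2 \<psi>) < r" if "m \<ge> M" for m
    proof -
      have "(\<Sum>\<^sub>\<infinity>i. (cmod (Rep_ell2 (X m) i - \<psi> i))\<^sup>2) \<le> (r / 2)\<^sup>2"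
        using tail[of M m "r / 2"] M[OF that] by (simp add: less_imp_le)
      then have "l2_norm (Rep_ell2 (X m) - \<psi>) \<le> r / 2"
        unfolding l2_norm_def using \<open>0 < r\<close> by (intro real_le_lsqrt) (auto intro: infsum_nonneg simp: fun_diff_def)
      moreover have "dist (X m) (Abs_ell2 \<psi>) = l2_norm (Rep_ell2 (X m) - \<psi>)"
        by (simp add: dist_norm norm_Rep_ell2 minus_ell2.rep_eq Abs_ell2_inverse \<psi>_l2)
      ultimately show ?thesis using \<open>0 < r\<close> by simp
    qed
    then show "\<exists>M. \<forall>m\<ge>M. dist (X m) (Abs_ell2 \<psi>) < r" by blast
  qed
  then show "convergent X" by (auto simp: convergent_def)
qed

section \<open>The spectral theorem for bounded symmetric operators\<close>

definition bounded_symmetric :: "(('i \<Rightarrow> complex) \<Rightarrow> ('i \<Rightarrow> complex)) \<Rightarrow> bool" where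
  "bounded_symmetric A \<longleftrightarrow>
     (\<forall>\<phi>\<in>l2. A \<phi> \<in> l2) \<and>
     (\<forall>\<phi>\<in>l2. \<forall>\<psi>\<in>l2. A (\<phi> + \<psi>) = A \<phi> + A \<psi>) \<and>
     (\<forall>c. \<forall>\<phi>\<in>l2. A (cscale c \<phi>) = cscale c (A \<phi>)) \<and>
     (\<forall>\<phi>\<in>l2. \<forall>\<psi>\<in>l2. l2_inner \<phi> (A \<psi>) = l2_inner (A \<phi>) \<psi>) \<and>
     (\<exists>C. \<forall>\<phi>\<in>l2. l2_norm (A \<phi>) \<le> C * l2_norm \<phi>)"

lemma l2_inner_add_right:
  assumes "\<phi> \<in> l2" "\<psi> \<in> l2" "\<psi>' \<in> l2"
  shows "l2_inner \<phi> (\<psi> + \<psi>') = l2_inner \<phi> \<psi> + l2_inner \<phi> \<psi>'"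
  using l2_inner_add_left[OF assms(2,3,1)] by (simp add: l2_inner_cnj[of \<phi>])

lemma Re_l2_inner:
  "\<phi> \<in> l2 \<Longrightarrow> \<psi> \<in> l2 \<Longrightarrow> Re (l2_inner \<phi> \<psi>) = inner (Abs_ell2 \<phi>) (Abs_ell2 \<psi>)"
  by (simp add: inner_ell2.rep_eq Abs_ell2_inverse)

lemma Im_l2_inner: "Im (l2_inner \<phi> \<psi>) = Re (l2_inner (cscale \<i> \<phi>) \<psi>)"
  by (simp add: l2_inner_cscale_left)

lemma l2_norm_nonneg: "0 \<le> l2_norm \<phi>"
  by (simp add: l2_norm_def infsum_nonneg)

lemma l2_norm_eq_0: "\<phi> \<in> l2 \<Longrightarrow> l2_norm \<phi> = 0 \<longleftrightarrow> \<phi> = 0"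
  using norm_eq_zero[of "Abs_ell2 \<phi>"] Abs_ell2_inject[of \<phi> 0] by (simp add: norm_Abs_ell2 zero_ell2_def l2_zero)

lemma l2_Cauchy_Schwarz: "\<phi> \<in> l2 \<Longrightarrow> \<psi> \<in> l2 \<Longrightarrow> \<bar>Re (l2_inner \<phi> \<psi>)\<bar> \<le> l2_norm \<phi> * l2_norm \<psi>"
  using Cauchy_Schwarz_ineq2[of "Abs_ell2 \<phi>" "Abs_ell2 \<psi>"] by (simp add: Re_l2_inner norm_Abs_ell2)

text \<open>
  \<^const>\<open>measure_of\<close> yields the given set function only if that is countably additive, which here
  follows from strong countable additivity of the projections.
\<close>

lemma emeasure_scalar_measure:
  assumes P: "projection_valued_measure P" and \<phi>: "\<phi> \<in> l2" and B: "B \<in> sets borel"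
  shows "emeasure (scalar_measure P \<phi>) B = ennreal (Re (l2_inner \<phi> (P B \<phi>)))"
proof -
  define f where "f B = Re (l2_inner \<phi> (P B \<phi>))" for B
  have proj: "orthogonal_projection (P B)" if "B \<in> sets borel" for B
    using P that by (simp add: projection_valued_measure_def)
  have P_l2: "P B \<phi> \<in> l2" if "B \<in> sets borel" for B
    using proj[OF that] \<phi> by (simp add: orthogonal_projection_def)
  have f_nonneg: "0 \<le> f B" if "B \<in> sets borel" for B
  proof -
    have "l2_inner \<phi> (P B \<phi>) = l2_inner (P B \<phi>) (P B \<phi>)"
      using proj[OF that] \<phi> P_l2[OF that] unfolding orthogonal_projection_def by metis
    then show ?thesis by (simp add: f_def l2_norm_eq_inner)
  qed
  have sums: "(\<lambda>n. f (E n)) sums f (\<Union>n. E n)" if E: "range E \<subseteq> sets borel" "disjoint_family E" for E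
    unfolding sums_def
  proof (rule LIM_zero_cancel, rule Lim_null_comparison)
    have En: "E n \<in> sets borel" for n using E by auto
    have "(\<lambda>N. l2_norm ((\<Sum>n<N. P (E n) \<phi>) - P (\<Union>n. E n) \<phi>)) \<longlonglongrightarrow> 0"
      using P E \<phi> unfolding projection_valued_measure_def by blast
    then show "(\<lambda>N. l2_norm \<phi> * l2_norm ((\<Sum>n<N. P (E n) \<phi>) - P (\<Union>n. E n) \<phi>)) \<longlonglongrightarrow> 0"
      by (rule tendsto_mult_right_zero)
    have "norm ((\<Sum>n<N. f (E n)) - f (\<Union>n. E n))
        \<le> l2_norm \<phi> * l2_norm ((\<Sum>n<N. P (E n) \<phi>) - P (\<Union>n. E n) \<phi>)" for N
    proof -
      have U: "P (\<Union>n. E n) \<phi> \<in> l2" using En by (intro P_l2) auto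
      have S: "(\<Sum>n<N. P (E n) \<phi>) \<in> l2" for N by (intro l2_sum P_l2 En)
      have sum: "Re (l2_inner \<phi> (\<Sum>n<N. P (E n) \<phi>)) = (\<Sum>n<N. f (E n))" for N
      proof (induction N)
        case 0
        show ?case by (simp add: l2_inner_def zero_fun_def)
      next
        case (Suc N)
        then show ?case
          unfolding sum.lessThan_Suc l2_inner_add_right[OF \<phi> S P_l2[OF En]] by (simp add: f_def)
      qed
      have "l2_inner \<phi> (\<Sum>n<N. P (E n) \<phi>)
          = l2_inner \<phi> (((\<Sum>n<N. P (E n) \<phi>) - P (\<Union>n. E n) \<phi>) + P (\<Union>n. E n) \<phi>)"
        by simp
      also have "\<dots> = l2_inner \<phi> ((\<Sum>n<N. P (E n) \<phi>) - P (\<Union>n. E n) \<phi>) + l2_inner \<phi> (P (\<Union>n. E n) \<phi>)"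
        by (intro l2_inner_add_right l2_diff \<phi> S U)
      finally have "(\<Sum>n<N. f (E n)) - f (\<Union>n. E n) = Re (l2_inner \<phi> ((\<Sum>n<N. P (E n) \<phi>) - P (\<Union>n. E n) \<phi>))"
        by (simp add: f_def sum[unfolded f_def, symmetric])
      then show ?thesis
        using l2_Cauchy_Schwarz[OF \<phi> l2_diff[OF S U]] by simp
    qed
    then show "\<forall>\<^sub>F N in sequentially. norm ((\<Sum>n<N. f (E n)) - f (\<Union>n. E n))
        \<le> l2_norm \<phi> * l2_norm ((\<Sum>n<N. P (E n) \<phi>) - P (\<Union>n. E n) \<phi>)"
      by (intro always_eventually allI)
  qed
  have empty: "f {} = 0"
    using sums[of "\<lambda>_. {}"] sums_unique[of "\<lambda>_. f {}" "f {}"]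
    by (auto simp: disjoint_family_on_def dest: sums_summable summable_LIMSEQ_zero LIMSEQ_const_iff[THEN iffD1])
  show ?thesis
    unfolding f_def[symmetric]
  proof (rule emeasure_measure_of[of "scalar_measure P \<phi>" UNIV "sets borel" "\<lambda>B. ennreal (f B)"])
    show "scalar_measure P \<phi> = measure_of UNIV (sets borel) (\<lambda>B. ennreal (f B))"
      by (simp add: scalar_measure_def f_def)
    show "positive (sets (scalar_measure P \<phi>)) (\<lambda>B. ennreal (f B))"
      by (simp add: positive_def empty)
    have sets: "sets (scalar_measure P \<phi>) = sets borel"
      unfolding scalar_measure_def using sets.sigma_sets_eq[of borel] by simp
    show "countably_additive (sets (scalar_measure P \<phi>)) (\<lambda>B. ennreal (f B))"
      unfolding countably_additive_def sets
    proof (intro allI impI)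
      fix E :: "nat \<Rightarrow> real set" assume E: "range E \<subseteq> sets borel" "disjoint_family E"
      then have "E n \<in> sets borel" for n by auto
      then show "(\<Sum>n. ennreal (f (E n))) = ennreal (f (\<Union>n. E n))"
        using sums[OF E] by (intro sums_unique[symmetric] sums_ennreal[THEN iffD2] f_nonneg) auto
    qed
    show "B \<in> sets (scalar_measure P \<phi>)" using B sets by simp
  qed auto
qed

lemma sets_scalar_measure: "sets (scalar_measure P \<phi>) = sets borel"
  and space_scalar_measure: "space (scalar_measure P \<phi>) = UNIV"
  unfolding scalar_measure_def using sets.sigma_sets_eq[of borel] by simp_all

text \<open>
  With a bound \<open>C\<close> for the norm of \<open>A\<close>, the operator \<open>T = (A + C) / 2C\<close> is a positive contraction, and
  \<open>g(t) = 2 C t - C\<close> transports its spectral measure back to that of \<open>A\<close>.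
\<close>

theorem spectral_theorem_bounded_symmetric:
  fixes A :: "('i \<Rightarrow> complex) \<Rightarrow> ('i \<Rightarrow> complex)"
  assumes A: "bounded_symmetric A"
  shows "\<exists>P. spectral_measure_of A P"
proof -
  have A_l2: "A \<phi> \<in> l2" if "\<phi> \<in> l2" for \<phi>
    using A that by (simp add: bounded_symmetric_def)
  have A_add: "A (\<phi> + \<psi>) = A \<phi> + A \<psi>" if "\<phi> \<in> l2" "\<psi> \<in> l2" for \<phi> \<psi>
    using A that by (simp add: bounded_symmetric_def)
  have A_scale: "A (cscale c \<phi>) = cscale c (A \<phi>)" if "\<phi> \<in> l2" for \<phi> c
    using A that by (simp add: bounded_symmetric_def)
  have A_sym: "l2_inner \<phi> (A \<psi>) = l2_inner (A \<phi>) \<psi>" if "\<phi> \<in> l2" "\<psi> \<in> l2" for \<phi> \<psi>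
    using A that by (simp add: bounded_symmetric_def)
  obtain C0 where C0: "\<And>\<phi>. \<phi> \<in> l2 \<Longrightarrow> l2_norm (A \<phi>) \<le> C0 * l2_norm \<phi>"
    using A unfolding bounded_symmetric_def by blast
  define C where "C = max 1 C0"
  have C: "l2_norm (A \<phi>) \<le> C * l2_norm \<phi>" if "\<phi> \<in> l2" for \<phi>
  proof -
    have "C0 * l2_norm \<phi> \<le> C * l2_norm \<phi>"
      by (intro mult_right_mono l2_norm_nonneg) (simp add: C_def)
    then show ?thesis using C0[OF that] by linarith
  qed
  have C_pos: "0 < C" by (simp add: C_def)

  define A' where "A' x = Abs_ell2 (A (Rep_ell2 x))" for x
  \<comment> \<open>The complex structure, seen as an operator of the real Hilbert space.\<close>
  define J where "J x = Abs_ell2 (cscale \<i> (Rep_ell2 x))" for x :: "'i ell2"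
  have Rep_A': "Rep_ell2 (A' x) = A (Rep_ell2 x)" for x
    by (simp add: A'_def Abs_ell2_inverse A_l2 Rep_ell2)
  have Rep_J: "Rep_ell2 (J x) = cscale \<i> (Rep_ell2 x)" for x
    by (simp add: J_def Abs_ell2_inverse l2_cscale Rep_ell2)
  have lin_A': "bounded_linear A'"
  proof (rule bounded_linear_intro[where K = C])
    show "A' (x + y) = A' x + A' y" for x y
      by (simp add: Rep_ell2_inject[symmetric] Rep_A' plus_ell2.rep_eq A_add Rep_ell2)
    show "A' (r *\<^sub>R x) = r *\<^sub>R A' x" for r x
      by (simp add: Rep_ell2_inject[symmetric] Rep_A' scaleR_ell2.rep_eq A_scale Rep_ell2)
    show "norm (A' x) \<le> norm x * C" for x
      using C[OF Rep_ell2[of x]] by (simp add: norm_Rep_ell2 Rep_A' mult.commute)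
  qed
  have lin_J: "bounded_linear J"
  proof (rule bounded_linear_intro[where K = 1])
    show "J (x + y) = J x + J y" for x y
      by (simp add: Rep_ell2_inject[symmetric] Rep_J plus_ell2.rep_eq plus_fun_def distrib_left)
    show "J (r *\<^sub>R x) = r *\<^sub>R J x" for r x
      by (simp add: Rep_ell2_inject[symmetric] Rep_J scaleR_ell2.rep_eq mult.left_commute)
    show "norm (J x) \<le> norm x * 1" for x
      by (simp add: norm_Rep_ell2 Rep_J l2_norm_def norm_mult)
  qed
  have sym_A': "inner x (A' y) = inner (A' x) y" for x y
    by (simp add: inner_ell2.rep_eq Rep_A' A_sym Rep_ell2)
  have bound_A': "\<bar>inner x (A' x)\<bar> \<le> C * inner x x" for x
  proof -
    have "\<bar>inner x (A' x)\<bar> \<le> norm x * norm (A' x)" by (rule Cauchy_Schwarz_ineq2)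
    also have "\<dots> \<le> norm x * (C * norm x)"
      using C[OF Rep_ell2[of x]] by (intro mult_left_mono) (auto simp: norm_Rep_ell2 Rep_A' l2_norm_nonneg)
    also have "\<dots> = C * inner x x" by (simp add: power2_norm_eq_inner[symmetric] power2_eq_square)
    finally show ?thesis .
  qed

  define T where "T x = (1 / (2 * C)) *\<^sub>R (A' x + C *\<^sub>R x)" for x
  interpret positive_contraction T
  proof (rule positive_contraction.intro)
    show "bounded_linear T"
      unfolding T_def[abs_def]
      by (intro bounded_linear_const_scaleR bounded_linear_add lin_A' bounded_linear_scaleR_right)
    show "inner x (T y) = inner (T x) y" for x y
      by (simp add: T_def inner_add_left inner_add_right sym_A')
    show "0 \<le> inner x (T x)" for x
      using bound_A'[of x] C_pos by (simp add: T_def inner_add_right)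
    show "inner x (T x) \<le> inner x x" for x
    proof -
      have "inner x (A' x) + C * inner x x \<le> 2 * C * inner x x" using bound_A'[of x] by linarith
      then show ?thesis using C_pos by (simp add: T_def inner_add_right field_simps)
    qed
  qed
  have J_T: "J (T x) = T (J x)" for x
  proof -
    have "J (A' x) = A' (J x)"
      by (simp add: Rep_ell2_inject[symmetric] Rep_J Rep_A' A_scale Rep_ell2)
    then show ?thesis
      by (simp add: T_def linear_cmul[OF bounded_linear.linear[OF lin_J]] linear_add[OF bounded_linear.linear[OF lin_J]])
  qed
  define g where "g t = 2 * C * t - C" for t :: real
  have g[measurable]: "g \<in> borel_measurable borel" unfolding g_def by measurable
  have vimage: "g -` B \<in> sets borel" if "B \<in> sets borel" for B
    using measurable_sets[OF g that] by simp
  define P where "P B \<phi> = Rep_ell2 (indicator_op (g -` B) (Abs_ell2 \<phi>))" for B \<phi>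
  have Abs_add: "Abs_ell2 (\<phi> + \<psi>) = Abs_ell2 \<phi> + Abs_ell2 \<psi>" if "\<phi> \<in> l2" "\<psi> \<in> l2" for \<phi> \<psi> :: "'i \<Rightarrow> complex"
    using that by (simp add: Rep_ell2_inject[symmetric] plus_ell2.rep_eq Abs_ell2_inverse l2_add)
  have Abs_scale: "Abs_ell2 (cscale c \<phi>) = Re c *\<^sub>R Abs_ell2 \<phi> + Im c *\<^sub>R J (Abs_ell2 \<phi>)" if "\<phi> \<in> l2" for c and \<phi> :: "'i \<Rightarrow> complex"
  proof -
    have "cscale c \<phi> = cscale (complex_of_real (Re c)) \<phi> + cscale (complex_of_real (Im c)) (cscale \<i> \<phi>)"
      by (rule ext) (simp add: plus_fun_def complex_eq_iff algebra_simps)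
    moreover have "Rep_ell2 (Re c *\<^sub>R Abs_ell2 \<phi> + Im c *\<^sub>R J (Abs_ell2 \<phi>))
        = cscale (complex_of_real (Re c)) \<phi> + cscale (complex_of_real (Im c)) (cscale \<i> \<phi>)"
      by (simp only: plus_ell2.rep_eq scaleR_ell2.rep_eq Rep_J Abs_ell2_inverse[OF that])
    moreover have "Rep_ell2 (Abs_ell2 (cscale c \<phi>)) = cscale c \<phi>"
      by (rule Abs_ell2_inverse) (rule l2_cscale[OF that])
    ultimately show ?thesis
      by (simp only: Rep_ell2_inject[symmetric])
  qed
  have inner_J: "inner (J x) (indicator_op B y) = inner (J (indicator_op B x)) y" if "B \<in> sets borel" for B x y
    using indicator_op_intertwine[of J, OF lin_J J_T that, of x] by (simp add: indicator_op_sym[OF that])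
  have proj: "orthogonal_projection (P B)" if B: "B \<in> sets borel" for B
    unfolding orthogonal_projection_def
  proof (intro conjI ballI allI)
    note V = vimage[OF B]
    note lin = linear_indicator_op[OF V]
    fix \<phi> \<psi> :: "'i \<Rightarrow> complex" and c
    assume \<phi>: "\<phi> \<in> l2"
    show "P B \<phi> \<in> l2" by (simp add: P_def Rep_ell2)
    show "P B (P B \<phi>) = P B \<phi>" by (simp add: P_def Rep_ell2_inverse indicator_op_idem[OF V])
    have J: "indicator_op (g -` B) (J x) = J (indicator_op (g -` B) x)" for x
      by (rule indicator_op_intertwine[of J, OF lin_J J_T V])
    have "Abs_ell2 (P B (cscale c \<phi>)) = Abs_ell2 (cscale c (P B \<phi>))"
      using \<phi> by (simp add: Abs_scale P_def Rep_ell2 Rep_ell2_inverse linear_add[OF lin] linear_cmul[OF lin] J)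
    then show "P B (cscale c \<phi>) = cscale c (P B \<phi>)"
      using Abs_ell2_inject[of "P B (cscale c \<phi>)" "cscale c (P B \<phi>)"] by (simp add: P_def Rep_ell2 l2_cscale)
    assume \<psi>: "\<psi> \<in> l2"
    show "P B (\<phi> + \<psi>) = P B \<phi> + P B \<psi>"
      by (simp add: P_def Abs_add \<phi> \<psi> linear_add[OF lin] plus_ell2.rep_eq)
    have P_l2: "P B \<xi> \<in> l2" for \<xi> by (simp add: P_def Rep_ell2)
    show "l2_inner \<phi> (P B \<psi>) = l2_inner (P B \<phi>) \<psi>"
    proof (rule complex_eqI)
      show "Re (l2_inner \<phi> (P B \<psi>)) = Re (l2_inner (P B \<phi>) \<psi>)"
        using \<phi> \<psi> P_l2 by (simp add: Re_l2_inner) (simp add: P_def Rep_ell2_inverse indicator_op_sym[OF V])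
      have "Abs_ell2 (cscale \<i> \<xi>) = J (Abs_ell2 \<xi>)" if "\<xi> \<in> l2" for \<xi> :: "'i \<Rightarrow> complex"
        using Abs_scale[OF that, of \<i>] by simp
      then show "Im (l2_inner \<phi> (P B \<psi>)) = Im (l2_inner (P B \<phi>) \<psi>)"
        unfolding Im_l2_inner using \<phi> \<psi> P_l2
        by (simp add: Re_l2_inner l2_cscale) (simp add: P_def Rep_ell2_inverse inner_J[OF V])
    qed
  qed
  have pvm: "projection_valued_measure P"
    unfolding projection_valued_measure_def
  proof (intro conjI ballI allI impI proj)
    show "P UNIV \<phi> = \<phi>" if "\<phi> \<in> l2" for \<phi>
      using that by (simp add: P_def indicator_op_UNIV Abs_ell2_inverse)
    fix B :: "nat \<Rightarrow> real set" and \<phi> :: "'i \<Rightarrow> complex"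
    assume B: "range B \<subseteq> sets borel" "disjoint_family B" and \<phi>: "\<phi> \<in> l2"
    have Rep_sum: "Rep_ell2 (\<Sum>n<N. x n) = (\<Sum>n<N. Rep_ell2 (x n))" for N and x :: "nat \<Rightarrow> 'i ell2"
      by (induction N) (simp_all add: zero_ell2.rep_eq plus_ell2.rep_eq)
    have "(\<Sum>n<N. P (B n) \<phi>) - P (\<Union>n. B n) \<phi>
        = Rep_ell2 ((\<Sum>n<N. indicator_op (g -` B n) (Abs_ell2 \<phi>)) - indicator_op (\<Union>n. g -` B n) (Abs_ell2 \<phi>))" for N
      by (simp add: P_def minus_ell2.rep_eq Rep_sum vimage_UN)
    moreover have "(\<lambda>N. norm ((\<Sum>n<N. indicator_op (g -` B n) (Abs_ell2 \<phi>)) - indicator_op (\<Union>n. g -` B n) (Abs_ell2 \<phi>))) \<longlonglongrightarrow> 0"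
    proof (rule indicator_op_countably_additive)
      show "range (\<lambda>n. g -` B n) \<subseteq> sets borel" using B(1) vimage by auto
      show "disjoint_family (\<lambda>n. g -` B n)" using B(2) unfolding disjoint_family_on_def by blast
    qed
    ultimately show "(\<lambda>N. l2_norm ((\<Sum>n<N. P (B n) \<phi>) - P (\<Union>n. B n) \<phi>)) \<longlonglongrightarrow> 0"
      by (simp add: norm_Rep_ell2)
  qed
  have "integrable (scalar_measure P \<phi>) (\<lambda>t. t) \<and>
      l2_inner \<phi> (A \<phi>) = complex_of_real (\<integral>t. t \<partial>scalar_measure P \<phi>)" if \<phi>: "\<phi> \<in> l2" for \<phi>
  proof -
    define x where "x = Abs_ell2 \<phi>"
    interpret finite_measure "vector_measure x" by (rule finite_vector_measure)
    have g_meas: "g \<in> measurable (vector_measure x) borel"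
      by (simp add: measurable_cong_sets[OF sets_vector_measure refl] g)
    have scalar: "scalar_measure P \<phi> = distr (vector_measure x) borel g"
    proof (rule measure_eqI)
      fix B assume "B \<in> sets (scalar_measure P \<phi>)"
      then have B: "B \<in> sets borel" by (simp add: sets_scalar_measure)
      have "emeasure (scalar_measure P \<phi>) B = ennreal (inner x (indicator_op (g -` B) x))"
        unfolding emeasure_scalar_measure[OF pvm \<phi> B]
        by (simp add: Re_l2_inner \<phi> P_def Rep_ell2 Rep_ell2_inverse x_def)
      then show "emeasure (scalar_measure P \<phi>) B = emeasure (distr (vector_measure x) borel g) B"
        by (simp add: inner_indicator_op[OF vimage[OF B]] emeasure_distr[OF g_meas B] space_vector_measure emeasure_eq_measure)
    qed (simp add: sets_scalar_measure)
    have int: "integrable (vector_measure x) g"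
      unfolding g_def using integral_id_vector_measure(1)[of x] by simp
    have "(\<integral>t. t \<partial>scalar_measure P \<phi>) = (\<integral>t. g t \<partial>vector_measure x)"
      unfolding scalar by (subst integral_distr[OF g_meas]) simp_all
    also have "\<dots> = 2 * C * inner x (T x) - C * inner x x"
      unfolding g_def using integral_id_vector_measure[of x]
      by (simp add: space_vector_measure measure_vector_UNIV)
    also have "\<dots> = inner x (A' x)"
      using C_pos by (simp add: T_def inner_add_right field_simps)
    also have "\<dots> = Re (l2_inner \<phi> (A \<phi>))"
      by (simp add: inner_ell2.rep_eq Rep_A' x_def Abs_ell2_inverse \<phi>)
    finally have Re: "Re (l2_inner \<phi> (A \<phi>)) = (\<integral>t. t \<partial>scalar_measure P \<phi>)" by simp
    have "Im (l2_inner \<phi> (A \<phi>)) = 0"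
      using arg_cong[OF l2_inner_cnj[of "A \<phi>" \<phi>], of Im] by (simp add: A_sym \<phi>)
    moreover have "integrable (scalar_measure P \<phi>) (\<lambda>t. t)"
      unfolding scalar using int by (subst integrable_distr_eq[OF g_meas]) simp_all
    ultimately show ?thesis
      using Re by (simp add: complex_eq_iff)
  qed
  then show ?thesis
    using pvm by (intro exI[of _ P]) (simp add: spectral_measure_of_def)
qed

section \<open>Quadratic forms and the dimension of spectral subspaces\<close>

lemma spectral_measure_of_spectral_projection:
  assumes "bounded_symmetric A"
  shows "spectral_measure_of A (spectral_projection A)"
  unfolding spectral_projection_def using spectral_theorem_bounded_symmetric[OF assms] by (rule someI_ex)

lemma spectral_form_eq_integral:
  assumes P: "spectral_measure_of A P" and \<phi>: "\<phi> \<in> l2"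
  shows "finite_measure (scalar_measure P \<phi>)"
    and "integrable (scalar_measure P \<phi>) (\<lambda>t. t)"
    and "measure (scalar_measure P \<phi>) UNIV = (l2_norm \<phi>)\<^sup>2"
    and "Re (l2_inner \<phi> (A \<phi>)) = (\<integral>t. t \<partial>scalar_measure P \<phi>)"
proof -
  have pvm: "projection_valued_measure P" using P by (simp add: spectral_measure_of_def)
  have "P UNIV \<phi> = \<phi>" using pvm \<phi> by (simp add: projection_valued_measure_def)
  then have em: "emeasure (scalar_measure P \<phi>) UNIV = ennreal ((l2_norm \<phi>)\<^sup>2)"
    by (subst emeasure_scalar_measure[OF pvm \<phi>]) (simp_all add: l2_norm_eq_inner)
  then show "finite_measure (scalar_measure P \<phi>)"
    by (intro finite_measureI) (simp add: space_scalar_measure)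
  show "measure (scalar_measure P \<phi>) UNIV = (l2_norm \<phi>)\<^sup>2"
    using em by (simp add: measure_def)
  show "integrable (scalar_measure P \<phi>) (\<lambda>t. t)"
    and "Re (l2_inner \<phi> (A \<phi>)) = (\<integral>t. t \<partial>scalar_measure P \<phi>)"
    using P \<phi> by (simp_all add: spectral_measure_of_def)
qed

text \<open>
  For a vector in the range, the half-line already carries the full mass of its scalar measure.
\<close>

lemma form_ge_on_spectral_subspace:
  assumes P: "spectral_measure_of A P" and \<phi>: "\<phi> \<in> l2" "P {x..} \<phi> = \<phi>"
  shows "x * (l2_norm \<phi>)\<^sup>2 \<le> Re (l2_inner \<phi> (A \<phi>))"
proof -
  let ?\<mu> = "scalar_measure P \<phi>"
  note form = spectral_form_eq_integral[OF P \<phi>(1)]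
  interpret finite_measure ?\<mu> by (rule form)
  have pvm: "projection_valued_measure P" using P by (simp add: spectral_measure_of_def)
  have "emeasure ?\<mu> {x..} = ennreal ((l2_norm \<phi>)\<^sup>2)"
    by (subst emeasure_scalar_measure[OF pvm \<phi>(1)]) (simp_all add: l2_norm_eq_inner \<phi>)
  then have "measure ?\<mu> {x..} = (l2_norm \<phi>)\<^sup>2" by (simp add: measure_def)
  then have "measure ?\<mu> (UNIV - {x..}) = 0"
    using finite_measure_compl[of "{x..}"] form(3) by (simp add: sets_scalar_measure space_scalar_measure)
  then have "AE t in ?\<mu>. x \<le> t"
    by (intro AE_I[of _ _ "UNIV - {x..}"]) (auto simp: emeasure_eq_measure sets_scalar_measure)
  then have "(\<integral>t. x \<partial>?\<mu>) \<le> (\<integral>t. t \<partial>?\<mu>)"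
    by (intro integral_mono_AE form(2)) simp_all
  then show ?thesis
    by (simp add: form(3,4) space_scalar_measure mult.commute)
qed

text \<open>
  The scalar measure is concentrated on \<open>t < x\<close> and does not vanish, so the mean of \<open>t\<close> is strictly less than that of \<open>x\<close>.
\<close>

lemma form_less_on_spectral_complement:
  assumes P: "spectral_measure_of A P" and \<phi>: "\<phi> \<in> l2" "P {x..} \<phi> = 0" "\<phi> \<noteq> 0"
  shows "Re (l2_inner \<phi> (A \<phi>)) < x * (l2_norm \<phi>)\<^sup>2"
proof -
  let ?\<mu> = "scalar_measure P \<phi>"
  note form = spectral_form_eq_integral[OF P \<phi>(1)]
  interpret finite_measure ?\<mu> by (rule form)
  have pvm: "projection_valued_measure P" using P by (simp add: spectral_measure_of_def)
  have "l2_inner \<phi> 0 = 0" by (simp add: l2_inner_def)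
  then have "emeasure ?\<mu> {x..} = 0"
    by (subst emeasure_scalar_measure[OF pvm \<phi>(1)]) (simp_all add: \<phi>(2))
  then have "AE t in ?\<mu>. t < x"
    by (intro AE_I[of _ _ "{x..}"]) (auto simp: sets_scalar_measure)
  moreover have "emeasure ?\<mu> (space ?\<mu>) \<noteq> 0"
    using form(3) l2_norm_eq_0[OF \<phi>(1)] \<phi>(3) by (simp add: emeasure_eq_measure space_scalar_measure)
  ultimately have "(\<integral>t. t \<partial>?\<mu>) < (\<integral>t. x \<partial>?\<mu>)"
    by (intro integral_less_AE_space form(2)) simp_all
  then show ?thesis
    by (simp add: form(3,4) space_scalar_measure mult.commute)
qed

lemma orthogonal_projection_image:
  assumes "orthogonal_projection P"
  shows "P ` l2 = {\<phi> \<in> l2. P \<phi> = \<phi>}"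
  using assms unfolding orthogonal_projection_def by (auto simp: image_iff) metis

interpretation fun_space: vector_space "cscale :: complex \<Rightarrow> ('i \<Rightarrow> complex) \<Rightarrow> 'i \<Rightarrow> complex"
  by unfold_locales (auto simp: plus_fun_def algebra_simps)

lemma dim_at_least_map:
  assumes dim: "dim_at_least j V"
    and V_zero: "0 \<in> V" and V_add: "\<And>\<phi> \<psi>. \<phi> \<in> V \<Longrightarrow> \<psi> \<in> V \<Longrightarrow> \<phi> + \<psi> \<in> V"
    and V_scale: "\<And>c \<phi>. \<phi> \<in> V \<Longrightarrow> cscale c \<phi> \<in> V"
    and F_add: "\<And>\<phi> \<psi>. \<phi> \<in> V \<Longrightarrow> \<psi> \<in> V \<Longrightarrow> F (\<phi> + \<psi>) = F \<phi> + F \<psi>"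
    and F_scale: "\<And>c \<phi>. \<phi> \<in> V \<Longrightarrow> F (cscale c \<phi>) = cscale c (F \<phi>)"
    and F_W: "\<And>\<phi>. \<phi> \<in> V \<Longrightarrow> F \<phi> \<in> W"
    and F_inj: "\<And>\<phi>. \<phi> \<in> V \<Longrightarrow> F \<phi> = 0 \<Longrightarrow> \<phi> = 0"
  shows "dim_at_least j W"
proof -
  obtain S where S: "S \<subseteq> V" "finite S" "card S = j" "\<not> fun_space.dependent S"
    using dim unfolding dim_at_least_def by blast
  have F_zero: "F 0 = 0"
    using F_scale[OF V_zero, of 0] by (simp add: zero_fun_def)
  have sum: "(\<Sum>v\<in>S'. cscale (u v) v) \<in> V \<and> F (\<Sum>v\<in>S'. cscale (u v) v) = (\<Sum>v\<in>S'. cscale (u v) (F v))"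
    if "finite S'" "S' \<subseteq> V" for S' u
    using that
  proof (induction S')
    case empty
    show ?case using V_zero F_zero by (simp only: sum.empty simp_thms)
  next
    case (insert v S')
    then have v: "v \<in> V" "(\<Sum>v\<in>S'. cscale (u v) v) \<in> V" by auto
    show ?case
      unfolding sum.insert[OF insert.hyps]
      using insert v by (simp only: F_add[OF V_scale v(2), OF v(1)] F_scale V_add[OF V_scale v(2), OF v(1)]) simp
  qed
  have inj: "inj_on F S"
  proof (rule inj_onI)
    fix a b assume ab: "a \<in> S" "b \<in> S" "F a = F b"
    then have V: "a \<in> V" "b \<in> V" using S(1) by auto
    have "F (a + cscale (-1) b) = 0"
      using V ab(3) by (simp only: F_add V_scale F_scale) (simp add: fun_eq_iff)
    then have "a + cscale (-1) b = 0"
      using V by (intro F_inj V_add V_scale)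
    then show "a = b" by (simp add: fun_eq_iff)
  qed
  have "\<not> fun_space.dependent (F ` S)"
  proof
    assume "fun_space.dependent (F ` S)"
    then obtain u where u: "\<exists>w\<in>F ` S. u w \<noteq> 0" "(\<Sum>w\<in>F ` S. cscale (u w) w) = 0"
      using fun_space.dependent_finite[of "F ` S"] S(2) by blast
    have "F (\<Sum>v\<in>S. cscale (u (F v)) v) = (\<Sum>v\<in>S. cscale (u (F v)) (F v))"
      using sum[OF S(2,1), of "\<lambda>v. u (F v)"] by blast
    also have "\<dots> = 0"
      using u(2) by (simp only: sum.reindex[OF inj] o_def)
    finally have "(\<Sum>v\<in>S. cscale (u (F v)) v) = 0"
      using sum[OF S(2,1), of "\<lambda>v. u (F v)"] F_inj by blast
    moreover have "\<exists>v\<in>S. u (F v) \<noteq> 0" using u(1) by blast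
    ultimately have "fun_space.dependent S"
      unfolding fun_space.dependent_finite[OF S(2)] by (intro exI[of _ "\<lambda>v. u (F v)"]) blast
    then show False using S(4) by blast
  qed
  then show ?thesis
    unfolding dim_at_least_def
    using S(1,2,3) F_W card_image[OF inj] by (intro exI[of _ "F ` S"]) auto
qed

lemma dim_at_least_l2:
  assumes "infinite (UNIV :: 'i set)"
  shows "dim_at_least j (l2 :: ('i \<Rightarrow> complex) set)"
proof -
  obtain I :: "'i set" where I: "finite I" "card I = j"
    using infinite_arbitrarily_large[OF assms] by blast
  define \<delta> :: "'i \<Rightarrow> 'i \<Rightarrow> complex" where "\<delta> i k = (if k = i then 1 else 0)" for i k
  have \<delta>_l2: "\<delta> i \<in> l2" for i
  proof -
    have "(\<lambda>k. (cmod (\<delta> i k))\<^sup>2) summable_on {i}" by simp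
    then have "(\<lambda>k. (cmod (\<delta> i k))\<^sup>2) summable_on UNIV"
      by (rule summable_on_cong_neutral[THEN iffD1, rotated 3]) (auto simp: \<delta>_def)
    then show ?thesis by (simp add: l2_def)
  qed
  have inj: "inj_on \<delta> I"
    by (rule inj_onI) (metis \<delta>_def one_neq_zero)
  have "\<not> fun_space.dependent (\<delta> ` I)"
  proof
    assume "fun_space.dependent (\<delta> ` I)"
    then obtain u where u: "\<exists>w\<in>\<delta> ` I. u w \<noteq> 0" "(\<Sum>w\<in>\<delta> ` I. cscale (u w) w) = 0"
      using fun_space.dependent_finite[of "\<delta> ` I"] I(1) by blast
    have "u (\<delta> i) = 0" if "i \<in> I" for i
    proof -
      have "0 = (\<Sum>w\<in>\<delta> ` I. cscale (u w) w) i" using u(2) by (simp add: zero_fun_def)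
      also have "\<dots> = (\<Sum>k\<in>I. u (\<delta> k) * \<delta> k i)"
        unfolding sum.reindex[OF inj] o_def by (induction I rule: infinite_finite_induct) (auto simp: plus_fun_def zero_fun_def)
      also have "\<dots> = u (\<delta> i)"
        using that I(1) by (simp add: \<delta>_def if_distrib[of "\<lambda>c. _ * c"] cong: if_cong)
      finally show ?thesis by simp
    qed
    then show False using u(1) by auto
  qed
  then show ?thesis
    unfolding dim_at_least_def using I \<delta>_l2 card_image[OF inj] by (intro exI[of _ "\<delta> ` I"]) auto
qed

text \<open>
  The min-max principle: the projection is injective on a space where the form is large, because the form is
  strictly smaller on its kernel. The space is given as the image of \<open>V\<close> under an injective linear map \<open>F\<close>.
\<close>

lemma dim_at_least_spectral_projection:
  assumes A: "bounded_symmetric A" and dim: "dim_at_least j V"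
    and V_zero: "0 \<in> V" and V_add: "\<And>\<phi> \<psi>. \<phi> \<in> V \<Longrightarrow> \<psi> \<in> V \<Longrightarrow> \<phi> + \<psi> \<in> V"
    and V_scale: "\<And>c \<phi>. \<phi> \<in> V \<Longrightarrow> cscale c \<phi> \<in> V"
    and F_l2: "\<And>\<phi>. \<phi> \<in> V \<Longrightarrow> F \<phi> \<in> l2"
    and F_add: "\<And>\<phi> \<psi>. \<phi> \<in> V \<Longrightarrow> \<psi> \<in> V \<Longrightarrow> F (\<phi> + \<psi>) = F \<phi> + F \<psi>"
    and F_scale: "\<And>c \<phi>. \<phi> \<in> V \<Longrightarrow> F (cscale c \<phi>) = cscale c (F \<phi>)"
    and F_inj: "\<And>\<phi>. \<phi> \<in> V \<Longrightarrow> F \<phi> = 0 \<Longrightarrow> \<phi> = 0"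
    and form: "\<And>\<phi>. \<phi> \<in> V \<Longrightarrow> x * (l2_norm (F \<phi>))\<^sup>2 \<le> Re (l2_inner (F \<phi>) (A (F \<phi>)))"
  shows "dim_at_least j (spectral_projection A {x..} ` l2)"
proof -
  define P where "P = spectral_projection A"
  have P: "spectral_measure_of A P"
    unfolding P_def using A by (rule spectral_measure_of_spectral_projection)
  then have proj: "orthogonal_projection (P {x..})"
    by (simp add: spectral_measure_of_def projection_valued_measure_def)
  show ?thesis
    unfolding P_def[symmetric]
  proof (rule dim_at_least_map[OF dim V_zero V_add V_scale, where F = "\<lambda>\<phi>. P {x..} (F \<phi>)"])
    show "P {x..} (F (\<phi> + \<psi>)) = P {x..} (F \<phi>) + P {x..} (F \<psi>)" if "\<phi> \<in> V" "\<psi> \<in> V" for \<phi> \<psi>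
      using proj that F_l2 by (simp add: F_add orthogonal_projection_def)
    show "P {x..} (F (cscale c \<phi>)) = cscale c (P {x..} (F \<phi>))" if "\<phi> \<in> V" for c \<phi>
      using proj that F_l2 by (simp add: F_scale orthogonal_projection_def)
    show "P {x..} (F \<phi>) \<in> P {x..} ` l2" if "\<phi> \<in> V" for \<phi>
      using F_l2[OF that] by blast
    show "\<phi> = 0" if "\<phi> \<in> V" "P {x..} (F \<phi>) = 0" for \<phi>
      using form_less_on_spectral_complement[OF P F_l2[OF that(1)] that(2)] form[OF that(1)] F_inj[OF that(1)]
      by fastforce
  qed auto
qed

lemma bounded_symmetric_l2: "bounded_symmetric A \<Longrightarrow> \<phi> \<in> l2 \<Longrightarrow> A \<phi> \<in> l2"
  by (simp add: bounded_symmetric_def)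

lemma bounded_symmetric_bound:
  "bounded_symmetric A \<Longrightarrow> \<exists>C. \<forall>\<phi>\<in>l2. l2_norm (A \<phi>) \<le> C * l2_norm \<phi>"
  by (simp only: bounded_symmetric_def)

text \<open>
  The implication between the forms is assumed for positive \<open>x\<close>; the maximum with zero absorbs the other thresholds. The
  first set of spectral thresholds has to be nonempty and the second bounded above, since otherwise the suprema would
  be meaningless default values.
\<close>

theorem sup_spectrum_le:
  fixes A A' :: "('i \<Rightarrow> complex) \<Rightarrow> ('i \<Rightarrow> complex)"
  assumes inf: "infinite (UNIV :: 'i set)" and A: "bounded_symmetric A" and A': "bounded_symmetric A'" and j: "j \<ge> 1"
    and F_l2: "\<And>\<phi>. \<phi> \<in> l2 \<Longrightarrow> F \<phi> \<in> l2"
    and F_add: "\<And>\<phi> \<psi>. F (\<phi> + \<psi>) = F \<phi> + F \<psi>"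
    and F_scale: "\<And>c \<phi>. F (cscale c \<phi>) = cscale c (F \<phi>)"
    and F_inj: "\<And>\<phi>. F \<phi> = 0 \<Longrightarrow> \<phi> = 0"
    and form: "\<And>x \<phi>. 0 < x \<Longrightarrow> \<phi> \<in> l2 \<Longrightarrow> x * (l2_norm \<phi>)\<^sup>2 \<le> Re (l2_inner \<phi> (A \<phi>)) \<Longrightarrow>
        x * (l2_norm (F \<phi>))\<^sup>2 \<le> Re (l2_inner (F \<phi>) (A' (F \<phi>)))"
  shows "max 0 (Sup {x. dim_at_least j (spectral_projection A {x..} ` l2)})
       \<le> max 0 (Sup {x. dim_at_least j (spectral_projection A' {x..} ` l2)})"
proof -
  define E where "E A = {x. dim_at_least j (spectral_projection A {x..} ` l2)}" for A :: "('i \<Rightarrow> complex) \<Rightarrow> ('i \<Rightarrow> complex)"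
  have range: "spectral_projection A {x..} ` l2 = {\<phi> \<in> l2. spectral_projection A {x..} \<phi> = \<phi>}"
    and proj: "orthogonal_projection (spectral_projection A {x..})"
    if "bounded_symmetric A" for A :: "('i \<Rightarrow> complex) \<Rightarrow> ('i \<Rightarrow> complex)" and x
  proof -
    show proj: "orthogonal_projection (spectral_projection A {x..})"
      using spectral_measure_of_spectral_projection[OF that]
      by (simp add: spectral_measure_of_def projection_valued_measure_def)
    show "spectral_projection A {x..} ` l2 = {\<phi> \<in> l2. spectral_projection A {x..} \<phi> = \<phi>}"
      using proj by (rule orthogonal_projection_image)
  qed
  have bdd: "bdd_above (E A')"
  proof -
    obtain C where C: "\<forall>\<phi>\<in>l2. l2_norm (A' \<phi>) \<le> C * l2_norm \<phi>"
      using bounded_symmetric_bound[OF A'] by (elim exE)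
    note A'_l2 = bounded_symmetric_l2[OF A']
    have "x \<le> C" if x: "x \<in> E A'" for x
    proof -
      have dim: "dim_at_least j (spectral_projection A' {x..} ` l2)"
        using x by (simp only: E_def mem_Collect_eq)
      obtain S where S: "S \<subseteq> spectral_projection A' {x..} ` l2" "finite S" "card S = j" "\<not> fun_space.dependent S"
        using dim unfolding dim_at_least_def by blast
      have "S \<noteq> {}" using S(3) j by auto
      then obtain \<phi> where "\<phi> \<in> S" by blast
      moreover have "0 \<notin> S" using S(4) fun_space.dependent_zero by blast
      ultimately have \<phi>: "\<phi> \<in> l2" "spectral_projection A' {x..} \<phi> = \<phi>" "\<phi> \<noteq> 0"
        using S(1) unfolding range[OF A'] by blast+
      have "x * (l2_norm \<phi>)\<^sup>2 \<le> Re (l2_inner \<phi> (A' \<phi>))"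
        by (rule form_ge_on_spectral_subspace[OF spectral_measure_of_spectral_projection[OF A'] \<phi>(1,2)])
      also have "\<dots> \<le> l2_norm \<phi> * l2_norm (A' \<phi>)"
        using l2_Cauchy_Schwarz[OF \<phi>(1) A'_l2[OF \<phi>(1)]] by linarith
      also have "\<dots> \<le> l2_norm \<phi> * (C * l2_norm \<phi>)"
        by (intro mult_left_mono bspec[OF C] \<phi> l2_norm_nonneg)
      also have "\<dots> = C * (l2_norm \<phi>)\<^sup>2" by (simp add: power2_eq_square)
      finally show ?thesis
        using l2_norm_eq_0[OF \<phi>(1)] \<phi>(3) by simp
    qed
    then show ?thesis by (rule bdd_aboveI)
  qed
  have nonempty: "E A \<noteq> {}"
  proof -
    obtain C where C: "\<forall>\<phi>\<in>l2. l2_norm (A \<phi>) \<le> C * l2_norm \<phi>"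
      using bounded_symmetric_bound[OF A] by (elim exE)
    note A_l2 = bounded_symmetric_l2[OF A]
    have "dim_at_least j (spectral_projection A {- C..} ` l2)"
    proof (rule dim_at_least_spectral_projection[OF A dim_at_least_l2[OF inf], where F = "\<lambda>\<phi>. \<phi>"])
      fix \<phi> :: "'i \<Rightarrow> complex" assume \<phi>: "\<phi> \<in> l2"
      have "\<bar>Re (l2_inner \<phi> (A \<phi>))\<bar> \<le> l2_norm \<phi> * l2_norm (A \<phi>)"
        by (intro l2_Cauchy_Schwarz A_l2 \<phi>)
      also have "\<dots> \<le> l2_norm \<phi> * (C * l2_norm \<phi>)"
        by (intro mult_left_mono bspec[OF C] \<phi> l2_norm_nonneg)
      finally show "- C * (l2_norm \<phi>)\<^sup>2 \<le> Re (l2_inner \<phi> (A \<phi>))"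
        by (simp add: power2_eq_square abs_le_iff algebra_simps)
    qed (auto intro: l2_zero l2_add l2_cscale)
    then show ?thesis by (auto simp: E_def)
  qed
  have transfer: "x \<in> E A'" if x: "x \<in> E A" "0 < x" for x
    unfolding E_def mem_Collect_eq
  proof (rule dim_at_least_spectral_projection[OF A', where F = F and V = "spectral_projection A {x..} ` l2"])
    show "dim_at_least j (spectral_projection A {x..} ` l2)" using x by (simp add: E_def)
    note P = proj[OF A, of x, unfolded orthogonal_projection_def]
    have V: "\<phi> \<in> spectral_projection A {x..} ` l2 \<longleftrightarrow> \<phi> \<in> l2 \<and> spectral_projection A {x..} \<phi> = \<phi>" for \<phi>
      unfolding range[OF A] by simp
    show "0 \<in> spectral_projection A {x..} ` l2"
      using P V l2_zero by (metis fun_space.scale_zero_left)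
    show "\<phi> + \<psi> \<in> spectral_projection A {x..} ` l2"
      if "\<phi> \<in> spectral_projection A {x..} ` l2" "\<psi> \<in> spectral_projection A {x..} ` l2" for \<phi> \<psi>
      using that P l2_add[of \<phi> \<psi>] unfolding V by simp
    show "cscale c \<phi> \<in> spectral_projection A {x..} ` l2" if "\<phi> \<in> spectral_projection A {x..} ` l2" for c \<phi>
      using that P l2_cscale[of \<phi> c] unfolding V by simp
    show "x * (l2_norm (F \<phi>))\<^sup>2 \<le> Re (l2_inner (F \<phi>) (A' (F \<phi>)))"
      if "\<phi> \<in> spectral_projection A {x..} ` l2" for \<phi>
      using that form_ge_on_spectral_subspace[OF spectral_measure_of_spectral_projection[OF A]] form[OF x(2)]
      unfolding V by blast
    show "F \<phi> \<in> l2" if "\<phi> \<in> spectral_projection A {x..} ` l2" for \<phi>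
      using that F_l2 unfolding V by blast
  qed (auto simp: F_add F_scale F_inj)
  have "Sup (E A) \<le> max 0 (Sup (E A'))"
  proof (rule cSup_least[OF nonempty])
    fix x assume "x \<in> E A"
    then show "x \<le> max 0 (Sup (E A'))"
      using transfer[of x] cSup_upper[OF _ bdd, of x] by (cases "0 < x") auto
  qed
  then show ?thesis by (simp add: E_def)
qed

section \<open>Jacobi operators are bounded and symmetric\<close>

definition unit_steps :: "(int ^ 'n) set" where
  "unit_steps = range (\<lambda>k. axis k 1) \<union> range (\<lambda>k. - axis k 1)"

lemma finite_unit_steps: "finite (unit_steps :: (int ^ 'n) set)"
  by (simp add: unit_steps_def)

lemma uminus_unit_steps: "d \<in> unit_steps \<Longrightarrow> - d \<in> unit_steps"
  by (auto simp: unit_steps_def)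

lemma nearest_neighbors_iff: "nearest_neighbors l m \<longleftrightarrow> m - l \<in> unit_steps"
  by (auto simp: nearest_neighbors_def unit_steps_def algebra_simps)

lemma nearest_neighbors_step: "d \<in> unit_steps \<Longrightarrow> nearest_neighbors l (l + d)"
  by (simp add: nearest_neighbors_iff)

lemma sum_nearest_neighbors: "(\<Sum>m | nearest_neighbors l m. f m) = (\<Sum>d\<in>unit_steps. f (l + d))"
  by (rule sum.reindex_bij_witness[of _ "\<lambda>d. l + d" "\<lambda>m. m - l"]) (auto simp: nearest_neighbors_iff)

text \<open>
  Reversing the direction of every bond; combined with a translation it exchanges the two ends of a bond.
\<close>

lemma sum_unit_steps_uminus: "(\<Sum>d\<in>unit_steps. f (- d)) = (\<Sum>d\<in>unit_steps. f d)"
  by (rule sum.reindex_bij_witness[of _ uminus uminus]) (auto simp: uminus_unit_steps)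

lemma bij_translation: "bij_betw (\<lambda>l. l + d) UNIV (UNIV :: (int ^ 'n) set)"
  by (rule bij_betwI[of _ _ _ "\<lambda>l. l - d"]) auto

lemma infinite_lattice: "infinite (UNIV :: (int ^ 'n) set)"
proof
  assume "finite (UNIV :: (int ^ 'n) set)"
  moreover have "inj (\<lambda>k :: int. (\<chi> i. k) :: int ^ 'n)"
    by (rule injI) (simp add: vec_eq_iff)
  ultimately have "finite (UNIV :: int set)"
    using finite_imageD finite_subset subset_UNIV by metis
  then show False using infinite_UNIV_int by blast
qed

lemma bounded_parameters_bound:
  fixes a :: "int ^ 'n \<Rightarrow> int ^ 'n \<Rightarrow> real"
  shows "bounded_parameters a b \<longleftrightarrow> (\<exists>C. (\<forall>d\<in>unit_steps. \<forall>l. \<bar>a l (l + d)\<bar> \<le> C) \<and> (\<forall>l. \<bar>b l\<bar> \<le> C))"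
proof
  assume "bounded_parameters a b"
  then obtain C1 C2 where C: "\<forall>x\<in>{a l m | l m. nearest_neighbors l m}. norm x \<le> C1" "\<forall>x\<in>range b. norm x \<le> C2"
    by (auto simp: bounded_parameters_def bounded_iff)
  have "\<bar>a l (l + d)\<bar> \<le> max C1 C2" if "d \<in> unit_steps" for l d
    using C(1) nearest_neighbors_step[OF that, of l] by fastforce
  moreover have "\<bar>b l\<bar> \<le> max C1 C2" for l
    using C(2) by (auto simp: le_max_iff_disj)
  ultimately show "\<exists>C. (\<forall>d\<in>unit_steps. \<forall>l. \<bar>a l (l + d)\<bar> \<le> C) \<and> (\<forall>l. \<bar>b l\<bar> \<le> C)" by blast
next
  assume "\<exists>C. (\<forall>d\<in>unit_steps. \<forall>l. \<bar>a l (l + d)\<bar> \<le> C) \<and> (\<forall>l. \<bar>b l\<bar> \<le> C)"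
  then obtain C where C: "\<forall>d\<in>unit_steps. \<forall>l. \<bar>a l (l + d)\<bar> \<le> C" "\<forall>l. \<bar>b l\<bar> \<le> C" by blast
  have "\<bar>a l m\<bar> \<le> C" if "nearest_neighbors l m" for l m
  proof -
    have "m - l \<in> unit_steps" using that by (simp add: nearest_neighbors_iff)
    then have "\<bar>a l (l + (m - l))\<bar> \<le> C" using C(1) by blast
    then show ?thesis by simp
  qed
  then have "bounded {a l m | l m. nearest_neighbors l m}" by (auto simp: bounded_iff)
  moreover have "bounded (range b)" using C(2) by (auto simp: bounded_iff)
  ultimately show "bounded_parameters a b" by (simp add: bounded_parameters_def)
qed

lemma bounded_parameters_add:
  assumes "bounded_parameters a b" "bounded_parameters a' b'"
  shows "bounded_parameters (\<lambda>l m. a l m + a' l m) (\<lambda>l. b l + b' l)"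
proof -
  obtain C C' where C: "\<forall>d\<in>unit_steps. \<forall>l. \<bar>a l (l + d)\<bar> \<le> C" "\<forall>l. \<bar>b l\<bar> \<le> C"
    "\<forall>d\<in>unit_steps. \<forall>l. \<bar>a' l (l + d)\<bar> \<le> C'" "\<forall>l. \<bar>b' l\<bar> \<le> C'"
    using assms unfolding bounded_parameters_bound by blast
  have "\<bar>a l (l + d) + a' l (l + d)\<bar> \<le> C + C'" if "d \<in> unit_steps" for d l
    using C that by (meson abs_triangle_ineq add_mono order_trans)
  moreover have "\<bar>b l + b' l\<bar> \<le> C + C'" for l
    using C by (meson abs_triangle_ineq add_mono order_trans)
  ultimately show ?thesis unfolding bounded_parameters_bound by blast
qed

lemma bounded_parameters_scale:
  assumes "bounded_parameters a b"
  shows "bounded_parameters (\<lambda>l m. c * a l m) (\<lambda>l. c * b l)"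
proof -
  obtain C where C: "\<forall>d\<in>unit_steps. \<forall>l. \<bar>a l (l + d)\<bar> \<le> C" "\<forall>l. \<bar>b l\<bar> \<le> C"
    using assms unfolding bounded_parameters_bound by blast
  then have "(\<forall>d\<in>unit_steps. \<forall>l. \<bar>c * a l (l + d)\<bar> \<le> \<bar>c\<bar> * C) \<and> (\<forall>l. \<bar>c * b l\<bar> \<le> \<bar>c\<bar> * C)"
    by (auto simp: abs_mult intro!: mult_left_mono)
  then show ?thesis unfolding bounded_parameters_bound by blast
qed

lemma l2_translate:
  fixes \<phi> :: "int ^ 'n \<Rightarrow> complex"
  assumes "\<phi> \<in> l2"
  shows "(\<lambda>l. \<phi> (l + d)) \<in> l2" and "l2_norm (\<lambda>l. \<phi> (l + d)) = l2_norm \<phi>"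
  using summable_on_reindex_bij_betw[OF bij_translation[of d], of "\<lambda>l. (cmod (\<phi> l))\<^sup>2"]
    infsum_reindex_bij_betw[OF bij_translation[of d], of "\<lambda>l. (cmod (\<phi> l))\<^sup>2"] assms
  by (auto simp: l2_def l2_norm_def)

lemma l2_norm_mult_le:
  assumes "\<phi> \<in> l2" "\<And>i. cmod (c i) \<le> C"
  shows "l2_norm (\<lambda>i. c i * \<phi> i) \<le> C * l2_norm \<phi>"
proof -
  have "0 \<le> C" using assms(2) norm_ge_zero order_trans by blast
  have "(\<Sum>\<^sub>\<infinity>i. (cmod (c i * \<phi> i))\<^sup>2) \<le> (\<Sum>\<^sub>\<infinity>i. C\<^sup>2 * (cmod (\<phi> i))\<^sup>2)"
  proof (rule infsum_mono)
    show "(\<lambda>i. (cmod (c i * \<phi> i))\<^sup>2) summable_on UNIV"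
      using l2_summable[OF l2_mult_bounded[OF assms]] .
    show "(\<lambda>i. C\<^sup>2 * (cmod (\<phi> i))\<^sup>2) summable_on UNIV"
      by (intro summable_on_cmult_right l2_summable assms)
    show "(cmod (c i * \<phi> i))\<^sup>2 \<le> C\<^sup>2 * (cmod (\<phi> i))\<^sup>2" for i
      unfolding norm_mult power_mult_distrib by (intro mult_right_mono power_mono assms) auto
  qed
  then have "l2_norm (\<lambda>i. c i * \<phi> i) \<le> sqrt (C\<^sup>2 * (\<Sum>\<^sub>\<infinity>i. (cmod (\<phi> i))\<^sup>2))"
    unfolding l2_norm_def by (simp add: infsum_cmult_right')
  then show ?thesis
    using \<open>0 \<le> C\<close> by (simp add: l2_norm_def real_sqrt_mult)
qed

lemma l2_norm_triangle: "\<phi> \<in> l2 \<Longrightarrow> \<psi> \<in> l2 \<Longrightarrow> l2_norm (\<phi> + \<psi>) \<le> l2_norm \<phi> + l2_norm \<psi>"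
  using norm_triangle_ineq[of "Abs_ell2 \<phi>" "Abs_ell2 \<psi>"]
  by (simp add: norm_Rep_ell2 plus_ell2.rep_eq Abs_ell2_inverse)

lemma l2_norm_sum_le:
  assumes "\<And>k. k \<in> K \<Longrightarrow> f k \<in> l2"
  shows "l2_norm (sum f K) \<le> (\<Sum>k\<in>K. l2_norm (f k))"
  using assms
proof (induction K rule: infinite_finite_induct)
  case (insert k K)
  then have "l2_norm (f k + sum f K) \<le> l2_norm (f k) + l2_norm (sum f K)"
    by (intro l2_norm_triangle l2_sum) auto
  moreover have "l2_norm (sum f K) \<le> (\<Sum>k\<in>K. l2_norm (f k))"
    using insert by blast
  ultimately show ?case
    unfolding sum.insert[OF insert.hyps] by linarith
qed (simp_all add: l2_norm_def)

lemma l2_inner_sum_right: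
  assumes "\<phi> \<in> l2" "\<And>k. k \<in> K \<Longrightarrow> f k \<in> l2"
  shows "l2_inner \<phi> (sum f K) = (\<Sum>k\<in>K. l2_inner \<phi> (f k))"
  using assms(2)
proof (induction K rule: infinite_finite_induct)
  case (insert k K)
  have "l2_inner \<phi> (f k + sum f K) = l2_inner \<phi> (f k) + l2_inner \<phi> (sum f K)"
    using insert.prems by (intro l2_inner_add_right assms(1) l2_sum) auto
  moreover have "l2_inner \<phi> (sum f K) = (\<Sum>k\<in>K. l2_inner \<phi> (f k))"
    using insert by blast
  ultimately show ?case
    unfolding sum.insert[OF insert.hyps] by (simp only:)
qed (simp_all add: l2_inner_def)

definition hop :: "(int ^ 'n \<Rightarrow> int ^ 'n \<Rightarrow> real) \<Rightarrow> int ^ 'n \<Rightarrow> (int ^ 'n \<Rightarrow> complex) \<Rightarrow> int ^ 'n \<Rightarrow> complex" where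
  "hop a d \<phi> = (\<lambda>l. complex_of_real (a l (l + d)) * \<phi> (l + d))"

text \<open>
  A Jacobi operator is a finite sum of bounded multiplications composed with translations, one for each
  direction. This reduces boundedness and symmetry to single directions.
\<close>

lemma jacobi_operator_eq_hops:
  "jacobi_operator a b \<phi> = (\<Sum>d\<in>unit_steps. hop a d \<phi>) + (\<lambda>l. complex_of_real (b l) * \<phi> l)"
proof
  have sum_apply: "(\<Sum>d\<in>K. f d) l = (\<Sum>d\<in>K. f d l)" for K and f :: "int ^ 'n \<Rightarrow> int ^ 'n \<Rightarrow> complex" and l
    by (induction K rule: infinite_finite_induct) (auto simp: plus_fun_def zero_fun_def)
  show "jacobi_operator a b \<phi> l = ((\<Sum>d\<in>unit_steps. hop a d \<phi>) + (\<lambda>l. complex_of_real (b l) * \<phi> l)) l" for l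
    by (simp add: jacobi_operator_def sum_nearest_neighbors plus_fun_def sum_apply hop_def)
qed

lemma Re_cnj_mult_real: "Re (cnj z * (complex_of_real r * z)) = r * (cmod z)\<^sup>2"
  by (simp add: cmod_power2 power2_eq_square[of "Re z"] power2_eq_square[of "Im z"] algebra_simps)

context
  fixes a :: "int ^ 'n \<Rightarrow> int ^ 'n \<Rightarrow> real" and b :: "int ^ 'n \<Rightarrow> real"
  assumes bounded: "bounded_parameters a b"
begin

lemma hop_l2: "\<phi> \<in> l2 \<Longrightarrow> d \<in> unit_steps \<Longrightarrow> hop a d \<phi> \<in> l2"
proof -
  assume *: "\<phi> \<in> l2" "d \<in> unit_steps"
  obtain C where "\<forall>d\<in>unit_steps. \<forall>l. \<bar>a l (l + d)\<bar> \<le> C"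
    using bounded unfolding bounded_parameters_bound by blast
  then show "hop a d \<phi> \<in> l2"
    unfolding hop_def using * by (intro l2_mult_bounded[where C = C] l2_translate) auto
qed

lemma site_l2: "\<phi> \<in> l2 \<Longrightarrow> (\<lambda>l. complex_of_real (b l) * \<phi> l) \<in> l2"
proof -
  assume *: "\<phi> \<in> l2"
  obtain C where "\<forall>l. \<bar>b l\<bar> \<le> C"
    using bounded unfolding bounded_parameters_bound by blast
  then show "(\<lambda>l. complex_of_real (b l) * \<phi> l) \<in> l2"
    using * by (intro l2_mult_bounded[where C = C]) auto
qed

lemma jacobi_operator_l2: "\<phi> \<in> l2 \<Longrightarrow> jacobi_operator a b \<phi> \<in> l2"
  unfolding jacobi_operator_eq_hops by (intro l2_add l2_sum hop_l2 site_l2)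

lemma bounded_symmetric_jacobi_operator:
  assumes sym: "nn_symmetric a"
  shows "bounded_symmetric (jacobi_operator a b)"
  unfolding bounded_symmetric_def
proof (intro conjI ballI allI)
  show "\<phi> \<in> l2 \<Longrightarrow> jacobi_operator a b \<phi> \<in> l2" for \<phi> by (rule jacobi_operator_l2)
  show "jacobi_operator a b (\<phi> + \<psi>) = jacobi_operator a b \<phi> + jacobi_operator a b \<psi>" for \<phi> \<psi>
    by (rule ext) (simp add: jacobi_operator_def plus_fun_def distrib_left sum.distrib)
  show "jacobi_operator a b (cscale c \<phi>) = cscale c (jacobi_operator a b \<phi>)" for c \<phi>
    by (rule ext) (simp add: jacobi_operator_def distrib_left sum_distrib_left mult.left_commute)
  fix \<phi> \<psi> :: "int ^ 'n \<Rightarrow> complex" assume \<phi>: "\<phi> \<in> l2" and \<psi>: "\<psi> \<in> l2"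
  have hop_adjoint: "l2_inner \<phi> (hop a d \<psi>) = l2_inner (hop a (- d) \<phi>) \<psi>" if d: "d \<in> unit_steps" for d
  proof -
    have "l2_inner (hop a (- d) \<phi>) \<psi> = (\<Sum>\<^sub>\<infinity>l. cnj (hop a (- d) \<phi> (l + d)) * \<psi> (l + d))"
      unfolding l2_inner_def by (rule infsum_reindex_bij_betw[OF bij_translation, symmetric])
    also have "\<dots> = l2_inner \<phi> (hop a d \<psi>)"
      unfolding l2_inner_def
    proof (rule infsum_cong)
      fix l
      have "a (l + d) l = a l (l + d)"
        using sym nearest_neighbors_step[OF d, of l] unfolding nn_symmetric_def by metis
      then show "cnj (hop a (- d) \<phi> (l + d)) * \<psi> (l + d) = cnj (\<phi> l) * hop a d \<psi> l"
        by (simp add: hop_def)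
    qed
    finally show ?thesis by simp
  qed
  have inner_right: "l2_inner \<xi> (jacobi_operator a b \<omega>)
      = (\<Sum>d\<in>unit_steps. l2_inner \<xi> (hop a d \<omega>)) + l2_inner \<xi> (\<lambda>l. complex_of_real (b l) * \<omega> l)"
    if "\<xi> \<in> l2" "\<omega> \<in> l2" for \<xi> \<omega>
    unfolding jacobi_operator_eq_hops using that
    by (subst l2_inner_add_right) (auto intro: l2_sum hop_l2 site_l2 l2_inner_sum_right)
  have "l2_inner \<phi> (jacobi_operator a b \<psi>)
      = (\<Sum>d\<in>unit_steps. l2_inner (hop a (- d) \<phi>) \<psi>) + l2_inner \<phi> (\<lambda>l. complex_of_real (b l) * \<psi> l)"
    by (simp add: inner_right \<phi> \<psi> hop_adjoint)
  also have "(\<Sum>d\<in>unit_steps. l2_inner (hop a (- d) \<phi>) \<psi>) = (\<Sum>d\<in>unit_steps. l2_inner (hop a d \<phi>) \<psi>)"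
    by (rule sum_unit_steps_uminus)
  also have "\<dots> = cnj (\<Sum>d\<in>unit_steps. l2_inner \<psi> (hop a d \<phi>))"
    by (simp add: l2_inner_cnj[of _ \<psi>])
  also have "l2_inner \<phi> (\<lambda>l. complex_of_real (b l) * \<psi> l) = cnj (l2_inner \<psi> (\<lambda>l. complex_of_real (b l) * \<phi> l))"
    unfolding l2_inner_cnj[symmetric] by (simp add: l2_inner_def mult_ac)
  also have "cnj (\<Sum>d\<in>unit_steps. l2_inner \<psi> (hop a d \<phi>)) + cnj (l2_inner \<psi> (\<lambda>l. complex_of_real (b l) * \<phi> l))
      = cnj (l2_inner \<psi> (jacobi_operator a b \<phi>))"
    by (simp add: inner_right \<phi> \<psi>)
  also have "\<dots> = l2_inner (jacobi_operator a b \<phi>) \<psi>"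
    by (rule l2_inner_cnj[symmetric])
  finally show "l2_inner \<phi> (jacobi_operator a b \<psi>) = l2_inner (jacobi_operator a b \<phi>) \<psi>" .
next
  obtain C where C: "\<forall>d\<in>unit_steps. \<forall>l. \<bar>a l (l + d)\<bar> \<le> C" "\<forall>l. \<bar>b l\<bar> \<le> C"
    using bounded unfolding bounded_parameters_bound by blast
  have "l2_norm (jacobi_operator a b \<phi>) \<le> (real (card (unit_steps :: (int ^ 'n) set)) * C + C) * l2_norm \<phi>" if \<phi>: "\<phi> \<in> l2" for \<phi>
  proof -
    have "l2_norm (jacobi_operator a b \<phi>)
        \<le> l2_norm (\<Sum>d\<in>unit_steps. hop a d \<phi>) + l2_norm (\<lambda>l. complex_of_real (b l) * \<phi> l)"
      unfolding jacobi_operator_eq_hops using \<phi> by (intro l2_norm_triangle l2_sum hop_l2 site_l2)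
    also have "l2_norm (\<Sum>d\<in>unit_steps. hop a d \<phi>) \<le> (\<Sum>d\<in>unit_steps. l2_norm (hop a d \<phi>))"
      using \<phi> by (intro l2_norm_sum_le hop_l2)
    also have "\<dots> \<le> (\<Sum>d\<in>(unit_steps :: (int ^ 'n) set). C * l2_norm \<phi>)"
    proof (rule sum_mono)
      fix d :: "int ^ 'n" assume d: "d \<in> unit_steps"
      have "l2_norm (hop a d \<phi>) \<le> C * l2_norm (\<lambda>l. \<phi> (l + d))"
        unfolding hop_def using C d \<phi> by (intro l2_norm_mult_le l2_translate) auto
      then show "l2_norm (hop a d \<phi>) \<le> C * l2_norm \<phi>" by (simp add: l2_translate \<phi>)
    qed
    also have "l2_norm (\<lambda>l. complex_of_real (b l) * \<phi> l) \<le> C * l2_norm \<phi>"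
      using C \<phi> by (intro l2_norm_mult_le) auto
    finally show ?thesis by (simp add: algebra_simps)
  qed
  then show "\<exists>C. \<forall>\<phi>\<in>l2. l2_norm (jacobi_operator a b \<phi>) \<le> C * l2_norm \<phi>" by blast
qed

lemma bond_summable:
  assumes "\<phi> \<in> l2" "d \<in> unit_steps"
  shows "(\<lambda>l. a l (l + d) * Re (cnj (\<phi> l) * \<phi> (l + d))) summable_on UNIV"
  using summable_on_Re[OF l2_inner_summable[OF assms(1) hop_l2[OF assms]]]
  by (simp add: hop_def algebra_simps)

lemma site_summable:
  assumes "\<phi> \<in> l2"
  shows "(\<lambda>l. b l * (cmod (\<phi> l))\<^sup>2) summable_on UNIV"
  using summable_on_Re[OF l2_inner_summable[OF assms(1) site_l2[OF assms]]]
  by (simp only: Re_cnj_mult_real)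

lemma jacobi_form:
  assumes \<phi>: "\<phi> \<in> l2"
  shows "Re (l2_inner \<phi> (jacobi_operator a b \<phi>))
    = (\<Sum>d\<in>unit_steps. \<Sum>\<^sub>\<infinity>l. a l (l + d) * Re (cnj (\<phi> l) * \<phi> (l + d))) + (\<Sum>\<^sub>\<infinity>l. b l * (cmod (\<phi> l))\<^sup>2)"
proof -
  have "l2_inner \<phi> (jacobi_operator a b \<phi>)
      = (\<Sum>d\<in>unit_steps. l2_inner \<phi> (hop a d \<phi>)) + l2_inner \<phi> (\<lambda>l. complex_of_real (b l) * \<phi> l)"
    unfolding jacobi_operator_eq_hops using \<phi>
    by (subst l2_inner_add_right) (auto intro: l2_sum hop_l2 site_l2 l2_inner_sum_right)
  moreover have "Re (l2_inner \<phi> (hop a d \<phi>)) = (\<Sum>\<^sub>\<infinity>l. a l (l + d) * Re (cnj (\<phi> l) * \<phi> (l + d)))"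
    if "d \<in> unit_steps" for d
    unfolding l2_inner_def infsum_Re[OF l2_inner_summable[OF \<phi> hop_l2[OF \<phi> that]], symmetric]
    by (simp add: hop_def algebra_simps)
  moreover have "Re (l2_inner \<phi> (\<lambda>l. complex_of_real (b l) * \<phi> l)) = (\<Sum>\<^sub>\<infinity>l. b l * (cmod (\<phi> l))\<^sup>2)"
    unfolding l2_inner_def infsum_Re[OF l2_inner_summable[OF \<phi> site_l2[OF \<phi>]], symmetric]
    by (simp only: Re_cnj_mult_real)
  ultimately show ?thesis by simp
qed

end


section \<open>Ground state representation\<close>

lemma infsum_sum_finite:
  fixes f :: "'k \<Rightarrow> 'i \<Rightarrow> real"
  assumes "\<And>k. k \<in> K \<Longrightarrow> f k summable_on A"
  shows "(\<lambda>i. \<Sum>k\<in>K. f k i) summable_on A" "(\<Sum>\<^sub>\<infinity>i\<in>A. \<Sum>k\<in>K. f k i) = (\<Sum>k\<in>K. \<Sum>\<^sub>\<infinity>i\<in>A. f k i)"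
proof -
  have "(\<lambda>i. \<Sum>k\<in>K. f k i) summable_on A \<and> (\<Sum>\<^sub>\<infinity>i\<in>A. \<Sum>k\<in>K. f k i) = (\<Sum>k\<in>K. \<Sum>\<^sub>\<infinity>i\<in>A. f k i)"
    using assms by (induction K rule: infinite_finite_induct) (auto simp: summable_on_add infsum_add)
  then show "(\<lambda>i. \<Sum>k\<in>K. f k i) summable_on A" "(\<Sum>\<^sub>\<infinity>i\<in>A. \<Sum>k\<in>K. f k i) = (\<Sum>k\<in>K. \<Sum>\<^sub>\<infinity>i\<in>A. f k i)"
    by auto
qed

text \<open>
  A quantity \<open>g d l\<close> attached to the start of the directed bond from \<open>l\<close> to \<open>l + d\<close> has the same total when it is
  attached to the end, because the bond can be read backwards.
\<close>

lemma sum_bonds_reversed: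
  fixes g :: "int ^ 'n \<Rightarrow> int ^ 'n \<Rightarrow> real"
  assumes "\<And>d. d \<in> unit_steps \<Longrightarrow> g d summable_on UNIV"
  shows "\<And>d. d \<in> unit_steps \<Longrightarrow> (\<lambda>l. g (- d) (l + d)) summable_on UNIV"
    and "(\<Sum>d\<in>unit_steps. \<Sum>\<^sub>\<infinity>l. g (- d) (l + d)) = (\<Sum>d\<in>unit_steps. \<Sum>\<^sub>\<infinity>l. g d l)"
proof -
  show "(\<lambda>l. g (- d) (l + d)) summable_on UNIV" if "d \<in> unit_steps" for d
    using assms[OF uminus_unit_steps[OF that]] summable_on_reindex_bij_betw[OF bij_translation[of d], of "g (- d)"] by simp
  have "(\<Sum>d\<in>unit_steps. \<Sum>\<^sub>\<infinity>l. g (- d) (l + d)) = (\<Sum>d\<in>unit_steps. \<Sum>\<^sub>\<infinity>l. g (- d) l)"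
    by (intro sum.cong refl infsum_reindex_bij_betw[OF bij_translation])
  also have "\<dots> = (\<Sum>d\<in>unit_steps. \<Sum>\<^sub>\<infinity>l. g d l)"
    by (rule sum_unit_steps_uminus)
  finally show "(\<Sum>d\<in>unit_steps. \<Sum>\<^sub>\<infinity>l. g (- d) (l + d)) = (\<Sum>d\<in>unit_steps. \<Sum>\<^sub>\<infinity>l. g d l)" .
qed

text \<open>
  For \<open>\<phi> = u f\<close> this is \<open>a u(l) u(m) |f(l) - f(m)|\<^sup>2\<close> with \<open>m = l + d\<close>. Each undirected bond occurs twice, once
  in each direction.
\<close>

definition bond_energy :: "(int ^ 'n \<Rightarrow> int ^ 'n \<Rightarrow> real) \<Rightarrow> (int ^ 'n \<Rightarrow> real) \<Rightarrow> (int ^ 'n \<Rightarrow> complex) \<Rightarrow> int ^ 'n \<Rightarrow> int ^ 'n \<Rightarrow> real" where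
  "bond_energy a u \<phi> d l = a l (l + d) * u l * u (l + d) * (cmod (\<phi> l / u l - \<phi> (l + d) / u (l + d)))\<^sup>2"

lemma weighted_difference_square:
  fixes s t :: real and p q :: complex
  assumes "0 < s" "0 < t"
  shows "s * t * (cmod (p / s - q / t))\<^sup>2 = t / s * (cmod p)\<^sup>2 + s / t * (cmod q)\<^sup>2 - 2 * Re (cnj p * q)"
  unfolding cmod_power2 using assms
  by simp (simp add: field_simps power2_eq_square)

text \<open>
  Expanding the square gives two diagonal terms and a hopping term. The diagonal terms have equal totals, which the
  equation for \<open>u\<close> turns into the potential term of the form. Since they are nonnegative and add up to
  \<open>- b |\<phi>|\<^sup>2\<close> at each site, all sums converge absolutely for every square-summable \<open>\<phi>\<close>.
\<close>

lemma ground_state_representation: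
  fixes a :: "int ^ 'n \<Rightarrow> int ^ 'n \<Rightarrow> real"
  assumes jacobi: "bounded_jacobi_parameters a b" and u: "\<And>l. u l > 0"
    and harmonic: "\<And>l. (\<Sum>m | nearest_neighbors l m. a l m * u m) + b l * u l = 0"
    and \<phi>: "\<phi> \<in> l2"
  shows "\<And>d. d \<in> unit_steps \<Longrightarrow> bond_energy a u \<phi> d summable_on UNIV"
    and "Re (l2_inner \<phi> (jacobi_operator a b \<phi>)) = - (\<Sum>d\<in>unit_steps. \<Sum>\<^sub>\<infinity>l. bond_energy a u \<phi> d l) / 2"
proof -
  have bounded: "bounded_parameters a b" and sym: "nn_symmetric a" and pos: "nn_positive a"
    using jacobi by (simp_all add: bounded_jacobi_parameters_def)
  have a_pos: "0 < a l (l + d)" if "d \<in> unit_steps" for l d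
    using pos nearest_neighbors_step[OF that, of l] unfolding nn_positive_def by blast
  have a_sym: "a (l + d) l = a l (l + d)" if "d \<in> unit_steps" for l d
    using sym nearest_neighbors_step[OF that, of l] unfolding nn_symmetric_def by metis
  define g where "g d l = a l (l + d) * (u (l + d) / u l) * (cmod (\<phi> l))\<^sup>2" for d l
  define h where "h d l = a l (l + d) * Re (cnj (\<phi> l) * \<phi> (l + d))" for d l
  have g_nonneg: "0 \<le> g d l" if "d \<in> unit_steps" for d l
    using a_pos[OF that, of l] u[of l] u[of "l + d"] by (simp add: g_def)
  have g_sum: "(\<Sum>d\<in>unit_steps. g d l) = - b l * (cmod (\<phi> l))\<^sup>2" for l
  proof -
    have "(\<Sum>d\<in>unit_steps. a l (l + d) * u (l + d)) = - b l * u l"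
      using harmonic[of l] by (simp add: sum_nearest_neighbors)
    moreover have "(\<Sum>d\<in>unit_steps. g d l) = (\<Sum>d\<in>unit_steps. a l (l + d) * u (l + d)) / u l * (cmod (\<phi> l))\<^sup>2"
      by (simp add: g_def sum_divide_distrib sum_distrib_right)
    ultimately show ?thesis using u[of l] by simp
  qed
  have site: "(\<lambda>l. b l * (cmod (\<phi> l))\<^sup>2) summable_on UNIV"
    by (rule site_summable[OF bounded \<phi>])
  have g_summable: "g d summable_on UNIV" if d: "d \<in> unit_steps" for d
  proof (rule summable_on_comparison_test)
    show "(\<lambda>l. - b l * (cmod (\<phi> l))\<^sup>2) summable_on UNIV"
      using summable_on_cmult_right[OF site, of "-1"] by simp
    show "g d l \<le> - b l * (cmod (\<phi> l))\<^sup>2" for l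
      unfolding g_sum[symmetric] by (rule member_le_sum) (use d g_nonneg finite_unit_steps in auto)
  qed (rule g_nonneg[OF d])
  have h_summable: "h d summable_on UNIV" if d: "d \<in> unit_steps" for d
    using bond_summable[OF bounded \<phi> d] by (simp add: h_def[abs_def])
  have rev1: "(\<lambda>l. g (- d) (l + d)) summable_on UNIV" if "d \<in> unit_steps" for d
    using sum_bonds_reversed(1)[of g] g_summable that by blast
  have rev2: "(\<Sum>d\<in>unit_steps. \<Sum>\<^sub>\<infinity>l. g (- d) (l + d)) = (\<Sum>d\<in>unit_steps. \<Sum>\<^sub>\<infinity>l. g d l)"
    using sum_bonds_reversed(2)[of g] g_summable by blast
  have energy: "bond_energy a u \<phi> d l = (g d l + g (- d) (l + d)) + (- 2) * h d l" if "d \<in> unit_steps" for d l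
  proof -
    have "bond_energy a u \<phi> d l = a l (l + d) * (u l * u (l + d) * (cmod (\<phi> l / u l - \<phi> (l + d) / u (l + d)))\<^sup>2)"
      by (simp add: bond_energy_def mult.assoc)
    also have "\<dots> = (g d l + g (- d) (l + d)) + (- 2) * h d l"
      unfolding weighted_difference_square[OF u u] using a_sym[OF that, of l]
      by (simp add: g_def h_def distrib_left right_diff_distrib)
    finally show ?thesis .
  qed
  have summable_gg: "(\<lambda>l. g d l + g (- d) (l + d)) summable_on UNIV" if "d \<in> unit_steps" for d
    by (intro summable_on_add g_summable rev1 that)
  have summable_h: "(\<lambda>l. (- 2) * h d l) summable_on UNIV" if "d \<in> unit_steps" for d
    by (intro summable_on_cmult_right h_summable that)
  show "bond_energy a u \<phi> d summable_on UNIV" if "d \<in> unit_steps" for d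
    using summable_on_add[OF summable_gg[OF that] summable_h[OF that]] energy[OF that]
    by (simp cong: summable_on_cong)
  have "(\<Sum>\<^sub>\<infinity>l. bond_energy a u \<phi> d l)
      = ((\<Sum>\<^sub>\<infinity>l. g d l) + (\<Sum>\<^sub>\<infinity>l. g (- d) (l + d))) + (- 2) * (\<Sum>\<^sub>\<infinity>l. h d l)" if "d \<in> unit_steps" for d
    unfolding energy[OF that] infsum_add[OF summable_gg[OF that] summable_h[OF that]]
      infsum_add[OF g_summable[OF that] rev1[OF that]] infsum_cmult_right' ..
  then have "(\<Sum>d\<in>unit_steps. \<Sum>\<^sub>\<infinity>l. bond_energy a u \<phi> d l)
      = 2 * (\<Sum>d\<in>unit_steps. \<Sum>\<^sub>\<infinity>l. g d l) - 2 * (\<Sum>d\<in>unit_steps. \<Sum>\<^sub>\<infinity>l. h d l)"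
    by (simp add: sum.distrib sum_subtractf sum_negf rev2 sum_distrib_left[symmetric])
  moreover have "(\<Sum>d\<in>unit_steps. \<Sum>\<^sub>\<infinity>l. g d l) = - (\<Sum>\<^sub>\<infinity>l. b l * (cmod (\<phi> l))\<^sup>2)"
  proof -
    have "(\<Sum>d\<in>unit_steps. \<Sum>\<^sub>\<infinity>l. g d l) = (\<Sum>\<^sub>\<infinity>l. \<Sum>d\<in>unit_steps. g d l)"
      using infsum_sum_finite(2)[of unit_steps g UNIV] g_summable by simp
    then show ?thesis unfolding g_sum by (simp add: infsum_uminus)
  qed
  moreover have "Re (l2_inner \<phi> (jacobi_operator a b \<phi>))
      = (\<Sum>d\<in>unit_steps. \<Sum>\<^sub>\<infinity>l. h d l) + (\<Sum>\<^sub>\<infinity>l. b l * (cmod (\<phi> l))\<^sup>2)"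
    unfolding h_def by (rule jacobi_form[OF bounded \<phi>])
  ultimately show "Re (l2_inner \<phi> (jacobi_operator a b \<phi>)) = - (\<Sum>d\<in>unit_steps. \<Sum>\<^sub>\<infinity>l. bond_energy a u \<phi> d l) / 2"
    by simp
qed

lemma bounded_parameters_potential:
  fixes a :: "int ^ 'n \<Rightarrow> int ^ 'n \<Rightarrow> real"
  assumes "bounded_parameters a b"
  shows "bounded_parameters (\<lambda>l m. 0 :: real) (\<lambda>l. \<bar>b l\<bar> + (\<Sum>m | nearest_neighbors l m. \<bar>a l m\<bar>))"
proof -
  obtain C where C: "\<forall>d\<in>unit_steps. \<forall>l. \<bar>a l (l + d)\<bar> \<le> C" "\<forall>l. \<bar>b l\<bar> \<le> C"
    using assms unfolding bounded_parameters_bound by blast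
  define K where "K = C + real (card (unit_steps :: (int ^ 'n) set)) * C"
  have K: "\<bar>\<bar>b l\<bar> + (\<Sum>m | nearest_neighbors l m. \<bar>a l m\<bar>)\<bar> \<le> K" for l
  proof -
    have "(\<Sum>m | nearest_neighbors l m. \<bar>a l m\<bar>) \<le> (\<Sum>d\<in>(unit_steps :: (int ^ 'n) set). C)"
      unfolding sum_nearest_neighbors using C(1) by (intro sum_mono) blast
    moreover have "0 \<le> (\<Sum>m | nearest_neighbors l m. \<bar>a l m\<bar>)" by (intro sum_nonneg) simp
    ultimately show ?thesis using C(2)[rule_format, of l] by (simp add: K_def)
  qed
  then have "0 \<le> K" using abs_ge_zero order_trans by blast
  then show ?thesis
    unfolding bounded_parameters_bound using K by (intro exI[of _ K]) auto
qed

text \<open>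
  Each hopping term is at most the mean of the weights at its two ends. Reversing bonds collects the weights at the
  starting points.
\<close>

lemma jacobi_form_le_potential:
  fixes a :: "int ^ 'n \<Rightarrow> int ^ 'n \<Rightarrow> real"
  assumes bounded: "bounded_parameters a b" and sym: "nn_symmetric a" and \<phi>: "\<phi> \<in> l2"
  shows "Re (l2_inner \<phi> (jacobi_operator a b \<phi>))
     \<le> (\<Sum>\<^sub>\<infinity>l. (\<bar>b l\<bar> + (\<Sum>m | nearest_neighbors l m. \<bar>a l m\<bar>)) * (cmod (\<phi> l))\<^sup>2)"
proof -
  have a_sym: "a (l + d) l = a l (l + d)" if "d \<in> unit_steps" for l d
    using sym nearest_neighbors_step[OF that, of l] unfolding nn_symmetric_def by metis
  define W where "W l = \<bar>b l\<bar> + (\<Sum>m | nearest_neighbors l m. \<bar>a l m\<bar>)" for l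
  have W: "(\<lambda>l. W l * (cmod (\<phi> l))\<^sup>2) summable_on UNIV"
    unfolding W_def by (rule site_summable[OF bounded_parameters_potential[OF bounded] \<phi>])
  define g where "g d l = \<bar>a l (l + d)\<bar> * (cmod (\<phi> l))\<^sup>2" for d l
  have W_eq: "W l * (cmod (\<phi> l))\<^sup>2 = \<bar>b l\<bar> * (cmod (\<phi> l))\<^sup>2 + (\<Sum>d\<in>unit_steps. g d l)" for l
    by (simp add: W_def g_def sum_nearest_neighbors distrib_right sum_distrib_right)
  have g_summable: "g d summable_on UNIV" if d: "d \<in> unit_steps" for d
  proof (rule summable_on_comparison_test[OF W])
    show "g d l \<le> W l * (cmod (\<phi> l))\<^sup>2" for l
    proof -
      have "g d l \<le> (\<Sum>d\<in>unit_steps. g d l)"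
        by (rule member_le_sum) (use d finite_unit_steps in \<open>auto simp: g_def\<close>)
      then show ?thesis unfolding W_eq by (simp add: add_increasing)
    qed
  qed (simp add: g_def)
  have b_summable: "(\<lambda>l. \<bar>b l\<bar> * (cmod (\<phi> l))\<^sup>2) summable_on UNIV"
    by (rule summable_on_comparison_test[OF W]) (auto simp: W_eq g_def intro!: sum_nonneg)
  have rev1: "(\<lambda>l. g (- d) (l + d)) summable_on UNIV" if "d \<in> unit_steps" for d
    using sum_bonds_reversed(1)[of g] g_summable that by blast
  have rev2: "(\<Sum>d\<in>unit_steps. \<Sum>\<^sub>\<infinity>l. g (- d) (l + d)) = (\<Sum>d\<in>unit_steps. \<Sum>\<^sub>\<infinity>l. g d l)"
    using sum_bonds_reversed(2)[of g] g_summable by blast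
  have bond: "(\<Sum>\<^sub>\<infinity>l. a l (l + d) * Re (cnj (\<phi> l) * \<phi> (l + d))) \<le> ((\<Sum>\<^sub>\<infinity>l. g d l) + (\<Sum>\<^sub>\<infinity>l. g (- d) (l + d))) / 2"
    if d: "d \<in> unit_steps" for d
  proof -
    have "(\<Sum>\<^sub>\<infinity>l. a l (l + d) * Re (cnj (\<phi> l) * \<phi> (l + d))) \<le> (\<Sum>\<^sub>\<infinity>l. (1 / 2) * (g d l + g (- d) (l + d)))"
    proof (rule infsum_mono)
      show "(\<lambda>l. a l (l + d) * Re (cnj (\<phi> l) * \<phi> (l + d))) summable_on UNIV"
        by (rule bond_summable[OF bounded \<phi> d])
      show "(\<lambda>l. (1 / 2) * (g d l + g (- d) (l + d))) summable_on UNIV"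
        by (intro summable_on_cmult_right summable_on_add g_summable rev1 d)
      show "a l (l + d) * Re (cnj (\<phi> l) * \<phi> (l + d)) \<le> (1 / 2) * (g d l + g (- d) (l + d))" for l
      proof -
        have "\<bar>Re (cnj (\<phi> l) * \<phi> (l + d))\<bar> \<le> cmod (\<phi> l) * cmod (\<phi> (l + d))"
          using abs_Re_le_cmod[of "cnj (\<phi> l) * \<phi> (l + d)"] by (simp add: norm_mult)
        also have "\<dots> \<le> ((cmod (\<phi> l))\<^sup>2 + (cmod (\<phi> (l + d)))\<^sup>2) / 2"
          using sum_squares_bound[of "cmod (\<phi> l)" "cmod (\<phi> (l + d))"] by simp
        finally have "\<bar>a l (l + d)\<bar> * \<bar>Re (cnj (\<phi> l) * \<phi> (l + d))\<bar>
            \<le> \<bar>a l (l + d)\<bar> * (((cmod (\<phi> l))\<^sup>2 + (cmod (\<phi> (l + d)))\<^sup>2) / 2)"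
          by (intro mult_left_mono) auto
        moreover have "\<bar>a l (l + d)\<bar> * (((cmod (\<phi> l))\<^sup>2 + (cmod (\<phi> (l + d)))\<^sup>2) / 2) = (1 / 2) * (g d l + g (- d) (l + d))"
          using a_sym[OF d, of l] by (simp add: g_def algebra_simps)
        ultimately show ?thesis
          using abs_ge_self[of "a l (l + d) * Re (cnj (\<phi> l) * \<phi> (l + d))"] unfolding abs_mult by linarith
      qed
    qed
    also have "\<dots> = ((\<Sum>\<^sub>\<infinity>l. g d l) + (\<Sum>\<^sub>\<infinity>l. g (- d) (l + d))) / 2"
      unfolding infsum_cmult_right' infsum_add[OF g_summable[OF d] rev1[OF d]] by simp
    finally show ?thesis .
  qed
  have "Re (l2_inner \<phi> (jacobi_operator a b \<phi>))
      \<le> (\<Sum>d\<in>unit_steps. ((\<Sum>\<^sub>\<infinity>l. g d l) + (\<Sum>\<^sub>\<infinity>l. g (- d) (l + d))) / 2) + (\<Sum>\<^sub>\<infinity>l. \<bar>b l\<bar> * (cmod (\<phi> l))\<^sup>2)"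
    unfolding jacobi_form[OF bounded \<phi>]
    by (intro add_mono sum_mono bond infsum_mono site_summable[OF bounded \<phi>] b_summable mult_right_mono) auto
  also have "(\<Sum>d\<in>unit_steps. ((\<Sum>\<^sub>\<infinity>l. g d l) + (\<Sum>\<^sub>\<infinity>l. g (- d) (l + d))) / 2) = (\<Sum>d\<in>unit_steps. \<Sum>\<^sub>\<infinity>l. g d l)"
    unfolding sum_divide_distrib[symmetric] sum.distrib rev2 by simp
  also have "(\<Sum>d\<in>unit_steps. \<Sum>\<^sub>\<infinity>l. g d l) + (\<Sum>\<^sub>\<infinity>l. \<bar>b l\<bar> * (cmod (\<phi> l))\<^sup>2) = (\<Sum>\<^sub>\<infinity>l. W l * (cmod (\<phi> l))\<^sup>2)"
  proof -
    have "(\<lambda>l. \<Sum>d\<in>unit_steps. g d l) summable_on UNIV"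
      "(\<Sum>\<^sub>\<infinity>l. \<Sum>d\<in>unit_steps. g d l) = (\<Sum>d\<in>unit_steps. \<Sum>\<^sub>\<infinity>l. g d l)"
      using infsum_sum_finite[of unit_steps g UNIV] g_summable by auto
    then show ?thesis
      unfolding W_eq by (simp add: infsum_add b_summable)
  qed
  finally show ?thesis by (simp add: W_def)
qed

lemma jacobi_form_add:
  assumes "bounded_parameters a b" "bounded_parameters a' b'" "\<phi> \<in> l2"
  shows "l2_inner \<phi> (jacobi_operator (\<lambda>l m. a l m + a' l m) (\<lambda>l. b l + b' l) \<phi>)
    = l2_inner \<phi> (jacobi_operator a b \<phi>) + l2_inner \<phi> (jacobi_operator a' b' \<phi>)"
proof -
  have "jacobi_operator (\<lambda>l m. a l m + a' l m) (\<lambda>l. b l + b' l) \<phi> = jacobi_operator a b \<phi> + jacobi_operator a' b' \<phi>"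
    by (rule ext) (simp add: jacobi_operator_def plus_fun_def distrib_right sum.distrib)
  then show ?thesis
    using assms by (simp add: l2_inner_add_right jacobi_operator_l2)
qed

lemma jacobi_form_scale:
  "Re (l2_inner \<phi> (jacobi_operator (\<lambda>l m. c * a l m) (\<lambda>l. c * b l) \<phi>)) = c * Re (l2_inner \<phi> (jacobi_operator a b \<phi>))"
proof -
  have "jacobi_operator (\<lambda>l m. c * a l m) (\<lambda>l. c * b l) \<phi> = cscale (complex_of_real c) (jacobi_operator a b \<phi>)"
    by (rule ext) (simp add: jacobi_operator_def distrib_left sum_distrib_left mult.assoc)
  then show ?thesis
    by (simp add: l2_inner_cnj[of \<phi>] l2_inner_cscale_left)
qed


section \<open>Comparison of eigenvalues\<close>

theorem theorem4p1:
  fixes a0 a1 \<delta>a :: "int ^ 'n \<Rightarrow> int ^ 'n \<Rightarrow> real"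
    and b0 b1 \<delta>b u0 u1 :: "int ^ 'n \<Rightarrow> real"
    and \<beta>_plus \<beta>_minus \<gamma>_minus \<eta> \<beta> :: real
    and j :: nat
  assumes "bounded_jacobi_parameters a0 b0"
    and "bounded_jacobi_parameters a1 b1"
    and "\<And>l. u0 l > 0"
    and "\<And>l. u1 l > 0"
    and "\<And>l. (\<Sum>m | nearest_neighbors l m. a0 l m * u0 m) + b0 l * u0 l = 0"
    and "\<And>l. (\<Sum>m | nearest_neighbors l m. a1 l m * u1 m) + b1 l * u1 l = 0"
    and "bdd_above (range (\<lambda>l. (u0 l / u1 l)\<^sup>2))"
    and "\<beta>_plus = (SUP l. (u0 l / u1 l)\<^sup>2)"
    and "\<beta>_minus = (INF l. (u0 l / u1 l)\<^sup>2)"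
    and "\<gamma>_minus = Inf {(a0 k l * u0 k * u0 l) / (a1 k l * u1 k * u1 l) | k l. nearest_neighbors k l}"
    and "\<beta>_minus > 0"
    and "\<eta> = \<gamma>_minus / \<beta>_minus"
    and "\<beta> = \<beta>_plus / \<beta>_minus"
    and "nn_symmetric \<delta>a"
    and "bounded_parameters (\<lambda>l m. a0 l m + \<delta>a l m) (\<lambda>l. b0 l + \<delta>b l)"
    and "nn_positive (\<lambda>l m. a0 l m + \<delta>a l m)"
    and "j \<ge> 1"
  shows "jacobi_E j (\<lambda>l m. a0 l m + \<delta>a l m) (\<lambda>l. b0 l + \<delta>b l)
      \<le> jacobi_E j (\<lambda>l m. \<eta> * a1 l m)
           (\<lambda>l. \<eta> * b1 l + \<beta> * (\<bar>\<delta>b l\<bar> + (\<Sum>m | nearest_neighbors l m. \<bar>\<delta>a l m\<bar>)))"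
proof -
  note jac0 = assms(1) and jac1 = assms(2) and u0 = assms(3) and u1 = assms(4)
  have sym0: "nn_symmetric a0" and pos0: "nn_positive a0" and bdd0: "bounded_parameters a0 b0"
    using jac0 by (simp_all add: bounded_jacobi_parameters_def)
  have sym1: "nn_symmetric a1" and pos1: "nn_positive a1" and bdd1: "bounded_parameters a1 b1"
    using jac1 by (simp_all add: bounded_jacobi_parameters_def)
  have bdd\<delta>: "bounded_parameters \<delta>a \<delta>b"
    using bounded_parameters_add[OF assms(15) bounded_parameters_scale[OF bdd0, of "-1"]] by simp
  define W where "W l = \<bar>\<delta>b l\<bar> + (\<Sum>m | nearest_neighbors l m. \<bar>\<delta>a l m\<bar>)" for l
  have bddW: "bounded_parameters (\<lambda>l m. 0 :: real) W"
    unfolding W_def using bdd\<delta> by (rule bounded_parameters_potential)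
  define A where "A = jacobi_operator (\<lambda>l m. a0 l m + \<delta>a l m) (\<lambda>l. b0 l + \<delta>b l)"
  define A' where "A' = jacobi_operator (\<lambda>l m. \<eta> * a1 l m) (\<lambda>l. \<eta> * b1 l + \<beta> * W l)"
  have bdd_A': "bounded_parameters (\<lambda>l m. \<eta> * a1 l m) (\<lambda>l. \<eta> * b1 l + \<beta> * W l)"
    using bounded_parameters_add[OF bounded_parameters_scale[OF bdd1, of \<eta>] bounded_parameters_scale[OF bddW, of \<beta>]] by simp
  have A: "bounded_symmetric A"
    unfolding A_def using assms(14) sym0
    by (intro bounded_symmetric_jacobi_operator assms(15)) (unfold nn_symmetric_def, metis)
  have A': "bounded_symmetric A'"
    unfolding A'_def using sym1
    by (intro bounded_symmetric_jacobi_operator bdd_A') (unfold nn_symmetric_def, metis)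

  have \<beta>_plus: "(u0 l / u1 l)\<^sup>2 \<le> \<beta>_plus" for l
    unfolding assms(8) by (rule cSUP_upper[OF UNIV_I assms(7)])
  have \<beta>_minus: "\<beta>_minus \<le> (u0 l / u1 l)\<^sup>2" for l
    unfolding assms(9) by (rule cINF_lower[OF _ UNIV_I]) (auto intro!: bdd_belowI2[where m = 0])
  have \<gamma>_minus: "\<gamma>_minus * (a1 l m * u1 l * u1 m) \<le> a0 l m * u0 l * u0 m" if "nearest_neighbors l m" for l m
  proof -
    have pos: "0 < a1 l m * u1 l * u1 m"
      using pos1 that u1 by (simp add: nn_positive_def)
    have "\<gamma>_minus \<le> (a0 l m * u0 l * u0 m) / (a1 l m * u1 l * u1 m)"
      unfolding assms(10)
    proof (rule cInf_lower)
      show "bdd_below {(a0 k l * u0 k * u0 l) / (a1 k l * u1 k * u1 l) | k l. nearest_neighbors k l}"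
        using pos0 pos1 u0 u1 by (auto simp: nn_positive_def less_imp_le intro!: bdd_belowI[where m = 0])
    qed (use that in blast)
    then show ?thesis using pos by (simp add: pos_le_divide_eq)
  qed

  \<comment> \<open>The map from \<open>u0 f\<close> to \<open>u1 f\<close>.\<close>
  define F where "F \<phi> l = complex_of_real (u1 l / u0 l) * \<phi> l" for \<phi> :: "int ^ 'n \<Rightarrow> complex" and l
  have F_l2: "F \<phi> \<in> l2" if "\<phi> \<in> l2" for \<phi>
    unfolding F_def
  proof (rule l2_mult_bounded[OF that, where C = "sqrt (1 / \<beta>_minus)"])
    fix l
    have "(u1 l / u0 l)\<^sup>2 = 1 / (u0 l / u1 l)\<^sup>2" by (simp add: power_divide)
    also have "\<dots> \<le> 1 / \<beta>_minus" by (intro divide_left_mono \<beta>_minus) (use assms(11) u0 u1 in \<open>simp_all add: less_imp_neq[THEN not_sym]\<close>)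
    finally show "cmod (complex_of_real (u1 l / u0 l)) \<le> sqrt (1 / \<beta>_minus)"
      by (simp only: norm_of_real real_le_rsqrt power2_abs)
  qed
  have quotient: "F \<phi> l / u1 l = \<phi> l / u0 l" for \<phi> l
    using u1[of l] by (simp add: F_def)
  have cmod_F: "(cmod (\<phi> l))\<^sup>2 = (u0 l / u1 l)\<^sup>2 * (cmod (F \<phi> l))\<^sup>2" for \<phi> l
    using u0[of l] u1[of l] by (simp add: F_def norm_mult norm_divide power_mult_distrib power_divide)

  have form: "x * (l2_norm (F \<phi>))\<^sup>2 \<le> Re (l2_inner (F \<phi>) (A' (F \<phi>)))"
    if x: "0 < x" and \<phi>: "\<phi> \<in> l2" and le: "x * (l2_norm \<phi>)\<^sup>2 \<le> Re (l2_inner \<phi> (A \<phi>))" for x \<phi>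
  proof -
    define K0 where "K0 = (\<Sum>d\<in>unit_steps. \<Sum>\<^sub>\<infinity>l. bond_energy a0 u0 \<phi> d l)"
    define K1 where "K1 = (\<Sum>d\<in>unit_steps. \<Sum>\<^sub>\<infinity>l. bond_energy a1 u1 (F \<phi>) d l)"
    define V where "V \<psi> = (\<Sum>\<^sub>\<infinity>l. W l * (cmod (\<psi> l))\<^sup>2)" for \<psi> :: "int ^ 'n \<Rightarrow> complex"
    note ground0 = ground_state_representation[OF jac0 u0 assms(5) \<phi>]
    note ground1 = ground_state_representation[OF jac1 u1 assms(6) F_l2[OF \<phi>]]
    have K: "\<gamma>_minus * K1 \<le> K0"
      unfolding K0_def K1_def sum_distrib_left infsum_cmult_right'[symmetric]
    proof (intro sum_mono infsum_mono summable_on_cmult_right ground0(1) ground1(1))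
      fix d l :: "int ^ 'n" assume d: "d \<in> unit_steps"
      show "\<gamma>_minus * bond_energy a1 u1 (F \<phi>) d l \<le> bond_energy a0 u0 \<phi> d l"
        unfolding bond_energy_def quotient mult.assoc[symmetric, of \<gamma>_minus]
        using mult_right_mono[OF \<gamma>_minus[OF nearest_neighbors_step[OF d, of l]], of "(cmod (\<phi> l / u0 l - \<phi> (l + d) / u0 (l + d)))\<^sup>2"]
        by (simp add: mult.assoc)
    qed
    have V: "V \<phi> \<le> \<beta>_plus * V (F \<phi>)"
      unfolding V_def infsum_cmult_right'[symmetric]
    proof (intro infsum_mono summable_on_cmult_right site_summable[OF bddW] \<phi> F_l2)
      fix l
      have "0 \<le> W l" by (simp add: W_def sum_nonneg)
      then have "(u0 l / u1 l)\<^sup>2 * (W l * (cmod (F \<phi> l))\<^sup>2) \<le> \<beta>_plus * (W l * (cmod (F \<phi> l))\<^sup>2)"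
        by (intro mult_right_mono \<beta>_plus) simp
      then show "W l * (cmod (\<phi> l))\<^sup>2 \<le> \<beta>_plus * (W l * (cmod (F \<phi> l))\<^sup>2)"
        unfolding cmod_F[of \<phi>] by (simp only: mult.left_commute)
    qed
    have norm: "\<beta>_minus * (l2_norm (F \<phi>))\<^sup>2 \<le> (l2_norm \<phi>)\<^sup>2"
    proof -
      have "\<beta>_minus * (\<Sum>\<^sub>\<infinity>l. (cmod (F \<phi> l))\<^sup>2) \<le> (\<Sum>\<^sub>\<infinity>l. (cmod (\<phi> l))\<^sup>2)"
        unfolding infsum_cmult_right'[symmetric]
      proof (intro infsum_mono summable_on_cmult_right l2_summable \<phi> F_l2)
        show "\<beta>_minus * (cmod (F \<phi> l))\<^sup>2 \<le> (cmod (\<phi> l))\<^sup>2" for l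
          unfolding cmod_F[of \<phi>] by (intro mult_right_mono \<beta>_minus) simp
      qed
      then show ?thesis by (simp add: l2_norm_def infsum_nonneg)
    qed
    have "Re (l2_inner \<phi> (A \<phi>)) \<le> - K0 / 2 + V \<phi>"
      unfolding A_def jacobi_form_add[OF bdd0 bdd\<delta> \<phi>] K0_def V_def W_def
      using jacobi_form_le_potential[OF bdd\<delta> assms(14) \<phi>] ground0(2) by simp
    then have upper: "Re (l2_inner \<phi> (A \<phi>)) \<le> \<gamma>_minus * (- K1 / 2) + \<beta>_plus * V (F \<phi>)"
      using K V by simp
    have "Re (l2_inner (F \<phi>) (A' (F \<phi>))) = \<eta> * (- K1 / 2) + \<beta> * V (F \<phi>)"
    proof -
      have "Re (l2_inner (F \<phi>) (A' (F \<phi>))) = Re (l2_inner (F \<phi>) (jacobi_operator (\<lambda>l m. \<eta> * a1 l m) (\<lambda>l. \<eta> * b1 l) (F \<phi>)))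
          + Re (l2_inner (F \<phi>) (jacobi_operator (\<lambda>l m. \<beta> * 0) (\<lambda>l. \<beta> * W l) (F \<phi>)))"
        using jacobi_form_add[OF bounded_parameters_scale[OF bdd1, of \<eta>] bounded_parameters_scale[OF bddW, of \<beta>] F_l2[OF \<phi>]]
        by (simp add: A'_def)
      also have "\<dots> = \<eta> * (- K1 / 2) + \<beta> * V (F \<phi>)"
        unfolding jacobi_form_scale ground1(2) jacobi_form[OF bddW F_l2[OF \<phi>]] K1_def V_def by simp
      finally show ?thesis .
    qed
    \<comment> \<open>This is where \<open>\<eta>\<close> and \<open>\<beta>\<close> get their values: multiplied by \<open>\<beta>_minus\<close> they become the constants of the upper bound.\<close>
    then have "\<beta>_minus * Re (l2_inner (F \<phi>) (A' (F \<phi>))) = \<gamma>_minus * (- K1 / 2) + \<beta>_plus * V (F \<phi>)"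
      using assms(11) by (simp add: assms(12,13) field_simps)
    moreover have "\<beta>_minus * (x * (l2_norm (F \<phi>))\<^sup>2) \<le> x * (l2_norm \<phi>)\<^sup>2"
      using mult_left_mono[OF norm, of x] x by (simp add: mult.left_commute)
    ultimately have "\<beta>_minus * (x * (l2_norm (F \<phi>))\<^sup>2) \<le> \<beta>_minus * Re (l2_inner (F \<phi>) (A' (F \<phi>)))"
      using le upper by linarith
    then show ?thesis using assms(11) by simp
  qed
  have "max 0 (Sup {x. dim_at_least j (spectral_projection A {x..} ` l2)})
      \<le> max 0 (Sup {x. dim_at_least j (spectral_projection A' {x..} ` l2)})"
  proof (rule sup_spectrum_le[OF infinite_lattice A A' assms(17) F_l2 _ _ _ form])
    show "F (\<phi> + \<psi>) = F \<phi> + F \<psi>" for \<phi> \<psi>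
      by (rule ext) (simp add: F_def plus_fun_def distrib_left)
    show "F (cscale c \<phi>) = cscale c (F \<phi>)" for c \<phi>
      by (rule ext) (simp add: F_def mult.left_commute)
    show "\<phi> = 0" if "F \<phi> = 0" for \<phi>
    proof
      fix l
      have "F \<phi> l = 0" using that by (simp add: zero_fun_def)
      then show "\<phi> l = 0 l" using u0[of l] u1[of l] by (simp add: F_def)
    qed
  qed
  then show ?thesis
    by (simp only: jacobi_E_def A_def A'_def W_def)
qed

end
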